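(* Let $\Gamma$ be a finitely generated group and let $(\Omega,\mu)$ be a standard Borel probability $\Gamma$-space. Consider a measurable cocycle $\sigma:\Gamma\times\Omega\to\mathrm{Homeo}^+(\mathbb{S}^1)$. Then $\mathrm{H}^2_b(\sigma)(e^b_{\mathbb{R}})=0$ in $\mathrm{H}^2_b(\Gamma;\mathrm{L}^\infty(\Omega,\mathbb{R}))$ if and only if $\sigma$ is semicohomologous to a measurable cocycle taking values in the rotations subgroup $\mathrm{Rot}\subset\mathrm{Homeo}^+(\mathbb{S}^1)$.
   Context: A standard Borel probability $\Gamma$-space is a standard Borel probability space $(\Omega,\mu)$ with an essentially free, measure preserving action of $\Gamma$. Put $H=\mathrm{Homeo}^+(\mathbb{S}^1)$, the group of orientation preserving homeomorphisms of $\mathbb{S}^1\cong\mathbb{R}/\mathbb{Z}$, with the Borel structure of the compact-open topology; $\mathrm{Rot}\subset H$ is the subgroup of rotations $x\mapsto x+\theta$. A measurable cocycle is a measurable map $\sigma:\Gamma\times\Omega\to H$ with $\sigma(\gamma_1\gamma_2,\omega)=\sigma(\gamma_1,\gamma_2\omega)\sigma(\gamma_2,\omega)$ for every $\gamma_1,\gamma_2\in\Gamma$ and almost every $\omega\in\Omega$. A non-decreasing degree one map $\mathbb{S}^1\to\mathbb{S}^1$ is a (not necessarily continuous) map that weakly preserves the cyclic order of every $k$-tuple of points, for every $k\in\mathbb{N}$; equivalently, it has a lift $\mathbb{R}\to\mathbb{R}$ that is non-decreasing and commutes with integer translations (constant maps are allowed). Semicohomology: $\sigma_1$ is left semicohomologous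 to $\sigma_2$ (equivalently, $\sigma_2$ is right semicohomologous to $\sigma_1$) if there is a measurable map $\varphi:\mathbb{S}^1\times\Omega\to\mathbb{S}^1$ such that $\varphi(\omega):=\varphi(\cdot,\omega)$ is a non-decreasing degree one map for almost every $\omega$ and $\sigma_1(\gamma,\omega)\varphi(\omega)=\varphi(\gamma\omega)\sigma_2(\gamma,\omega)$ for every $\gamma\in\Gamma$ and almost every $\omega\in\Omega$. $\sigma_1$ and $\sigma_2$ are semicohomologous if $\sigma_1$ is both left and right semicohomologous to $\sigma_2$. Bounded cohomology: for a discrete group $G$ and a normed $G$-module $A$ with isometric action, $\mathrm{H}^n_b(G;A)$ is the cohomology of the inhomogeneous complex of bounded functions $\overline{\mathrm{C}}^n_b(G;A)=\{f:G^n\to A \text{ bounded}\}$ with coboundary $(\overline\delta f)(g_1,\dots,g_{n+1})=g_1\cdot f(g_2,\dots,g_{n+1})+\sum_{i=1}^n(-1)^if(g_1,\dots,g_ig_{i+1},\dots,g_{n+1})+(-1)^{n+1}f(g_1,\dots,g_n)$. All groups, including $H$, are regarded as discrete here. $\mathbb{R}$ is a trivial $H$-module; $\mathrm{L}^\infty(\Omega,\mathbb{R})$ has the sup norm and the action $(\gamma f)(\omega)=f(\gamma^{-1}\omega)$. Real bounded Euler class: let $\widetilde H=\mathrm{Homeo}^+_{\mathbb{Z}}(\mathbb{R})$ be the group of orientation preserving homeomorphisms $f$ of $\mathbb{R}$ with $f(x+1)=f(x)+1$, $i:\mathbb{Z}\to\widetilde H$ the inclusion as integer translations, $p:\widetilde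 H\to H$ the projection, and $\overline s:H\to\widetilde H$ the section of $p$ determined by $\overline s(f)(0)\in[0,1)$. Then $\overline\varepsilon:H^2\to\mathbb{Z}$ defined by $\overline s(fg)\,i(\overline\varepsilon(f,g))=\overline s(f)\overline s(g)$ is a bounded cocycle; viewing it as real-valued, $e^b_{\mathbb{R}}=[\overline\varepsilon]\in\mathrm{H}^2_b(H;\mathbb{R})$. Real parametrized Euler class: $\mathrm{H}^2_b(\sigma):\mathrm{H}^2_b(H;\mathbb{R})\to\mathrm{H}^2_b(\Gamma;\mathrm{L}^\infty(\Omega,\mathbb{R}))$ is induced by $\psi\mapsto\big[(\gamma,\lambda)\mapsto\big(\omega\mapsto\psi(\sigma(\gamma^{-1},\omega)^{-1},\sigma(\lambda^{-1},\gamma^{-1}\omega)^{-1})\big)\big]$, and the real parametrized Euler class of $\sigma$ is $\mathrm{H}^2_b(\sigma)(e^b_{\mathbb{R}})$. *)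

theory Defs
  imports
    "HOL-Probability.Probability"
    "HOL-Algebra.Ring"
    "HOL-Algebra.Coset"
    "HOL-Algebra.Generated_Groups"
    "HOL-Algebra.Group_Action"
begin

section \<open>The circle\<close>

quotient_type circle = real / "\<lambda>x y :: real. x - y \<in> \<int>"
proof (rule equivpI)
  show "reflp (\<lambda>x y :: real. x - y \<in> \<int>)"
    by (rule reflpI) simp
  show "symp (\<lambda>x y :: real. x - y \<in> \<int>)"
    by (rule sympI) (metis Ints_minus minus_diff_eq)
  show "transp (\<lambda>x y :: real. x - y \<in> \<int>)"
  proof (rule transpI)
    fix x y z :: real
    assume "x - y \<in> \<int>" "y - z \<in> \<int>"
    then have "(x - y) + (y - z) \<in> \<int>" by (rule Ints_add)
    then show "x - z \<in> \<int>" by simp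
  qed
qed

lift_definition circle_of :: "real \<Rightarrow> circle" is "\<lambda>x. x" .

instantiation circle :: ab_group_add
begin

lift_definition zero_circle :: circle is "0 :: real" .

lift_definition plus_circle :: "circle \<Rightarrow> circle \<Rightarrow> circle" is "(+)"
proof -
  fix a b c d :: real
  assume "a - b \<in> \<int>" "c - d \<in> \<int>"
  then have "(a - b) + (c - d) \<in> \<int>" by (rule Ints_add)
  then show "a + c - (b + d) \<in> \<int>" by (simp add: algebra_simps)
qed

lift_definition uminus_circle :: "circle \<Rightarrow> circle" is uminus
proof -
  fix a b :: real
  assume "a - b \<in> \<int>"
  then have "- (a - b) \<in> \<int>" by (rule Ints_minus)
  then show "- a - - b \<in> \<int>" by simp
qed

lift_definition minus_circle :: "circle \<Rightarrow> circle \<Rightarrow> circle" is "(-)"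
proof -
  fix a b c d :: real
  assume "a - b \<in> \<int>" "c - d \<in> \<int>"
  then have "(a - b) - (c - d) \<in> \<int>" by (rule Ints_diff)
  then show "a - c - (b - d) \<in> \<int>" by (simp add: algebra_simps)
qed

instance
  by standard (transfer; simp)+

end

instantiation circle :: topological_space
begin

definition open_circle :: "circle set \<Rightarrow> bool"
  where "open_circle U \<longleftrightarrow> open (circle_of -` U)"

instance
  by standard (auto simp: open_circle_def vimage_Union)

end


section \<open>Homeomorphisms of the circle\<close>

definition is_lift :: "(real \<Rightarrow> real) \<Rightarrow> (circle \<Rightarrow> circle) \<Rightarrow> bool"
  where "is_lift F f \<longleftrightarrow> (\<forall>x. f (circle_of x) = circle_of (F x))"

definition orientation_preserving :: "(circle \<Rightarrow> circle) \<Rightarrow> bool"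
  where "orientation_preserving f \<longleftrightarrow>
    (\<exists>F. continuous_on UNIV F \<and> strict_mono F \<and> is_lift F f)"

definition Homeo_circle :: "(circle \<Rightarrow> circle) monoid"
  where "Homeo_circle =
    \<lparr>carrier = {f. (\<exists>g. homeomorphism UNIV UNIV f g) \<and> orientation_preserving f},
     mult = (\<circ>), one = id\<rparr>"

definition rotations :: "(circle \<Rightarrow> circle) set"
  where "rotations = {(\<lambda>x. x + \<theta>) |\<theta>. True}"

definition compact_open_topology :: "(circle \<Rightarrow> circle) topology"
  where "compact_open_topology =
    topology_generated_by
      {{f \<in> carrier Homeo_circle. f ` K \<subseteq> U} |K U. compact K \<and> open U}"

definition Homeo_borel :: "(circle \<Rightarrow> circle) measure"
  where "Homeo_borel =
    sigma (carrier Homeo_circle) {U. openin compact_open_topology U}"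

definition Homeo_real :: "(real \<Rightarrow> real) set"
  where "Homeo_real =
    {F. (\<exists>G. homeomorphism UNIV UNIV F G) \<and> strict_mono F \<and> (\<forall>x. F (x + 1) = F x + 1)}"

definition nondecreasing_degree_one :: "(circle \<Rightarrow> circle) \<Rightarrow> bool"
  where "nondecreasing_degree_one f \<longleftrightarrow>
    (\<exists>F. mono F \<and> (\<forall>x. \<forall>k::int. F (x + of_int k) = F x + of_int k) \<and> is_lift F f)"


section \<open>Bounded cohomology of discrete groups\<close>

text \<open>
  Only the additive structure, the norm and the action of a coefficient module enter the
  bounded cochain complex. The ring record is used for its additive notation; below, its
  multiplicative fields hold the usual (pointwise) product.
\<close>

record ('g, 'a) normed_module = "'a ring" +
  nrm :: "'a \<Rightarrow> real"
  gact :: "'g \<Rightarrow> 'a \<Rightarrow> 'a"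

definition tuples :: "'g monoid \<Rightarrow> nat \<Rightarrow> 'g list set"
  where "tuples G n = {gs. length gs = n \<and> set gs \<subseteq> carrier G}"

definition bounded_cochains ::
    "'g monoid \<Rightarrow> ('g, 'a) normed_module \<Rightarrow> nat \<Rightarrow> ('g list \<Rightarrow> 'a) monoid"
  where "bounded_cochains G A n =
    \<lparr>carrier = {f \<in> tuples G n \<rightarrow>\<^sub>E carrier A. \<exists>C. \<forall>gs \<in> tuples G n. nrm A (f gs) \<le> C},
     mult = (\<lambda>f h. \<lambda>gs \<in> tuples G n. f gs \<oplus>\<^bsub>A\<^esub> h gs),
     one = (\<lambda>gs \<in> tuples G n. \<zero>\<^bsub>A\<^esub>)\<rparr>"

text \<open>Lists are indexed from 0, so the entry written $g_i$ in the usual formula is \<open>gs ! (i - 1)\<close>.\<close>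

definition coboundary ::
    "'g monoid \<Rightarrow> ('g, 'a) normed_module \<Rightarrow> nat \<Rightarrow> ('g list \<Rightarrow> 'a) \<Rightarrow> 'g list \<Rightarrow> 'a"
  where "coboundary G A n f = (\<lambda>gs \<in> tuples G (Suc n).
    gact A (hd gs) (f (tl gs))
    \<oplus>\<^bsub>A\<^esub> (\<Oplus>\<^bsub>A\<^esub>i \<in> {1..n}. add_pow A ((-1 :: int) ^ i)
          (f (take (i - 1) gs @ [gs ! (i - 1) \<otimes>\<^bsub>G\<^esub> gs ! i] @ drop (i + 1) gs)))
    \<oplus>\<^bsub>A\<^esub> add_pow A ((-1 :: int) ^ (n + 1)) (f (butlast gs)))"

definition bounded_cocycles ::
    "'g monoid \<Rightarrow> ('g, 'a) normed_module \<Rightarrow> nat \<Rightarrow> ('g list \<Rightarrow> 'a) monoid"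
  where "bounded_cocycles G A n =
    (bounded_cochains G A n)
      \<lparr>carrier := kernel (bounded_cochains G A n) (bounded_cochains G A (Suc n)) (coboundary G A n)\<rparr>"

definition bounded_coboundaries ::
    "'g monoid \<Rightarrow> ('g, 'a) normed_module \<Rightarrow> nat \<Rightarrow> ('g list \<Rightarrow> 'a) set"
  where "bounded_coboundaries G A n =
    (case n of 0 \<Rightarrow> {\<one>\<^bsub>bounded_cochains G A 0\<^esub>}
      | Suc m \<Rightarrow> coboundary G A m ` carrier (bounded_cochains G A m))"

definition bounded_cohomology ::
    "'g monoid \<Rightarrow> ('g, 'a) normed_module \<Rightarrow> nat \<Rightarrow> ('g list \<Rightarrow> 'a) set monoid"
  where "bounded_cohomology G A n = bounded_cocycles G A n Mod bounded_coboundaries G A n"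

definition bounded_class ::
    "'g monoid \<Rightarrow> ('g, 'a) normed_module \<Rightarrow> nat \<Rightarrow> ('g list \<Rightarrow> 'a) \<Rightarrow> ('g list \<Rightarrow> 'a) set"
  where "bounded_class G A n f = bounded_coboundaries G A n #>\<^bsub>bounded_cocycles G A n\<^esub> f"

definition trivial_real :: "('g, real) normed_module"
  where "trivial_real =
    \<lparr>carrier = UNIV, mult = (*), one = 1, zero = 0, add = (+), nrm = abs, gact = (\<lambda>_ x. x)\<rparr>"


section \<open>The real bounded Euler class\<close>

definition euler_section :: "(circle \<Rightarrow> circle) \<Rightarrow> real \<Rightarrow> real"
  where "euler_section f = (THE F. F \<in> Homeo_real \<and> is_lift F f \<and> F 0 \<in> {0..<1})"

definition euler_cocycle :: "(circle \<Rightarrow> circle) \<Rightarrow> (circle \<Rightarrow> circle) \<Rightarrow> int"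
  where "euler_cocycle f g =
    (THE n. euler_section (f \<circ> g) \<circ> (\<lambda>x. x + of_int n) = euler_section f \<circ> euler_section g)"

definition real_euler_class :: "((circle \<Rightarrow> circle) list \<Rightarrow> real) set"
  where "real_euler_class =
    bounded_class Homeo_circle trivial_real 2
      (\<lambda>fs \<in> tuples Homeo_circle 2. of_int (euler_cocycle (fs ! 0) (fs ! 1)))"


section \<open>Standard Borel probability spaces with a group action\<close>

definition standard_borel :: "'w measure \<Rightarrow> bool"
  where "standard_borel M \<longleftrightarrow>
    (\<exists>X. completely_metrizable_space X \<and> second_countable X \<and> topspace X = space M
       \<and> sets M = sigma_sets (space M) {U. openin X U})"

definition finitely_generated :: "'g monoid \<Rightarrow> bool"
  where "finitely_generated G \<longleftrightarrow>
    (\<exists>S. finite S \<and> S \<subseteq> carrier G \<and> generate G S = carrier G)"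

locale standard_borel_probability_space_action =
  group_action \<Gamma> "space M" act + prob_space M
  for \<Gamma> :: "'g monoid" and M :: "'w measure" and act :: "'g \<Rightarrow> 'w \<Rightarrow> 'w" +
  assumes standard_borel: "standard_borel M"
    and measurable_action:
      "(\<lambda>(\<gamma>, \<omega>). act \<gamma> \<omega>) \<in> count_space (carrier \<Gamma>) \<Otimes>\<^sub>M M \<rightarrow>\<^sub>M M"
    and measure_preserving: "\<And>\<gamma>. \<gamma> \<in> carrier \<Gamma> \<Longrightarrow> distr M M (act \<gamma>) = M"
    and essentially_free: "AE \<omega> in M. stabilizer \<Gamma> act \<omega> = {\<one>\<^bsub>\<Gamma>\<^esub>}"

subsection \<open>The coefficient module of essentially bounded functions\<close>

definition Linf_fun :: "'w measure \<Rightarrow> ('w \<Rightarrow> real) set"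
  where "Linf_fun M = {f \<in> borel_measurable M. \<exists>C. AE \<omega> in M. \<bar>f \<omega>\<bar> \<le> C}"

definition Linf_eq :: "'w measure \<Rightarrow> (('w \<Rightarrow> real) \<times> ('w \<Rightarrow> real)) set"
  where "Linf_eq M = {(f, g). f \<in> Linf_fun M \<and> g \<in> Linf_fun M \<and> (AE \<omega> in M. f \<omega> = g \<omega>)}"

definition Linf_class :: "'w measure \<Rightarrow> ('w \<Rightarrow> real) \<Rightarrow> ('w \<Rightarrow> real) set"
  where "Linf_class M f = Linf_eq M `` {f}"

definition Linf ::
    "'g monoid \<Rightarrow> 'w measure \<Rightarrow> ('g \<Rightarrow> 'w \<Rightarrow> 'w) \<Rightarrow> ('g, ('w \<Rightarrow> real) set) normed_module"
  where "Linf \<Gamma> M act =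
    \<lparr>carrier = Linf_fun M // Linf_eq M,
     mult = (\<lambda>X Y. \<Union>f \<in> X. \<Union>g \<in> Y. Linf_class M (\<lambda>\<omega>. f \<omega> * g \<omega>)),
     one = Linf_class M (\<lambda>_. 1),
     zero = Linf_class M (\<lambda>_. 0),
     add = (\<lambda>X Y. \<Union>f \<in> X. \<Union>g \<in> Y. Linf_class M (\<lambda>\<omega>. f \<omega> + g \<omega>)),
     nrm = (\<lambda>X. Inf {C. 0 \<le> C \<and> (\<forall>f \<in> X. AE \<omega> in M. \<bar>f \<omega>\<bar> \<le> C)}),
     gact = (\<lambda>\<gamma> X. \<Union>f \<in> X. Linf_class M (\<lambda>\<omega>. f (act (inv\<^bsub>\<Gamma>\<^esub> \<gamma>) \<omega>)))\<rparr>"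


section \<open>Measurable cocycles\<close>

definition measurable_cocycle ::
    "'g monoid \<Rightarrow> 'w measure \<Rightarrow> ('g \<Rightarrow> 'w \<Rightarrow> 'w) \<Rightarrow> ('g \<Rightarrow> 'w \<Rightarrow> circle \<Rightarrow> circle) \<Rightarrow> bool"
  where "measurable_cocycle \<Gamma> M act \<sigma> \<longleftrightarrow>
    (\<lambda>(\<gamma>, \<omega>). \<sigma> \<gamma> \<omega>) \<in> count_space (carrier \<Gamma>) \<Otimes>\<^sub>M M \<rightarrow>\<^sub>M Homeo_borel \<and>
    (\<forall>\<gamma>\<^sub>1 \<in> carrier \<Gamma>. \<forall>\<gamma>\<^sub>2 \<in> carrier \<Gamma>. AE \<omega> in M.
       \<sigma> (\<gamma>\<^sub>1 \<otimes>\<^bsub>\<Gamma>\<^esub> \<gamma>\<^sub>2) \<omega> = \<sigma> \<gamma>\<^sub>1 (act \<gamma>\<^sub>2 \<omega>) \<circ> \<sigma> \<gamma>\<^sub>2 \<omega>)"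

definition left_semicohomologous ::
    "'g monoid \<Rightarrow> 'w measure \<Rightarrow> ('g \<Rightarrow> 'w \<Rightarrow> 'w)
      \<Rightarrow> ('g \<Rightarrow> 'w \<Rightarrow> circle \<Rightarrow> circle) \<Rightarrow> ('g \<Rightarrow> 'w \<Rightarrow> circle \<Rightarrow> circle) \<Rightarrow> bool"
  where "left_semicohomologous \<Gamma> M act \<sigma>\<^sub>1 \<sigma>\<^sub>2 \<longleftrightarrow>
    (\<exists>\<phi> :: 'w \<Rightarrow> circle \<Rightarrow> circle.
       (\<lambda>(x, \<omega>). \<phi> \<omega> x) \<in> borel \<Otimes>\<^sub>M M \<rightarrow>\<^sub>M borel \<and>
       (AE \<omega> in M. nondecreasing_degree_one (\<phi> \<omega>)) \<and>
       (\<forall>\<gamma> \<in> carrier \<Gamma>. AE \<omega> in M. \<sigma>\<^sub>1 \<gamma> \<omega> \<circ> \<phi> \<omega> = \<phi> (act \<gamma> \<omega>) \<circ> \<sigma>\<^sub>2 \<gamma> \<omega>))"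

definition semicohomologous ::
    "'g monoid \<Rightarrow> 'w measure \<Rightarrow> ('g \<Rightarrow> 'w \<Rightarrow> 'w)
      \<Rightarrow> ('g \<Rightarrow> 'w \<Rightarrow> circle \<Rightarrow> circle) \<Rightarrow> ('g \<Rightarrow> 'w \<Rightarrow> circle \<Rightarrow> circle) \<Rightarrow> bool"
  where "semicohomologous \<Gamma> M act \<sigma>\<^sub>1 \<sigma>\<^sub>2 \<longleftrightarrow>
    left_semicohomologous \<Gamma> M act \<sigma>\<^sub>1 \<sigma>\<^sub>2 \<and> left_semicohomologous \<Gamma> M act \<sigma>\<^sub>2 \<sigma>\<^sub>1"


section \<open>The map induced by a cocycle in bounded cohomology\<close>

definition pullback_cochain ::
    "'g monoid \<Rightarrow> 'w measure \<Rightarrow> ('g \<Rightarrow> 'w \<Rightarrow> 'w) \<Rightarrow> ('g \<Rightarrow> 'w \<Rightarrow> circle \<Rightarrow> circle)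
      \<Rightarrow> ((circle \<Rightarrow> circle) list \<Rightarrow> real) \<Rightarrow> 'g list \<Rightarrow> ('w \<Rightarrow> real) set"
  where "pullback_cochain \<Gamma> M act \<sigma> \<psi> = (\<lambda>gs \<in> tuples \<Gamma> 2.
    Linf_class M (\<lambda>\<omega>. \<psi>
      [inv\<^bsub>Homeo_circle\<^esub> (\<sigma> (inv\<^bsub>\<Gamma>\<^esub> (gs ! 0)) \<omega>),
       inv\<^bsub>Homeo_circle\<^esub> (\<sigma> (inv\<^bsub>\<Gamma>\<^esub> (gs ! 1)) (act (inv\<^bsub>\<Gamma>\<^esub> (gs ! 0)) \<omega>))]))"

text \<open>
  The group of homeomorphisms is discrete as far as cochains are concerned, so a representative
  \<open>\<psi>\<close> of a class need not be measurable, and then its pullback has no values in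
  $\mathrm{L}^\infty$. The induced map is therefore evaluated on Borel representatives.
  The result does not depend on the Borel representative: if \<open>\<beta>\<close> is a bounded function
  with Borel coboundary $d$, then $n\beta(f) = \beta(f^n) + \sum_{k=1}^{n-1} d(f, f^k)$, so
  $\beta(f) = \lim_n \frac1n \sum_{k=1}^{n-1} d(f, f^k)$ and \<open>\<beta>\<close> is Borel as well.
\<close>

definition borel_cochain2 :: "((circle \<Rightarrow> circle) list \<Rightarrow> real) \<Rightarrow> bool"
  where "borel_cochain2 \<psi> \<longleftrightarrow>
    (\<lambda>(f, g). \<psi> [f, g]) \<in> borel_measurable (Homeo_borel \<Otimes>\<^sub>M Homeo_borel)"

definition induced_map2 ::
    "'g monoid \<Rightarrow> 'w measure \<Rightarrow> ('g \<Rightarrow> 'w \<Rightarrow> 'w) \<Rightarrow> ('g \<Rightarrow> 'w \<Rightarrow> circle \<Rightarrow> circle)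
      \<Rightarrow> ((circle \<Rightarrow> circle) list \<Rightarrow> real) set \<Rightarrow> ('g list \<Rightarrow> ('w \<Rightarrow> real) set) set"
  where "induced_map2 \<Gamma> M act \<sigma> c =
    the_elem ((\<lambda>\<psi>. bounded_class \<Gamma> (Linf \<Gamma> M act) 2 (pullback_cochain \<Gamma> M act \<sigma> \<psi>))
      ` {\<psi> \<in> c. borel_cochain2 \<psi>})"

end

theory Submission
  imports Defs
begin

text \<open>
  Write $T(\gamma,\omega)$ for the normalised lift of $\sigma(\gamma^{-1},\omega)^{-1}$. The real
  parametrized Euler class vanishes iff there are uniformly bounded measurable $b(\gamma,\cdot)$ with
  $T(\gamma,\omega)\,T(\eta,\gamma^{-1}\omega) = T(\gamma\eta,\omega)
  + b(\eta,\gamma^{-1}\omega) - b(\gamma\eta,\omega) + b(\gamma,\omega)$ almost everywhere.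

  Given such $b$, the maps $\varphi_\omega(y) = \sup_\gamma T(\gamma,\omega)(y - b(\gamma,\omega))$
  are non-decreasing of degree one and satisfy
  $T(\gamma,\omega)\,\varphi_{\gamma^{-1}\omega}(y) = \varphi_\omega(y + b(\gamma,\omega))$.
  They are one semicohomology between $\sigma$ and the rotations by
  $-b(\gamma^{-1},\omega)$, and their generalised inverses are the other one.

  Conversely, if $\sigma\varphi = \varphi\rho$ with $\rho$ a cocycle of rotations, push the rotation
  invariant measure forward along $\varphi_\omega$. This gives an equivariant family of probability measures
  on the circle, whose lifted distribution functions $\psi_\omega$ satisfy
  $\psi_\omega(T(\gamma,\omega)x) = \psi_{\gamma^{-1}\omega}(x) + b(\gamma,\omega)$ for suitable $b$.
\<close>

section \<open>Lifts of circle homeomorphisms\<close>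

text \<open>The vanishing condition holds almost everywhere for each pair of group elements, whereas
  the supremum involves all of them at once: countability of \<Gamma> merges the exceptional sets
  into one null set and makes the supremum measurable. It is finite because \<open>b\<close> is
  uniformly bounded and normalised lifts move points by at most 2. Its equivariance is a reindexing:
  left multiplication by \<gamma> permutes the index set, and the defect \<open>delta b\<close> can
  be pulled through \<open>T\<close> because it equals the Euler cocycle, an integer. The supremum
  may jump or be constant on intervals, hence the generalised inverse.

  In the converse, \<open>b\<close> is the mean over the circle of the integer part produced when
  \<open>T\<close> moves a representative out of [0,1). Expanding \<psi> at a composite of two lifts
  in two ways turns the Euler cocycle into \<open>delta b\<close>.

  A separate obstacle is measurability. A bounded primitive on the discrete group of homeomorphisms
  is a priori arbitrary and becomes Borel only through averages along powers. Conversely,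
  homeomorphism-valued maps are known only through pointwise values of lifts, from which Borel
  measurability for the compact-open topology has to be recovered.\<close>

text \<open>In the presence of \<open>HOL-Algebra\<close> the notation \<open>inv f\<close> denotes the inverse in an implicit group.\<close>

abbreviation finv :: "('a \<Rightarrow> 'b) \<Rightarrow> 'b \<Rightarrow> 'a"
  where "finv \<equiv> inv_into UNIV"

lemma circle_of_eq_iff: "circle_of x = circle_of y \<longleftrightarrow> x - y \<in> \<int>"
  by transfer simp

lemma circle_of_add: "circle_of (x + y) = circle_of x + circle_of y"
  by transfer simp

lemma circle_of_of_int [simp]: "circle_of (of_int k) = 0"
  by transfer simp

lemma circle_of_add_int [simp]: "circle_of (x + of_int k) = circle_of x"
  by (simp add: circle_of_eq_iff)

definition rep :: "circle \<Rightarrow> real"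
  where "rep z = (THE x. x \<in> {0..<1} \<and> circle_of x = z)"

lemma rep_circle_of [simp]: "rep (circle_of x) = frac x"
proof -
  have "y = frac x" if "0 \<le> y" "y < 1" "circle_of y = circle_of x" for y
  proof -
    from that(3) have "y - x \<in> \<int>" by (simp add: circle_of_eq_iff)
    then have "frac y = frac x"
      by (metis Ints_cases diff_add_cancel frac_add_of_int_left)
    with that show ?thesis by (simp add: frac_eq)
  qed
  moreover have "circle_of (frac x) = circle_of x"
    by (simp add: circle_of_eq_iff frac_def)
  ultimately show ?thesis
    unfolding rep_def by (intro the_equality) (auto simp: frac_lt_1)
qed

lemma circle_of_exhaust: obtains x where "z = circle_of x"
proof -
  have "\<exists>x. z = circle_of x" by transfer (metis Ints_0 diff_self)
  then show ?thesis using that by blast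
qed

lemma circle_of_rep [simp]: "circle_of (rep z) = z"
  by (cases z rule: circle_of_exhaust) (simp add: circle_of_eq_iff frac_def)

lemma rep_range: "0 \<le> rep z" "rep z < 1"
  by (cases z rule: circle_of_exhaust; simp add: frac_lt_1)+

text \<open>The saturation of a set is the union of its integer translates; hence
  \<open>circle_of\<close> is an open map, the source of the open arcs used below.\<close>

lemma vimage_circle_of_image: "circle_of -` circle_of ` V = (\<Union>k::int. (\<lambda>x. x + of_int k) ` V)"
proof -
  have "\<exists>k::int. x - of_int k \<in> V" if "circle_of x = circle_of v" "v \<in> V" for x v
  proof -
    obtain k :: int where "x - v = of_int k" using \<open>circle_of x = circle_of v\<close> Ints_cases unfolding circle_of_eq_iff by metis
    then have "x - of_int k = v" by simp
    with that show ?thesis by blast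
  qed
  then show ?thesis
    by (force simp: image_iff)
qed

lemma open_circle_of_image: "open V \<Longrightarrow> open (circle_of ` V)"
  unfolding open_circle_def vimage_circle_of_image
  by (intro impI open_UN ballI) (simp add: add.commute[of _ "real_of_int _"] open_translation)

lemma continuous_on_circle_of: "continuous_on UNIV circle_of"
  by (auto simp: continuous_on_open_vimage open_circle_def)

text \<open>Universal property of the quotient topology.\<close>

lemma continuous_on_circle_iff:
  fixes f :: "circle \<Rightarrow> 'a::topological_space"
  shows "continuous_on UNIV f \<longleftrightarrow> continuous_on UNIV (\<lambda>x. f (circle_of x))"
  by (auto simp: continuous_on_open_vimage open_circle_def vimage_def)

section \<open>Degree one homeomorphisms of the line and the circle maps that they induce\<close>

lemma degree_one_int:
  assumes "\<And>x::real. F (x + 1) = F x + (1::real)"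
  shows "F (x + of_int k) = F x + of_int k"
proof -
  have nat: "F (y + of_nat n) = F y + of_nat n" for y n
  proof (induction n)
    case (Suc n)
    have "F (y + of_nat (Suc n)) = F ((y + of_nat n) + 1)" by (simp add: ac_simps)
    then show ?case using Suc assms by simp
  qed simp
  show ?thesis
  proof (cases k rule: int_cases2)
    case (nonneg n)
    then show ?thesis using nat[of x n] by simp
  next
    case (nonpos n)
    then show ?thesis using nat[of "x - of_nat n" n] by simp
  qed
qed

text \<open>Since \<open>F (\<plusminus>n) = F 0 \<plusminus> n\<close>, the intermediate value
  theorem gives surjectivity, and a continuous injection of the line has a continuous inverse. So
  the existence of an inverse never has to be checked separately.\<close>

lemma Homeo_realI:
  assumes "continuous_on UNIV F" "strict_mono F" "\<And>x. F (x + 1) = F x + 1"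
  shows "F \<in> Homeo_real"
proof -
  have "\<exists>x. F x = y" for y
  proof -
    obtain n :: nat where n: "\<bar>y - F 0\<bar> \<le> n" using real_arch_simple by blast
    have "F (of_nat n) = F 0 + n" using degree_one_int[of F 0 "int n", OF assms(3)] by simp
    moreover have "F (- of_nat n) = F 0 - n" using degree_one_int[of F 0 "- int n", OF assms(3)] by simp
    ultimately show ?thesis
      using IVT'[of F "- of_nat n" y "of_nat n"] n continuous_on_subset[OF assms(1)] by (auto simp: abs_le_iff)
  qed
  then have bij: "bij F"
    using strict_mono_imp_inj_on[OF assms(2)] by (metis bijI surjI surj_def)
  obtain G where "homeomorphism UNIV UNIV F G"
    using homeomorphism_into_1d[OF path_connected_UNIV assms(1) bij_is_surj[OF bij]
      strict_mono_imp_inj_on[OF assms(2)]] by blast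
  then show ?thesis using assms unfolding Homeo_real_def by blast
qed

lemma Homeo_realD:
  assumes "F \<in> Homeo_real"
  shows "continuous_on UNIV F" "strict_mono F" "\<And>x. F (x + 1) = F x + 1" "bij F" "finv F \<in> Homeo_real"
proof -
  obtain G where G: "homeomorphism UNIV UNIV F G" and F: "strict_mono F" "\<And>x. F (x + 1) = F x + 1"
    using assms unfolding Homeo_real_def by blast
  show "continuous_on UNIV F" "strict_mono F" "\<And>x. F (x + 1) = F x + 1"
    using G F by (auto simp: homeomorphism_def)
  show "bij F" using G by (auto simp: homeomorphism_def intro!: bij_betw_byWitness)
  have GF: "G = finv F" using G by (intro inv_equality[symmetric]) (auto simp: homeomorphism_def)
  have "homeomorphism UNIV UNIV (finv F) F" using G GF homeomorphism_sym by blast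
  moreover have "strict_mono (finv F)"
    using F(1) \<open>bij F\<close> by (metis bij_inv_eq_iff strict_mono_def strict_mono_less)
  moreover have "finv F (x + 1) = finv F x + 1" for x
    using F(2) \<open>bij F\<close> by (metis bij_inv_eq_iff)
  ultimately show "finv F \<in> Homeo_real" unfolding Homeo_real_def by blast
qed

lemma Homeo_real_int: "F \<in> Homeo_real \<Longrightarrow> F (x + of_int k) = F x + of_int k"
  by (rule degree_one_int) (rule Homeo_realD)

lemma Homeo_real_comp: "F \<in> Homeo_real \<Longrightarrow> G \<in> Homeo_real \<Longrightarrow> F \<circ> G \<in> Homeo_real"
  by (intro Homeo_realI continuous_on_compose)
    (auto simp: Homeo_realD(3) intro!: strict_monoI intro: continuous_on_subset[OF Homeo_realD(1)] simp: strict_mono_less[OF Homeo_realD(2)])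

lemma Homeo_real_translate: "F \<in> Homeo_real \<Longrightarrow> (\<lambda>x. F x + c) \<in> Homeo_real"
  by (intro Homeo_realI)
    (auto simp: Homeo_realD(3) intro!: continuous_intros strict_monoI intro: Homeo_realD(1) simp: strict_mono_less[OF Homeo_realD(2)])

lemma Homeo_real_mono: "F \<in> Homeo_real \<Longrightarrow> mono F"
  by (simp add: Homeo_realD(2) strict_mono_mono)

lemma Homeo_real_le: "F \<in> Homeo_real \<Longrightarrow> F x \<le> F y \<longleftrightarrow> x \<le> y"
  by (simp add: Homeo_realD(2) strict_mono_less_eq)

lemma Homeo_real_less: "F \<in> Homeo_real \<Longrightarrow> F x < F y \<longleftrightarrow> x < y"
  by (simp add: Homeo_realD(2) strict_mono_less)

lemma Homeo_real_id: "(\<lambda>x. x) \<in> Homeo_real"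
  by (intro Homeo_realI) (auto intro: strict_monoI)

text \<open>\<open>orientation_preserving\<close> asks only for a continuous strictly increasing
  lift, so degree one has to be derived. The number \<open>F (x + 1) - F x\<close> is a positive
  integer; were it at least 2, \<open>F\<close> would take the value \<open>F x + 1\<close> strictly
  between \<open>x\<close> and \<open>x + 1\<close>, against injectivity of \<open>f\<close>. In the
  other direction the inverse circle map is induced by the inverse lift.\<close>

lemma carrier_Homeo: "f \<in> carrier Homeo_circle \<longleftrightarrow> (\<exists>F \<in> Homeo_real. is_lift F f)"
proof
  assume "f \<in> carrier Homeo_circle"
  then obtain g F where g: "homeomorphism UNIV UNIV f g"
    and F: "continuous_on UNIV F" "strict_mono F" "is_lift F f"
    by (auto simp: Homeo_circle_def orientation_preserving_def)
  have inj: "inj f" using g by (metis homeomorphism_def injI UNIV_I)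
  have "F (x + 1) = F x + 1" for x
  proof (rule ccontr)
    assume ne: "F (x + 1) \<noteq> F x + 1"
    have "circle_of (F (x + 1)) = circle_of (F x)"
      using F(3) circle_of_add_int[of x 1] unfolding is_lift_def by (metis of_int_1)
    then obtain k :: int where k: "F (x + 1) - F x = of_int k"
      unfolding circle_of_eq_iff using Ints_cases by metis
    moreover have "F x < F (x + 1)" using F(2) by (simp add: strict_mono_less)
    ultimately have "(0::real) < of_int k" "of_int k \<noteq> (1::real)" using ne by auto
    then have "0 < k" "k \<noteq> 1" by simp_all
    then have "(1::real) < of_int k" by simp
    then have "F x + 1 < F (x + 1)" using k by linarith
    then obtain y where y: "x \<le> y" "y \<le> x + 1" "F y = F x + 1"
      using IVT'[of F x "F x + 1" "x + 1"] continuous_on_subset[OF F(1)] by auto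
    then have "circle_of (F y) = circle_of (F x)" using circle_of_add_int[of _ 1] by simp
    then have "circle_of y = circle_of x" using F(3) inj unfolding is_lift_def by (metis injD)
    then have "y - x \<in> \<int>" by (simp add: circle_of_eq_iff)
    moreover have "y \<noteq> x" "y \<noteq> x + 1" using y ne by auto
    ultimately show False using y(1,2)
      by (smt (verit, best) Ints_cases of_int_0_less_iff of_int_less_1_iff)
  qed
  then have "F \<in> Homeo_real" using F by (intro Homeo_realI) auto
  then show "\<exists>F \<in> Homeo_real. is_lift F f" using F by blast
next
  assume "\<exists>F \<in> Homeo_real. is_lift F f"
  then obtain F where F: "F \<in> Homeo_real" "is_lift F f" by blast
  define g where "g z = circle_of (finv F (rep z))" for z
  have invF: "finv F \<in> Homeo_real" using F Homeo_realD by blast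
  have gl: "g (circle_of x) = circle_of (finv F x)" for x
  proof -
    have "finv F (frac x) = finv F x + of_int (- \<lfloor>x\<rfloor>)"
      using Homeo_real_int[OF invF, of x "- \<lfloor>x\<rfloor>"] by (simp add: frac_def)
    then show ?thesis unfolding g_def using circle_of_add_int by (metis rep_circle_of)
  qed
  have fl: "f (circle_of x) = circle_of (F x)" for x using F by (simp add: is_lift_def)
  have bij: "bij F" using F Homeo_realD by blast
  have "f (g z) = z" for z
    by (cases z rule: circle_of_exhaust) (simp add: gl fl bij bij_is_surj surj_f_inv_f)
  moreover have "g (f z) = z" for z
    by (cases z rule: circle_of_exhaust) (simp add: gl fl bij bij_is_inj)
  moreover have "continuous_on UNIV f"
    unfolding continuous_on_circle_iff fl
    by (rule continuous_on_compose2[OF continuous_on_circle_of]) (use F Homeo_realD in auto)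
  moreover have "continuous_on UNIV g"
    unfolding continuous_on_circle_iff gl
    by (rule continuous_on_compose2[OF continuous_on_circle_of]) (use invF Homeo_realD in auto)
  ultimately have "homeomorphism UNIV UNIV f g"
    unfolding homeomorphism_def by (metis UNIV_I surjI)
  then show "f \<in> carrier Homeo_circle"
    using F Homeo_realD(1,2) by (auto simp: Homeo_circle_def orientation_preserving_def)
qed

lemma is_lift_comp: "is_lift F f \<Longrightarrow> is_lift G g \<Longrightarrow> is_lift (F \<circ> G) (f \<circ> g)"
  by (simp add: is_lift_def)

lemma is_lift_inverse:
  assumes "F \<in> Homeo_real" "is_lift F f"
  shows "is_lift (finv F) (finv f)"
proof -
  have "bij F" using assms Homeo_realD by blast
  have "f (circle_of (finv F x)) = circle_of x" for x
    using assms \<open>bij F\<close> by (simp add: is_lift_def bij_is_surj surj_f_inv_f)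
  moreover have "inj f"
  proof -
    have "f \<in> carrier Homeo_circle" using assms carrier_Homeo by blast
    then show ?thesis by (auto simp: Homeo_circle_def homeomorphism_def intro: inj_on_inverseI)
  qed
  ultimately show ?thesis unfolding is_lift_def by (metis inv_f_f)
qed

lemma bij_Homeo: "f \<in> carrier Homeo_circle \<Longrightarrow> bij f"
  by (auto simp: Homeo_circle_def homeomorphism_def intro!: bij_betw_byWitness)

section \<open>Normalised lifts and the Euler cocycle\<close>

lemma lift_unique:
  assumes "F \<in> Homeo_real" "G \<in> Homeo_real" "is_lift F f" "is_lift G f"
  obtains k :: int where "\<And>x. F x = G x + of_int k"
proof -
  have int: "F x - G x \<in> \<int>" for x
    using assms(3,4) by (metis circle_of_eq_iff is_lift_def)
  \<comment> \<open>A continuous integer-valued function on the line is constant, since distinct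
    values are at distance at least 1.\<close>
  have "(\<lambda>x. F x - G x) constant_on UNIV"
  proof (rule continuous_discrete_range_constant)
    show "continuous_on UNIV (\<lambda>x. F x - G x)"
      using assms by (intro continuous_intros Homeo_realD(1))
    fix x :: real
    have "1 \<le> norm ((F y - G y) - (F x - G x))" if "F y - G y \<noteq> F x - G x" for y
      using Ints_nonzero_abs_ge1[OF Ints_diff[OF int[of y] int[of x]]] that by auto
    then show "\<exists>e>0. \<forall>y. y \<in> UNIV \<and> F y - G y \<noteq> F x - G x \<longrightarrow> e \<le> norm (F y - G y - (F x - G x))"
      by (intro exI[of _ 1]) auto
  qed auto
  then obtain c where c: "\<And>x. F x - G x = c" by (auto simp: constant_on_def)
  then obtain k :: int where "c = of_int k" using int Ints_cases by metis
  then show ?thesis using c that by (metis add.commute diff_eq_eq)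
qed

text \<open>This justifies the definite description in \<open>euler_section\<close>: subtracting
  \<open>\<lfloor>F 0\<rfloor>\<close> normalises any lift, and two normalised lifts differ by an
  integer of absolute value below 1.\<close>

lemma euler_section_lift:
  assumes "f \<in> carrier Homeo_circle"
  shows "euler_section f \<in> Homeo_real" "is_lift (euler_section f) f"
    "0 \<le> euler_section f 0" "euler_section f 0 < 1"
proof -
  obtain F where F: "F \<in> Homeo_real" "is_lift F f" using assms carrier_Homeo by blast
  define G where "G x = F x + of_int (- \<lfloor>F 0\<rfloor>)" for x
  have G: "G \<in> Homeo_real \<and> is_lift G f \<and> G 0 \<in> {0..<1}"
    unfolding G_def using F Homeo_real_translate[OF F(1)]
    by (auto simp: is_lift_def simp del: of_int_minus) (simp, linarith)
  have "\<exists>!F. F \<in> Homeo_real \<and> is_lift F f \<and> F 0 \<in> {0..<1}"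
  proof (rule ex1I[of _ G], rule G)
    fix K assume K: "K \<in> Homeo_real \<and> is_lift K f \<and> K 0 \<in> {0..<1}"
    then obtain k :: int where k: "\<And>x. K x = G x + of_int k" using lift_unique G by blast
    have "k = 0" using k[of 0] G K by auto
    then show "K = G" using k by auto
  qed
  from theI'[OF this] show "euler_section f \<in> Homeo_real" "is_lift (euler_section f) f"
    "0 \<le> euler_section f 0" "euler_section f 0 < 1"
    unfolding euler_section_def by auto
qed

lemma comp_Homeo: "f \<in> carrier Homeo_circle \<Longrightarrow> g \<in> carrier Homeo_circle \<Longrightarrow> f \<circ> g \<in> carrier Homeo_circle"
  unfolding carrier_Homeo using is_lift_comp Homeo_real_comp by blast

lemma inverse_Homeo: "f \<in> carrier Homeo_circle \<Longrightarrow> finv f \<in> carrier Homeo_circle"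
  unfolding carrier_Homeo using is_lift_inverse Homeo_realD(5) by blast

lemma m_inv_Homeo:
  assumes "f \<in> carrier Homeo_circle"
  shows "inv\<^bsub>Homeo_circle\<^esub> f = finv f"
  unfolding m_inv_def
proof (rule the_equality)
  show "finv f \<in> carrier Homeo_circle \<and> f \<otimes>\<^bsub>Homeo_circle\<^esub> finv f = \<one>\<^bsub>Homeo_circle\<^esub>
      \<and> finv f \<otimes>\<^bsub>Homeo_circle\<^esub> f = \<one>\<^bsub>Homeo_circle\<^esub>"
    using assms inverse_Homeo[OF assms] bij_Homeo[OF assms]
    by (simp add: Homeo_circle_def bij_is_inj fun_eq_iff surj_f_inv_f bij_is_surj)
  fix g assume "g \<in> carrier Homeo_circle \<and> f \<otimes>\<^bsub>Homeo_circle\<^esub> g = \<one>\<^bsub>Homeo_circle\<^esub>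
      \<and> g \<otimes>\<^bsub>Homeo_circle\<^esub> f = \<one>\<^bsub>Homeo_circle\<^esub>"
  then show "g = finv f" using inv_unique_comp[of f g] by (simp add: Homeo_circle_def)
qed

text \<open>Both compositions lift \<open>f \<circ> g\<close>, so they differ by an integer. It can
  be taken out of the argument because lifts commute with integer translations.\<close>

lemma euler_section_comp:
  assumes "f \<in> carrier Homeo_circle" "g \<in> carrier Homeo_circle"
  shows "euler_section f (euler_section g x) = euler_section (f \<circ> g) x + of_int (euler_cocycle f g)"
proof -
  let ?s = euler_section
  have fg: "f \<circ> g \<in> carrier Homeo_circle" using comp_Homeo assms .
  obtain k :: int where k: "\<And>x. (?s f \<circ> ?s g) x = ?s (f \<circ> g) x + of_int k"
    using lift_unique[OF Homeo_real_comp euler_section_lift(1)[OF fg] is_lift_comp euler_section_lift(2)[OF fg]]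
      euler_section_lift assms by metis
  have eq: "?s (f \<circ> g) \<circ> (\<lambda>x. x + of_int n) = ?s f \<circ> ?s g \<longleftrightarrow> n = k" for n
    using k Homeo_real_int[OF euler_section_lift(1)[OF fg]] by (auto simp: fun_eq_iff)
  have "euler_cocycle f g = k" unfolding euler_cocycle_def eq by simp
  then show ?thesis using k by simp
qed

text \<open>Evaluation at 0: the composite of the sections lies in [0,2) and the section of the
  composite in [0,1). The bound 2 is crude, but only boundedness matters.\<close>

lemma euler_cocycle_bound:
  assumes "f \<in> carrier Homeo_circle" "g \<in> carrier Homeo_circle"
  shows "\<bar>real_of_int (euler_cocycle f g)\<bar> \<le> 2"
proof -
  let ?s = euler_section
  have fg: "f \<circ> g \<in> carrier Homeo_circle" using comp_Homeo assms .
  note f = euler_section_lift[OF assms(1)] and g = euler_section_lift[OF assms(2)] and h = euler_section_lift[OF fg]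
  have "?s f 0 \<le> ?s f (?s g 0)" using Homeo_real_le[OF f(1)] g by simp
  moreover have "?s f (?s g 0) \<le> ?s f (0 + 1)" using Homeo_real_le[OF f(1)] g by simp
  ultimately show ?thesis
    using euler_section_comp[OF assms, of 0] f h Homeo_realD(3)[OF f(1), of 0] by linarith
qed

section \<open>The Borel structure on circle homeomorphisms\<close>

lemma measurable_circle_of [measurable]: "circle_of \<in> borel_measurable borel"
  by (rule borel_measurable_continuous_onI[OF continuous_on_circle_of])

lemma measurable_rep [measurable]: "rep \<in> borel_measurable borel"
proof (rule borel_measurableI_less)
  fix y :: real
  have "- {circle_of 0} = circle_of ` {0<..<1}"
  proof (intro Set.set_eqI iffI)
    fix z assume "z \<in> - {circle_of 0}"
    then have "rep z \<noteq> 0" by (metis ComplD circle_of_rep singletonI)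
    then show "z \<in> circle_of ` {0<..<1}"
      using rep_range[of z] by (intro image_eqI[of _ _ "rep z"]) auto
  next
    fix z assume "z \<in> circle_of ` {0<..<1}"
    then obtain x where x: "z = circle_of x" "0 < x" "x < 1" by auto
    then have "rep z = x" "rep (circle_of 0) = 0" by (simp_all add: frac_eq)
    then show "z \<in> - {circle_of 0}" using x by (metis ComplI less_irrefl singletonD)
  qed
  then have "closed {circle_of 0}" by (simp add: closed_def open_circle_of_image)
  moreover have "{z \<in> space borel. rep z < y}
      = circle_of ` {0<..<min y 1} \<union> (if y > 0 then {circle_of 0} else {})" (is "?L = ?R")
  proof (intro Set.set_eqI iffI)
    fix z assume z: "z \<in> ?L"
    show "z \<in> ?R"
    proof (cases "rep z = 0")
      case True
      then have "z = circle_of 0" by (metis circle_of_rep)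
      with z True show ?thesis by auto
    next
      case False
      then have "z \<in> circle_of ` {0<..<min y 1}"
        using z rep_range[of z] by (intro image_eqI[of _ _ "rep z"]) auto
      then show ?thesis by simp
    qed
  next
    fix z assume "z \<in> ?R"
    moreover have "rep (circle_of x) = x" if "0 < x" "x < 1" for x
      using that by (simp add: frac_eq)
    ultimately show "z \<in> ?L" by (auto split: if_splits)
  qed
  ultimately show "{z \<in> space borel. rep z < y} \<in> sets borel"
    by (auto simp: open_circle_of_image)
qed

lemma measurable_frac [measurable]: "(frac :: real \<Rightarrow> real) \<in> borel_measurable borel"
  unfolding frac_def[abs_def] by measurable

lemma space_Homeo_borel: "space Homeo_borel = carrier Homeo_circle"
  unfolding Homeo_borel_def by (rule space_measure_of_conv)

lemma openin_compact_open_subset: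
  assumes "openin compact_open_topology U"
  shows "U \<subseteq> carrier Homeo_circle"
proof -
  have "topspace compact_open_topology \<subseteq> carrier Homeo_circle"
    unfolding compact_open_topology_def topology_generated_by_topspace by blast
  then show ?thesis using openin_subset[OF assms] by blast
qed

lemma sets_Homeo_borel:
  "sets Homeo_borel = sigma_sets (carrier Homeo_circle) {U. openin compact_open_topology U}"
  unfolding Homeo_borel_def using openin_compact_open_subset by (intro sets_measure_of) blast

text \<open>Points are compact, so evaluation conditions are subbasic open sets.\<close>

lemma measurable_evaluation: "(\<lambda>f. f z) \<in> borel_measurable Homeo_borel"
proof (rule borel_measurableI)
  fix S :: "circle set" assume "open S"
  then have "openin compact_open_topology {f \<in> carrier Homeo_circle. f ` {z} \<subseteq> S}"
    unfolding compact_open_topology_def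
    by (intro topology_generated_by_Basis CollectI exI[of _ "{z}"] exI[of _ S]) simp
  then have "{f \<in> carrier Homeo_circle. f ` {z} \<subseteq> S} \<in> sets Homeo_borel"
    unfolding sets_Homeo_borel by (intro sigma_sets.Basic CollectI)
  moreover have "{f \<in> carrier Homeo_circle. f ` {z} \<subseteq> S} = (\<lambda>f. f z) -` S \<inter> space Homeo_borel"
    by (auto simp: space_Homeo_borel)
  ultimately show "(\<lambda>f. f z) -` S \<inter> space Homeo_borel \<in> sets Homeo_borel" by simp
qed

text \<open>On [0,1) the normalised lift exceeds its value at 0 by a number in [0,1), which is
  therefore the fractional part of a difference of representatives. This expresses the lift through
  evaluations of \<open>f\<close> and so makes it measurable in \<open>f\<close>.\<close>

lemma euler_section_eq:
  assumes "f \<in> carrier Homeo_circle"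
  shows "euler_section f x
    = rep (f 0) + frac (rep (f (circle_of x)) - rep (f 0)) + of_int \<lfloor>x\<rfloor>"
proof -
  let ?F = "euler_section f"
  note F = euler_section_lift[OF assms]
  have 0: "rep (f 0) = ?F 0"
    using F(2-4) circle_of_of_int[of 0] by (metis frac_eq is_lift_def of_int_0 rep_circle_of)
  have "?F 0 \<le> ?F (frac x)" "?F (frac x) < ?F (0 + 1)"
    using Homeo_real_le[OF F(1)] Homeo_real_less[OF F(1)] by (simp_all add: frac_lt_1)
  moreover have x: "?F x = ?F (frac x) + of_int \<lfloor>x\<rfloor>"
    using Homeo_real_int[OF F(1), of "frac x" "\<lfloor>x\<rfloor>"] by (simp add: frac_def)
  ultimately have "frac (?F (frac x) - ?F 0) = ?F (frac x) - ?F 0"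
    using Homeo_realD(3)[OF F(1), of 0] by (simp add: frac_eq)
  moreover have "rep (f (circle_of x)) = frac (?F x)" using F(2) by (simp add: is_lift_def)
  then have "rep (f (circle_of x)) - ?F 0 = ?F (frac x) - ?F 0 + of_int (\<lfloor>x\<rfloor> - \<lfloor>?F x\<rfloor>)"
    unfolding frac_def[of "?F x"] using x by linarith
  ultimately have "frac (rep (f (circle_of x)) - ?F 0) = ?F (frac x) - ?F 0"
    by (metis add.commute frac_add_of_int_left)
  then show ?thesis using 0 x by simp
qed

lemma measurable_euler_section: "(\<lambda>f. euler_section f x) \<in> borel_measurable Homeo_borel"
proof -
  note [measurable] = measurable_evaluation
  have "(\<lambda>f. rep (f 0) + frac (rep (f (circle_of x)) - rep (f 0)) + of_int \<lfloor>x\<rfloor>)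
      \<in> borel_measurable Homeo_borel" by measurable
  then show ?thesis
    by (rule measurable_cong[THEN iffD1, rotated]) (simp add: euler_section_eq space_Homeo_borel)
qed

text \<open>Open sets of the compact-open topology contain uniform neighbourhoods, measured on
  lifts. For a subbasic set, continuity of \<open>F\<close> gives a radius and a tolerance at each
  point lying over \<open>K\<close>; a finite subcover of the compact set makes the tolerance
  uniform.\<close>

lemma compact_open_uniform:
  assumes "openin compact_open_topology U" "F \<in> Homeo_real" "is_lift F f" "f \<in> U"
  shows "\<exists>\<epsilon>>0. \<forall>G g. G \<in> Homeo_real \<longrightarrow> is_lift G g \<longrightarrow> (\<forall>x. \<bar>G x - F x\<bar> < \<epsilon>) \<longrightarrow> g \<in> U"
  using assms(1) unfolding compact_open_topology_def openin_topology_generated_by_iff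
  using assms(4)
proof (induction rule: generate_topology_on.induct)
  case Empty
  then show ?case by simp
next
  case (Int a b)
  then obtain d e where "d > 0" "e > 0"
    and d: "\<And>G g. G \<in> Homeo_real \<Longrightarrow> is_lift G g \<Longrightarrow> (\<forall>x. \<bar>G x - F x\<bar> < d) \<Longrightarrow> g \<in> a"
    and e: "\<And>G g. G \<in> Homeo_real \<Longrightarrow> is_lift G g \<Longrightarrow> (\<forall>x. \<bar>G x - F x\<bar> < e) \<Longrightarrow> g \<in> b"
    by blast
  then show ?case by (intro exI[of _ "min d e"]) auto
next
  case (UN K)
  then obtain k where k: "k \<in> K" "f \<in> k" by blast
  from UN.IH[OF this] show ?case using k by (meson UnionI)
next
  case (Basis s)
  then obtain K U where K: "compact K" and U: "open U"
    and s: "s = {f \<in> carrier Homeo_circle. f ` K \<subseteq> U}" by blast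
  have "\<exists>d e. d > 0 \<and> e > 0 \<and> (\<forall>y\<in>ball x d. \<forall>t. \<bar>t - F y\<bar> < e \<longrightarrow> circle_of t \<in> U)"
    if "circle_of x \<in> K" for x
  proof -
    have "F x \<in> circle_of -` U"
      using that Basis s assms(3) by (auto simp: is_lift_def)
    moreover have "open (circle_of -` U)" using U by (simp add: open_circle_def)
    ultimately obtain e where e: "e > 0" "ball (F x) e \<subseteq> circle_of -` U"
      unfolding open_contains_ball by blast
    have "isCont F x" using Homeo_realD(1)[OF assms(2)] by (simp add: continuous_on_eq_continuous_at)
    then obtain d where d: "d > 0" "\<And>y. \<bar>y - x\<bar> < d \<Longrightarrow> \<bar>F y - F x\<bar> < e / 2"
      using e(1) unfolding continuous_at_eps_delta by (metis dist_real_def half_gt_zero)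
    have "circle_of t \<in> U" if "y \<in> ball x d" "\<bar>t - F y\<bar> < e / 2" for y t
    proof -
      have "\<bar>y - x\<bar> < d" using that(1) by (simp add: dist_real_def abs_minus_commute)
      then have "\<bar>F y - F x\<bar> < e / 2" by (rule d(2))
      then have "\<bar>F x - t\<bar> < e" using that(2) by linarith
      then have "t \<in> ball (F x) e" by (simp add: dist_real_def)
      then show ?thesis using e by blast
    qed
    then show ?thesis using d e by (intro exI[of _ d] exI[of _ "e / 2"]) auto
  qed
  then obtain d e where de: "\<And>x. circle_of x \<in> K \<Longrightarrow> d x > 0 \<and> e x > 0
      \<and> (\<forall>y\<in>ball x (d x). \<forall>t. \<bar>t - F y\<bar> < e x \<longrightarrow> circle_of t \<in> U)" by metis
  let ?V = "\<lambda>x. circle_of ` ball x (d x)"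
  have "K \<subseteq> (\<Union>x\<in>circle_of -` K. ?V x)"
  proof
    fix z assume "z \<in> K"
    obtain x where x: "z = circle_of x" by (rule circle_of_exhaust)
    then have "x \<in> ball x (d x)" using de \<open>z \<in> K\<close> by simp
    then show "z \<in> (\<Union>x\<in>circle_of -` K. ?V x)" using x \<open>z \<in> K\<close> by blast
  qed
  then obtain I where I: "I \<subseteq> circle_of -` K" "finite I" "K \<subseteq> (\<Union>x\<in>I. ?V x)"
    using compactE_image[OF K, of "circle_of -` K" ?V] open_circle_of_image[OF open_ball] by metis
  \<comment> \<open>The inserted 1 keeps the minimum defined when the finite cover is empty.\<close>
  define \<epsilon> where "\<epsilon> = Min (insert 1 (e ` I))"
  have "\<epsilon> > 0" unfolding \<epsilon>_def using I de by (subst Min_gr_iff) auto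
  moreover have "g \<in> s" if G: "G \<in> Homeo_real" "is_lift G g" "\<forall>x. \<bar>G x - F x\<bar> < \<epsilon>" for G g
  proof -
    have "g z \<in> U" if "z \<in> K" for z
    proof -
      obtain x y where xy: "x \<in> I" "y \<in> ball x (d x)" "z = circle_of y" using I \<open>z \<in> K\<close> by blast
      have "\<epsilon> \<le> e x" unfolding \<epsilon>_def using I xy by (intro Min_le) auto
      then have "\<bar>G y - F y\<bar> < e x" using G by (meson less_le_trans)
      then have "circle_of (G y) \<in> U" using de[of x] xy I by blast
      then show ?thesis using G xy by (simp add: is_lift_def)
    qed
    moreover have "g \<in> carrier Homeo_circle" using G carrier_Homeo by blast
    ultimately show ?thesis unfolding s by blast
  qed
  ultimately show ?case by (intro exI[of _ \<epsilon>]) simp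
qed

text \<open>
  Near a given lift, an open set of homeomorphisms is cut out by prescribing the values at the points
  $i/n$ up to an error $1/m$, and rational values suffice. Hence its preimage is a countable union.
\<close>

lemma measurable_Homeo_borelI:
  assumes F: "\<And>\<omega>. \<omega> \<in> space N \<Longrightarrow> F \<omega> \<in> Homeo_real"
    and lift: "\<And>\<omega>. \<omega> \<in> space N \<Longrightarrow> is_lift (F \<omega>) (h \<omega>)"
    and meas[measurable]: "\<And>x. (\<lambda>\<omega>. F \<omega> x) \<in> borel_measurable N"
  shows "h \<in> N \<rightarrow>\<^sub>M Homeo_borel"
proof (rule measurable_sigma_sets[OF sets_Homeo_borel])
  show "{U. openin compact_open_topology U} \<subseteq> Pow (carrier Homeo_circle)"
    using openin_compact_open_subset by blast
  show "h \<in> space N \<rightarrow> carrier Homeo_circle"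
    using F lift carrier_Homeo by blast
  fix U assume "U \<in> {U. openin compact_open_topology U}"
  then have U: "openin compact_open_topology U" by simp
  \<comment> \<open>The triples \<open>(n, m, p)\<close> form a countable type, so any union of sets
    \<open>P t\<close> is again measurable.\<close>
  define P where "P = (\<lambda>(n, m, p :: rat list). {\<omega> \<in> space N.
      \<forall>i\<in>{..n}. \<bar>F \<omega> (real i / real n) - of_rat (p ! i)\<bar> < 1 / real m})"
  have P: "P t \<in> sets N" for t
  proof -
    obtain n m p where t: "t = (n, m, p)" by (cases t)
    show ?thesis unfolding P_def t prod.case by measurable
  qed
  have "\<exists>t. \<omega> \<in> P t \<and> P t \<subseteq> h -` U" if w: "\<omega> \<in> h -` U \<inter> space N" for \<omega>
  proof -
    obtain \<epsilon> where "\<epsilon> > 0"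
      and \<epsilon>: "\<And>G g. G \<in> Homeo_real \<Longrightarrow> is_lift G g \<Longrightarrow> (\<forall>x. \<bar>G x - F \<omega> x\<bar> < \<epsilon>) \<Longrightarrow> g \<in> U"
      using compact_open_uniform[OF U F lift, of \<omega>] w by auto
    \<comment> \<open>The error budget is \<open>3 / m\<close>: twice \<open>1 / m\<close> because
      two lifts are compared through the same rational value, and once \<open>1 / m\<close> for the
      variation of \<open>F \<omega>\<close> between grid points.\<close>
    define m where "m = nat \<lceil>3 / \<epsilon>\<rceil> + 1"
    have m: "real m > 0" "3 / real m < \<epsilon>"
    proof -
      have "3 / \<epsilon> < real m" unfolding m_def by linarith
      moreover show "real m > 0" by (simp add: m_def)
      ultimately show "3 / real m < \<epsilon>" using \<open>\<epsilon> > 0\<close> by (simp add: field_simps)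
    qed
    have "uniformly_continuous_on {0..1} (F \<omega>)"
      using Homeo_realD(1)[OF F] w by (intro compact_uniformly_continuous) (auto intro: continuous_on_subset)
    then obtain d where d: "d > 0"
      "\<And>x y. x \<in> {0..1} \<Longrightarrow> y \<in> {0..1} \<Longrightarrow> \<bar>x - y\<bar> < d \<Longrightarrow> \<bar>F \<omega> x - F \<omega> y\<bar> < 1 / real m"
      using m(1) unfolding uniformly_continuous_on_def dist_real_def
      by (metis divide_pos_pos zero_less_one abs_minus_commute)
    define n where "n = nat \<lceil>1 / d\<rceil> + 1"
    have n: "real n > 0" "1 / real n < d"
    proof -
      have "1 / d < real n" unfolding n_def by linarith
      moreover show "real n > 0" by (simp add: n_def)
      ultimately show "1 / real n < d" using d by (simp add: field_simps)
    qed
    have "\<exists>q::rat. \<bar>F \<omega> (real i / real n) - of_rat q\<bar> < 1 / real m" for i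
    proof -
      obtain q where "F \<omega> (real i / real n) - 1 / real m < of_rat q" "of_rat q < F \<omega> (real i / real n)"
        using of_rat_dense[of "F \<omega> (real i / real n) - 1 / real m" "F \<omega> (real i / real n)"] m(1) by auto
      then show ?thesis by (intro exI[of _ q]) auto
    qed
    then obtain q :: "nat \<Rightarrow> rat" where q: "\<And>i. \<bar>F \<omega> (real i / real n) - of_rat (q i)\<bar> < 1 / real m"
      by metis
    let ?t = "(n, m, map q [0..<Suc n])"
    have q': "map q [0..<Suc n] ! i = q i" if "i \<le> n" for i
      using nth_map[of i "[0..<Suc n]" q] that by (simp del: upt_Suc)
    have "\<omega> \<in> P ?t" unfolding P_def using q w q' by (simp del: upt_Suc)
    moreover have "h \<omega>' \<in> U" if w': "\<omega>' \<in> P ?t" for \<omega>'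
    proof -
      have sp: "\<omega>' \<in> space N" using w' by (simp add: P_def)
      let ?G = "F \<omega>'" and ?F = "F \<omega>"
      have G: "?G \<in> Homeo_real" and FF: "?F \<in> Homeo_real" using F sp w by auto
      have near: "\<bar>?G (real i / real n) - ?F (real i / real n)\<bar> < 2 / real m" if "i \<le> n" for i
      proof -
        have "\<bar>?G (real i / real n) - of_rat (q i)\<bar> < 1 / real m"
          using w' that q'[OF that] by (auto simp: P_def simp del: upt_Suc)
        then show ?thesis using q[of i] by (simp add: abs_less_iff)
      qed
      \<comment> \<open>The nearby lift comes with no modulus of continuity. Monotonicity replaces
        it: its value at \<open>x\<close> is squeezed between its values at the two neighbouring
        grid points.\<close>
      have close: "\<bar>?G x - ?F x\<bar> < \<epsilon>" if x: "0 \<le> x" "x < 1" for x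
      proof -
        define i where "i = nat \<lfloor>x * real n\<rfloor>"
        have i: "real i \<le> x * real n" "x * real n < real i + 1"
          unfolding i_def using x n by simp_all linarith?
        moreover have "x * real n < real n" using x n by simp
        ultimately have "real i < real n" by linarith
        then have "i + 1 \<le> n" by simp
        have lo: "real i / real n \<le> x" and hi: "x \<le> real (i + 1) / real n"
          using i n by (simp_all add: field_simps)
        have in01: "x \<in> {0..1}" "real i / real n \<in> {0..1}" "real (i + 1) / real n \<in> {0..1}"
          using x \<open>i + 1 \<le> n\<close> n by (auto simp: divide_simps)
        have gap: "real (i + 1) / real n - real i / real n = 1 / real n"
          using n by (simp add: field_simps)
        have "\<bar>?F (real i / real n) - ?F x\<bar> < 1 / real m"
          "\<bar>?F (real (i + 1) / real n) - ?F x\<bar> < 1 / real m"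
          using gap n(2) lo hi by (intro d(2) in01; linarith)+
        moreover have "?G (real i / real n) \<le> ?G x" "?G x \<le> ?G (real (i + 1) / real n)"
          using lo hi Homeo_real_le[OF G] by auto
        moreover have "3 / real m = 2 / real m + 1 / real m" by (simp add: field_simps)
        moreover have "i \<le> n" using \<open>i + 1 \<le> n\<close> by simp
        ultimately show ?thesis using near[OF \<open>i \<le> n\<close>] near[OF \<open>i + 1 \<le> n\<close>] m(2) by linarith
      qed
      have "\<bar>?G x - ?F x\<bar> < \<epsilon>" for x
      proof -
        have "?G x = ?G (frac x) + of_int \<lfloor>x\<rfloor>" "?F x = ?F (frac x) + of_int \<lfloor>x\<rfloor>"
          using Homeo_real_int[OF G, of "frac x" "\<lfloor>x\<rfloor>"] Homeo_real_int[OF FF, of "frac x" "\<lfloor>x\<rfloor>"]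
          by (simp_all add: frac_def)
        then show ?thesis using close[OF frac_ge_0 frac_lt_1, of x] by linarith
      qed
      then show ?thesis using \<epsilon>[OF G lift[OF sp]] by blast
    qed
    ultimately show ?thesis by blast
  qed
  moreover have "P t \<subseteq> space N" for t using P sets.sets_into_space by blast
  ultimately have "h -` U \<inter> space N = (\<Union>t\<in>{t. P t \<subseteq> h -` U}. P t)" by blast
  moreover have "(\<Union>t\<in>{t. P t \<subseteq> h -` U}. P t) \<in> sets N"
    using P by (intro sets.countable_UN') auto
  ultimately show "h -` U \<inter> space N \<in> sets N" by simp
qed

text \<open>By monotonicity and continuity from the left, \<open>F \<omega>\<close> exceeds
  \<open>a\<close> at \<open>u \<omega>\<close> iff it already does so at some rational point below
  \<open>u \<omega>\<close>. Measurability at fixed arguments thus extends to arguments depending on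
  \<omega>.\<close>

lemma measurable_mono_continuous:
  fixes F :: "'a \<Rightarrow> real \<Rightarrow> real"
  assumes [measurable]: "\<And>x. (\<lambda>\<omega>. F \<omega> x) \<in> borel_measurable N" "u \<in> borel_measurable N"
    and F: "\<And>\<omega>. \<omega> \<in> space N \<Longrightarrow> mono (F \<omega>)" "\<And>\<omega>. \<omega> \<in> space N \<Longrightarrow> continuous_on UNIV (F \<omega>)"
  shows "(\<lambda>\<omega>. F \<omega> (u \<omega>)) \<in> borel_measurable N"
proof (rule borel_measurableI_greater)
  fix a
  have "\<exists>q\<in>\<rat>. q < u \<omega> \<and> a < F \<omega> q" if w: "\<omega> \<in> space N" "a < F \<omega> (u \<omega>)" for \<omega>
  proof -
    have "isCont (F \<omega>) (u \<omega>)" using F(2) w by (simp add: continuous_on_eq_continuous_at)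
    then obtain d where d: "d > 0" "\<And>y. \<bar>y - u \<omega>\<bar> < d \<Longrightarrow> \<bar>F \<omega> y - F \<omega> (u \<omega>)\<bar> < F \<omega> (u \<omega>) - a"
      using w(2) unfolding continuous_at_eps_delta by (metis dist_real_def diff_gt_0_iff_gt)
    obtain q where "q \<in> \<rat>" "u \<omega> - d < q" "q < u \<omega>"
      using Rats_dense_in_real[of "u \<omega> - d" "u \<omega>"] d by auto
    moreover then have "\<bar>F \<omega> q - F \<omega> (u \<omega>)\<bar> < F \<omega> (u \<omega>) - a" by (intro d(2)) auto
    ultimately show ?thesis by (intro bexI[of _ q]) auto
  qed
  moreover have "a < F \<omega> (u \<omega>)" if "\<omega> \<in> space N" "q < u \<omega>" "a < F \<omega> q" for q \<omega>
    using monoD[OF F(1)[OF that(1)], of q "u \<omega>"] that by auto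
  ultimately have "{\<omega> \<in> space N. a < F \<omega> (u \<omega>)} = {\<omega> \<in> space N. \<exists>q\<in>\<rat>. q < u \<omega> \<and> a < F \<omega> q}" by blast
  also have "\<dots> \<in> sets N"
  proof -
    have "{\<omega> \<in> space N. \<exists>q\<in>\<rat>. q < u \<omega> \<and> a < F \<omega> q} = (\<Union>q\<in>\<rat>. {\<omega> \<in> space N. q < u \<omega> \<and> a < F \<omega> q})"
      by blast
    also have "\<dots> \<in> sets N"
    proof (intro sets.countable_UN' countable_rat image_subsetI)
      fix q show "{\<omega> \<in> space N. q < u \<omega> \<and> a < F \<omega> q} \<in> sets N" by measurable
    qed
    finally show ?thesis .
  qed
  finally show "{\<omega> \<in> space N. a < F \<omega> (u \<omega>)} \<in> sets N" .
qed

section \<open>Measurability of composition, inversion and the Euler cocycle\<close>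

lemma measurable_Homeo_carrier:
  "h \<in> N \<rightarrow>\<^sub>M Homeo_borel \<Longrightarrow> \<omega> \<in> space N \<Longrightarrow> h \<omega> \<in> carrier Homeo_circle"
  using measurable_space space_Homeo_borel by metis

lemma measurable_euler_section_eval:
  assumes h: "h \<in> N \<rightarrow>\<^sub>M Homeo_borel" and u: "u \<in> borel_measurable N"
  shows "(\<lambda>\<omega>. euler_section (h \<omega>) (u \<omega>)) \<in> borel_measurable N"
proof (rule measurable_mono_continuous[OF _ u])
  show "(\<lambda>\<omega>. euler_section (h \<omega>) x) \<in> borel_measurable N" for x
    using measurable_compose[OF h measurable_euler_section] .
qed (use measurable_Homeo_carrier[OF h] euler_section_lift Homeo_realD(1) Homeo_real_mono in blast)+

lemma measurable_comp_Homeo: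
  assumes "h \<in> N \<rightarrow>\<^sub>M Homeo_borel" "k \<in> N \<rightarrow>\<^sub>M Homeo_borel"
  shows "(\<lambda>\<omega>. h \<omega> \<circ> k \<omega>) \<in> N \<rightarrow>\<^sub>M Homeo_borel"
proof (rule measurable_Homeo_borelI)
  fix \<omega> assume "\<omega> \<in> space N"
  note hk = measurable_Homeo_carrier[OF assms(1) this] measurable_Homeo_carrier[OF assms(2) this]
  show "euler_section (h \<omega>) \<circ> euler_section (k \<omega>) \<in> Homeo_real"
    "is_lift (euler_section (h \<omega>) \<circ> euler_section (k \<omega>)) (h \<omega> \<circ> k \<omega>)"
    using hk by (simp_all add: Homeo_real_comp is_lift_comp euler_section_lift)
next
  show "(\<lambda>\<omega>. (euler_section (h \<omega>) \<circ> euler_section (k \<omega>)) x) \<in> borel_measurable N" for x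
    unfolding comp_def using assms by (intro measurable_euler_section_eval) auto
qed

text \<open>For an increasing bijection, \<open>finv F x \<le> a\<close> iff
  \<open>x \<le> F a\<close>, so the sublevel sets of the inverse lift are superlevel sets of the
  lift itself.\<close>

lemma measurable_inv_Homeo:
  assumes "h \<in> N \<rightarrow>\<^sub>M Homeo_borel"
  shows "(\<lambda>\<omega>. finv (h \<omega>)) \<in> N \<rightarrow>\<^sub>M Homeo_borel"
proof (rule measurable_Homeo_borelI)
  fix \<omega> assume "\<omega> \<in> space N"
  note h = measurable_Homeo_carrier[OF assms(1) this]
  show "finv (euler_section (h \<omega>)) \<in> Homeo_real"
    "is_lift (finv (euler_section (h \<omega>))) (finv (h \<omega>))"
    using h by (simp_all add: Homeo_realD is_lift_inverse euler_section_lift)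
next
  fix x
  have [measurable]: "(\<lambda>\<omega>. euler_section (h \<omega>) y) \<in> borel_measurable N" for y
    using assms by (intro measurable_euler_section_eval) auto
  show "(\<lambda>\<omega>. finv (euler_section (h \<omega>)) x) \<in> borel_measurable N"
  proof (rule borel_measurableI_le)
    fix a
    have "finv (euler_section (h \<omega>)) x \<le> a \<longleftrightarrow> x \<le> euler_section (h \<omega>) a" if "\<omega> \<in> space N" for \<omega>
    proof -
      note F = euler_section_lift(1)[OF measurable_Homeo_carrier[OF assms that]]
      show ?thesis using Homeo_real_le[OF F, of "finv (euler_section (h \<omega>)) x" a] Homeo_realD(4)[OF F]
        by (simp add: bij_is_surj surj_f_inv_f)
    qed
    then have "{\<omega> \<in> space N. finv (euler_section (h \<omega>)) x \<le> a} = {\<omega> \<in> space N. x \<le> euler_section (h \<omega>) a}"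
      by auto
    also have "\<dots> \<in> sets N" by measurable
    finally show "{\<omega> \<in> space N. finv (euler_section (h \<omega>)) x \<le> a} \<in> sets N" .
  qed
qed

lemma measurable_euler_cocycle:
  assumes "h \<in> N \<rightarrow>\<^sub>M Homeo_borel" "k \<in> N \<rightarrow>\<^sub>M Homeo_borel"
  shows "(\<lambda>\<omega>. real_of_int (euler_cocycle (h \<omega>) (k \<omega>))) \<in> borel_measurable N"
proof -
  have "(\<lambda>\<omega>. euler_section (h \<omega>) (euler_section (k \<omega>) 0) - euler_section (h \<omega> \<circ> k \<omega>) 0)
      \<in> borel_measurable N"
    using assms by (intro borel_measurable_diff measurable_euler_section_eval measurable_comp_Homeo) auto
  then show ?thesis
    by (rule measurable_cong[THEN iffD1, rotated])
      (simp add: euler_section_comp measurable_Homeo_carrier[OF assms(1)] measurable_Homeo_carrier[OF assms(2)])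
qed

section \<open>Bounded cohomology with coefficients in essentially bounded functions\<close>

lemma Linf_funI:
  "f \<in> borel_measurable M \<Longrightarrow> (\<And>\<omega>. \<omega> \<in> space M \<Longrightarrow> \<bar>f \<omega>\<bar> \<le> C) \<Longrightarrow> f \<in> Linf_fun M"
  unfolding Linf_fun_def by (auto intro!: exI[of _ C])

lemma Linf_fun_add:
  assumes "f \<in> Linf_fun M" "g \<in> Linf_fun M"
  shows "(\<lambda>\<omega>. f \<omega> + g \<omega>) \<in> Linf_fun M"
proof -
  obtain C D where "AE \<omega> in M. \<bar>f \<omega>\<bar> \<le> C" "AE \<omega> in M. \<bar>g \<omega>\<bar> \<le> D"
    using assms unfolding Linf_fun_def by blast
  then have "AE \<omega> in M. \<bar>f \<omega> + g \<omega>\<bar> \<le> C + D" by eventually_elim linarith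
  then show ?thesis using assms unfolding Linf_fun_def by auto
qed

lemma Linf_fun_uminus: "f \<in> Linf_fun M \<Longrightarrow> (\<lambda>\<omega>. - f \<omega>) \<in> Linf_fun M"
  unfolding Linf_fun_def by simp

lemma Linf_fun_zero: "(\<lambda>_. 0) \<in> Linf_fun M"
  by (rule Linf_funI[where C = 0]) auto

lemma Linf_class_eqI:
  assumes "AE \<omega> in M. f \<omega> = g \<omega>" "f \<in> Linf_fun M" "g \<in> Linf_fun M"
  shows "Linf_class M f = Linf_class M g"
proof -
  have "h \<in> Linf_class M f \<Longrightarrow> h \<in> Linf_class M g"
    if "AE \<omega> in M. f \<omega> = g \<omega>" "g \<in> Linf_fun M" for f g h
    using that unfolding Linf_class_def Linf_eq_def by (auto elim: AE_mp)
  moreover have "AE \<omega> in M. g \<omega> = f \<omega>" using assms(1) by eventually_elim simp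
  ultimately show ?thesis using assms by blast
qed

lemma Linf_class_self: "f \<in> Linf_fun M \<Longrightarrow> f \<in> Linf_class M f"
  unfolding Linf_class_def Linf_eq_def by auto

lemma Linf_classD: "g \<in> Linf_class M f \<Longrightarrow> g \<in> Linf_fun M \<and> (AE \<omega> in M. f \<omega> = g \<omega>)"
  unfolding Linf_class_def Linf_eq_def by auto

lemma Linf_class_eq_iff:
  assumes "f \<in> Linf_fun M" "g \<in> Linf_fun M"
  shows "Linf_class M f = Linf_class M g \<longleftrightarrow> (AE \<omega> in M. f \<omega> = g \<omega>)"
  using Linf_class_eqI[OF _ assms] Linf_classD[of g M f] Linf_class_self[OF assms(2)] by metis

lemma carrier_Linf: "carrier (Linf \<Gamma> M act) = Linf_class M ` Linf_fun M"
  unfolding Linf_def Linf_class_def quotient_def by auto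

text \<open>Addition and action in \<open>Linf\<close> are written as unions over all
  representatives; this collapses such a union once independence of the representatives is
  known.\<close>

lemma UN_const_class:
  assumes "A \<noteq> {}" "\<And>x. x \<in> A \<Longrightarrow> B x = C"
  shows "(\<Union>x\<in>A. B x) = C"
  using assms by auto

lemma add_Linf:
  assumes "f \<in> Linf_fun M" "g \<in> Linf_fun M"
  shows "Linf_class M f \<oplus>\<^bsub>Linf \<Gamma> M act\<^esub> Linf_class M g = Linf_class M (\<lambda>\<omega>. f \<omega> + g \<omega>)"
proof -
  have "Linf_class M (\<lambda>\<omega>. f' \<omega> + g' \<omega>) = Linf_class M (\<lambda>\<omega>. f \<omega> + g \<omega>)"
    if "f' \<in> Linf_class M f" "g' \<in> Linf_class M g" for f' g'
  proof (rule Linf_class_eqI)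
    have "AE \<omega> in M. f \<omega> = f' \<omega>" "AE \<omega> in M. g \<omega> = g' \<omega>" using that Linf_classD by blast+
    then show "AE \<omega> in M. f' \<omega> + g' \<omega> = f \<omega> + g \<omega>" by eventually_elim simp
    have "f' \<in> Linf_fun M" "g' \<in> Linf_fun M" using that Linf_classD by blast+
    then show "(\<lambda>\<omega>. f' \<omega> + g' \<omega>) \<in> Linf_fun M" "(\<lambda>\<omega>. f \<omega> + g \<omega>) \<in> Linf_fun M"
      using assms by (auto intro: Linf_fun_add)
  qed
  then have "(\<Union>f'\<in>Linf_class M f. \<Union>g'\<in>Linf_class M g. Linf_class M (\<lambda>\<omega>. f' \<omega> + g' \<omega>))
      = Linf_class M (\<lambda>\<omega>. f \<omega> + g \<omega>)"
    using Linf_class_self[OF assms(1)] Linf_class_self[OF assms(2)]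
    by (intro UN_const_class) blast+
  then show ?thesis by (simp add: Linf_def)
qed

lemma abelian_group_Linf: "abelian_group (Linf \<Gamma> M act)"
proof -
  let ?A = "Linf \<Gamma> M act"
  have zero: "\<zero>\<^bsub>?A\<^esub> = Linf_class M (\<lambda>_. 0)" by (simp add: Linf_def)
  show ?thesis
  proof (rule abelian_groupI)
    show "X \<oplus>\<^bsub>?A\<^esub> Y \<in> carrier ?A" if "X \<in> carrier ?A" "Y \<in> carrier ?A" for X Y
      using that unfolding carrier_Linf by (auto simp: add_Linf intro!: imageI Linf_fun_add)
    show "\<zero>\<^bsub>?A\<^esub> \<in> carrier ?A" unfolding carrier_Linf zero using Linf_fun_zero by blast
    show "X \<oplus>\<^bsub>?A\<^esub> Y \<oplus>\<^bsub>?A\<^esub> Z = X \<oplus>\<^bsub>?A\<^esub> (Y \<oplus>\<^bsub>?A\<^esub> Z)"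
      if "X \<in> carrier ?A" "Y \<in> carrier ?A" "Z \<in> carrier ?A" for X Y Z
      using that unfolding carrier_Linf by (auto simp: add_Linf Linf_fun_add add.assoc)
    show "X \<oplus>\<^bsub>?A\<^esub> Y = Y \<oplus>\<^bsub>?A\<^esub> X" if "X \<in> carrier ?A" "Y \<in> carrier ?A" for X Y
      using that unfolding carrier_Linf by (auto simp: add_Linf add.commute)
    show "\<zero>\<^bsub>?A\<^esub> \<oplus>\<^bsub>?A\<^esub> X = X" if "X \<in> carrier ?A" for X
      using that unfolding carrier_Linf zero by (auto simp: add_Linf Linf_fun_zero)
    show "\<exists>Y\<in>carrier ?A. Y \<oplus>\<^bsub>?A\<^esub> X = \<zero>\<^bsub>?A\<^esub>" if X: "X \<in> carrier ?A" for X
    proof -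
      obtain f where f: "f \<in> Linf_fun M" "X = Linf_class M f" using X unfolding carrier_Linf by blast
      then have "Linf_class M (\<lambda>\<omega>. - f \<omega>) \<oplus>\<^bsub>?A\<^esub> X = \<zero>\<^bsub>?A\<^esub>"
        by (simp add: add_Linf Linf_fun_uminus zero)
      then show ?thesis unfolding carrier_Linf using f Linf_fun_uminus by blast
    qed
  qed
qed

lemma a_inv_Linf:
  assumes "f \<in> Linf_fun M"
  shows "\<ominus>\<^bsub>Linf \<Gamma> M act\<^esub> Linf_class M f = Linf_class M (\<lambda>\<omega>. - f \<omega>)"
proof -
  interpret abelian_group "Linf \<Gamma> M act" by (rule abelian_group_Linf)
  have "Linf_class M (\<lambda>\<omega>. - f \<omega>) \<oplus>\<^bsub>Linf \<Gamma> M act\<^esub> Linf_class M f = Linf_class M (\<lambda>_. 0)"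
    by (simp add: add_Linf assms Linf_fun_uminus)
  also have "\<dots> = \<zero>\<^bsub>Linf \<Gamma> M act\<^esub>" by (simp add: Linf_def)
  finally show ?thesis
    using assms Linf_fun_uminus by (intro minus_equality) (auto simp: carrier_Linf)
qed

lemma abelian_group_trivial_real: "abelian_group (trivial_real :: ('g, real) normed_module)"
  by (rule abelian_groupI) (auto simp: trivial_real_def intro: exI[of _ "- x" for x])

lemma a_inv_trivial_real: "\<ominus>\<^bsub>trivial_real\<^esub> x = - x"
proof -
  interpret abelian_group "trivial_real :: ('g, real) normed_module" by (rule abelian_group_trivial_real)
  show ?thesis by (rule minus_equality) (auto simp: trivial_real_def)
qed

section \<open>Cochains of degrees one and two and their representing functions\<close>

lemma tuples_1: "gs \<in> tuples G (Suc 0) \<longleftrightarrow> (\<exists>x\<in>carrier G. gs = [x])"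
  unfolding tuples_def by (auto simp: length_Suc_conv)

lemma tuples_2: "gs \<in> tuples G 2 \<longleftrightarrow> (\<exists>x\<in>carrier G. \<exists>y\<in>carrier G. gs = [x, y])"
  unfolding tuples_def by (auto simp: length_Suc_conv numeral_2_eq_2)

text \<open>The inner sum has the single index 1, and integer multiples by 1 and -1 become the
  identity and the additive inverse.\<close>

lemma coboundary_1:
  assumes A: "abelian_group A" and f: "f \<in> tuples G (Suc 0) \<rightarrow> carrier A"
    and xy: "x \<in> carrier G" "y \<in> carrier G" "x \<otimes>\<^bsub>G\<^esub> y \<in> carrier G"
  shows "coboundary G A (Suc 0) f [x, y]
    = gact A x (f [y]) \<oplus>\<^bsub>A\<^esub> \<ominus>\<^bsub>A\<^esub> f [x \<otimes>\<^bsub>G\<^esub> y] \<oplus>\<^bsub>A\<^esub> f [x]"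
proof -
  interpret abelian_group A by (rule A)
  have c: "f [x] \<in> carrier A" "f [y] \<in> carrier A" "f [x \<otimes>\<^bsub>G\<^esub> y] \<in> carrier A"
    using f xy by (auto simp: tuples_1)
  have pow1: "add_pow A (1 :: int) a = a" if "a \<in> carrier A" for a
    using that by (simp add: add_pow_int_ge)
  have pow2: "add_pow A (- 1 :: int) a = \<ominus>\<^bsub>A\<^esub> a" if "a \<in> carrier A" for a
    using that by (simp add: add_pow_int_lt)
  have "[x, y] \<in> tuples G (Suc (Suc 0))" using xy by (auto simp: tuples_def)
  then show ?thesis
    using c by (simp add: coboundary_def pow1 pow2)
qed

text \<open>Genuine functions with a single bound valid at every point and for every group element,
  instead of classes with essential bounds. They represent all bounded 1-cochains by
  \<open>bounded_cochains_1\<close>, and the pointwise bound makes later suprema finite everywhere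
  on the space.\<close>

definition bounded_functions :: "'g monoid \<Rightarrow> 'w measure \<Rightarrow> ('g \<Rightarrow> 'w \<Rightarrow> real) set"
  where "bounded_functions \<Gamma> M = {b. (\<forall>\<gamma>\<in>carrier \<Gamma>. b \<gamma> \<in> borel_measurable M)
    \<and> (\<exists>C. \<forall>\<gamma>\<in>carrier \<Gamma>. \<forall>\<omega>\<in>space M. \<bar>b \<gamma> \<omega>\<bar> \<le> C)}"

lemma bounded_functions_Linf: "b \<in> bounded_functions \<Gamma> M \<Longrightarrow> \<gamma> \<in> carrier \<Gamma> \<Longrightarrow> b \<gamma> \<in> Linf_fun M"
  unfolding bounded_functions_def using Linf_funI by blast

lemma bounded_functions_diff:
  assumes "b \<in> bounded_functions \<Gamma> M" "c \<in> bounded_functions \<Gamma> M"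
  shows "(\<lambda>\<gamma> \<omega>. b \<gamma> \<omega> - c \<gamma> \<omega>) \<in> bounded_functions \<Gamma> M"
proof -
  obtain C D where "\<forall>\<gamma>\<in>carrier \<Gamma>. \<forall>\<omega>\<in>space M. \<bar>b \<gamma> \<omega>\<bar> \<le> C"
    "\<forall>\<gamma>\<in>carrier \<Gamma>. \<forall>\<omega>\<in>space M. \<bar>c \<gamma> \<omega>\<bar> \<le> D"
    using assms unfolding bounded_functions_def by blast
  then have "\<forall>\<gamma>\<in>carrier \<Gamma>. \<forall>\<omega>\<in>space M. \<bar>b \<gamma> \<omega> - c \<gamma> \<omega>\<bar> \<le> C + D"
    by (metis abs_triangle_ineq4 add_mono order_trans)
  moreover have "\<forall>\<gamma>\<in>carrier \<Gamma>. (\<lambda>\<omega>. b \<gamma> \<omega> - c \<gamma> \<omega>) \<in> borel_measurable M"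
    using assms unfolding bounded_functions_def by (intro ballI borel_measurable_diff) auto
  ultimately show ?thesis unfolding bounded_functions_def by blast
qed

lemma bounded_functions_zero: "(\<lambda>_ _. 0) \<in> bounded_functions \<Gamma> M"
  unfolding bounded_functions_def by auto

definition cochain1 :: "'g monoid \<Rightarrow> 'w measure \<Rightarrow> ('g \<Rightarrow> 'w \<Rightarrow> real) \<Rightarrow> 'g list \<Rightarrow> ('w \<Rightarrow> real) set"
  where "cochain1 \<Gamma> M b = (\<lambda>gs\<in>tuples \<Gamma> (Suc 0). Linf_class M (b (hd gs)))"

definition cochain2 ::
    "'g monoid \<Rightarrow> 'w measure \<Rightarrow> ('g \<Rightarrow> 'g \<Rightarrow> 'w \<Rightarrow> real) \<Rightarrow> 'g list \<Rightarrow> ('w \<Rightarrow> real) set"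
  where "cochain2 \<Gamma> M p = (\<lambda>gs\<in>tuples \<Gamma> 2. Linf_class M (p (gs ! 0) (gs ! 1)))"

lemma nrm_Linf_le:
  assumes "f \<in> borel_measurable M" "\<And>\<omega>. \<omega> \<in> space M \<Longrightarrow> \<bar>f \<omega>\<bar> \<le> C" "0 \<le> C"
  shows "nrm (Linf \<Gamma> M act) (Linf_class M f) \<le> C"
proof -
  have "AE \<omega> in M. \<bar>g \<omega>\<bar> \<le> C" if "g \<in> Linf_class M f" for g
  proof -
    have "AE \<omega> in M. f \<omega> = g \<omega>" using that Linf_classD by blast
    then show ?thesis using AE_space by eventually_elim (metis assms(2))
  qed
  then have "Inf {C. 0 \<le> C \<and> (\<forall>f\<in>Linf_class M f. AE \<omega> in M. \<bar>f \<omega>\<bar> \<le> C)} \<le> C"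
    using assms(3) by (intro cInf_lower bdd_belowI[of _ 0]) auto
  then show ?thesis by (simp add: Linf_def)
qed

text \<open>The \<open>+ 1\<close> saves showing that the infimum in the norm is attained.\<close>

lemma AE_bound_nrm_Linf:
  assumes "f \<in> Linf_fun M" "nrm (Linf \<Gamma> M act) (Linf_class M f) \<le> C"
  shows "AE \<omega> in M. \<bar>f \<omega>\<bar> \<le> C + 1"
proof -
  let ?S = "{C. 0 \<le> C \<and> (\<forall>f\<in>Linf_class M f. AE \<omega> in M. \<bar>f \<omega>\<bar> \<le> C)}"
  obtain D where D: "AE \<omega> in M. \<bar>f \<omega>\<bar> \<le> D" using assms unfolding Linf_fun_def by blast
  have "AE \<omega> in M. \<bar>g \<omega>\<bar> \<le> max D 0" if "g \<in> Linf_class M f" for g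
  proof -
    have "AE \<omega> in M. f \<omega> = g \<omega>" using that Linf_classD by blast
    then show ?thesis using D by eventually_elim auto
  qed
  then have "max D 0 \<in> ?S" by simp
  then have ne: "?S \<noteq> {}" by blast
  have "Inf ?S < C + 1" using assms(2) by (simp add: Linf_def)
  from cInf_lessD[OF ne this] obtain C' where C': "C' \<in> ?S" "C' < C + 1" by blast
  then have "AE \<omega> in M. \<bar>f \<omega>\<bar> \<le> C'" using Linf_class_self[OF assms(1)] by blast
  then show ?thesis by eventually_elim (use C'(2) in auto)
qed

text \<open>The norm bound of a cochain controls its representatives only almost everywhere.
  Truncating them at a common level changes them on null sets and produces an everywhere bounded
  family.\<close>

lemma bounded_cochains_1:
  "carrier (bounded_cochains \<Gamma> (Linf \<Gamma> M act) (Suc 0)) = cochain1 \<Gamma> M ` bounded_functions \<Gamma> M"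
proof (intro equalityI subsetI)
  fix F assume F: "F \<in> carrier (bounded_cochains \<Gamma> (Linf \<Gamma> M act) (Suc 0))"
  then have Fc: "F \<in> tuples \<Gamma> (Suc 0) \<rightarrow>\<^sub>E carrier (Linf \<Gamma> M act)" by (simp add: bounded_cochains_def)
  obtain C where C: "\<forall>gs\<in>tuples \<Gamma> (Suc 0). nrm (Linf \<Gamma> M act) (F gs) \<le> C"
    using F by (auto simp: bounded_cochains_def)
  have "\<exists>f. f \<in> Linf_fun M \<and> F [\<gamma>] = Linf_class M f" if "\<gamma> \<in> carrier \<Gamma>" for \<gamma>
  proof -
    have "F [\<gamma>] \<in> carrier (Linf \<Gamma> M act)" using Fc that by (auto simp: tuples_1)
    then show ?thesis unfolding carrier_Linf by blast
  qed
  then obtain f where f: "\<And>\<gamma>. \<gamma> \<in> carrier \<Gamma> \<Longrightarrow> f \<gamma> \<in> Linf_fun M"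
    "\<And>\<gamma>. \<gamma> \<in> carrier \<Gamma> \<Longrightarrow> F [\<gamma>] = Linf_class M (f \<gamma>)" by metis
  \<comment> \<open>\<open>C + 1\<close> is the essential bound from
    \<open>AE_bound_nrm_Linf\<close>; the absolute value keeps the truncation interval nonempty even
    if \<open>C + 1\<close> is negative.\<close>
  define b where "b \<gamma> \<omega> = max (- \<bar>C + 1\<bar>) (min \<bar>C + 1\<bar> (f \<gamma> \<omega>))" for \<gamma> \<omega>
  have bm: "b \<gamma> \<in> borel_measurable M" if "\<gamma> \<in> carrier \<Gamma>" for \<gamma>
    using f(1)[OF that] unfolding b_def[abs_def] Linf_fun_def by auto
  have bC: "\<bar>b \<gamma> \<omega>\<bar> \<le> \<bar>C + 1\<bar>" for \<gamma> \<omega> unfolding b_def by auto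
  have b: "b \<in> bounded_functions \<Gamma> M"
    using bm bC unfolding bounded_functions_def by blast
  have "Linf_class M (b \<gamma>) = F [\<gamma>]" if "\<gamma> \<in> carrier \<Gamma>" for \<gamma>
    unfolding f(2)[OF that]
  proof (rule Linf_class_eqI)
    have "AE \<omega> in M. \<bar>f \<gamma> \<omega>\<bar> \<le> C + 1"
      using C[rule_format, of "[\<gamma>]"] f[OF that] that
      by (intro AE_bound_nrm_Linf[where \<Gamma> = \<Gamma> and act = act]) (simp_all add: tuples_1)
    then show "AE \<omega> in M. b \<gamma> \<omega> = f \<gamma> \<omega>" by eventually_elim (auto simp: b_def)
    show "b \<gamma> \<in> Linf_fun M" "f \<gamma> \<in> Linf_fun M"
      by (rule bounded_functions_Linf[OF b that] f(1)[OF that])+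
  qed
  then have "F = cochain1 \<Gamma> M b"
    using Fc unfolding cochain1_def
    by (intro ext) (auto simp: tuples_1 PiE_def extensional_def)
  then show "F \<in> cochain1 \<Gamma> M ` bounded_functions \<Gamma> M" using b by blast
next
  fix F assume "F \<in> cochain1 \<Gamma> M ` bounded_functions \<Gamma> M"
  then obtain b where b: "b \<in> bounded_functions \<Gamma> M" "F = cochain1 \<Gamma> M b" by blast
  then obtain C where C: "\<forall>\<gamma>\<in>carrier \<Gamma>. \<forall>\<omega>\<in>space M. \<bar>b \<gamma> \<omega>\<bar> \<le> C"
    unfolding bounded_functions_def by blast
  have "nrm (Linf \<Gamma> M act) (Linf_class M (b \<gamma>)) \<le> \<bar>C\<bar>" if "\<gamma> \<in> carrier \<Gamma>" for \<gamma>
  proof (rule nrm_Linf_le)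
    show "b \<gamma> \<in> borel_measurable M" using b(1) that by (simp add: bounded_functions_def)
    show "\<bar>b \<gamma> \<omega>\<bar> \<le> \<bar>C\<bar>" if "\<omega> \<in> space M" for \<omega>
      using C \<open>\<gamma> \<in> carrier \<Gamma>\<close> that by (meson abs_ge_self order_trans)
  qed simp
  then have "\<forall>gs\<in>tuples \<Gamma> (Suc 0). nrm (Linf \<Gamma> M act) (F gs) \<le> \<bar>C\<bar>"
    unfolding b(2) cochain1_def by (auto simp: tuples_1)
  then have "\<exists>C. \<forall>gs\<in>tuples \<Gamma> (Suc 0). nrm (Linf \<Gamma> M act) (F gs) \<le> C" by blast
  moreover have "F \<in> tuples \<Gamma> (Suc 0) \<rightarrow>\<^sub>E carrier (Linf \<Gamma> M act)"
    using bounded_functions_Linf[OF b(1)] unfolding b(2) cochain1_def carrier_Linf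
    by (auto simp: tuples_1)
  ultimately show "F \<in> carrier (bounded_cochains \<Gamma> (Linf \<Gamma> M act) (Suc 0))"
    unfolding bounded_cochains_def partial_object.select_convs by (intro CollectI conjI)
qed

context standard_borel_probability_space_action
begin

lemma group_Gamma: "group \<Gamma>"
  using group_hom group_hom.axioms(1) by blast

lemma measurable_act: "\<gamma> \<in> carrier \<Gamma> \<Longrightarrow> act \<gamma> \<in> M \<rightarrow>\<^sub>M M"
  using measurable_compose[OF measurable_Pair1' measurable_action, of \<gamma>] by simp

lemma act_space: "\<gamma> \<in> carrier \<Gamma> \<Longrightarrow> \<omega> \<in> space M \<Longrightarrow> act \<gamma> \<omega> \<in> space M"
  by (rule measurable_space[OF measurable_act])

lemma AE_act:
  assumes "\<gamma> \<in> carrier \<Gamma>" "AE \<omega> in M. P \<omega>"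
  shows "AE \<omega> in M. P (act \<gamma> \<omega>)"
  by (rule AE_distrD[OF measurable_act[OF assms(1)], of P, unfolded measure_preserving[OF assms(1)], OF assms(2)])

lemma inv_closed: "\<gamma> \<in> carrier \<Gamma> \<Longrightarrow> inv\<^bsub>\<Gamma>\<^esub> \<gamma> \<in> carrier \<Gamma>"
  using group.inv_closed group_Gamma by metis

lemma mult_closed: "\<gamma> \<in> carrier \<Gamma> \<Longrightarrow> \<eta> \<in> carrier \<Gamma> \<Longrightarrow> \<gamma> \<otimes>\<^bsub>\<Gamma>\<^esub> \<eta> \<in> carrier \<Gamma>"
  using monoid.m_closed group.is_monoid group_Gamma by metis

lemma act_inv_mult:
  assumes "\<gamma> \<in> carrier \<Gamma>" "\<eta> \<in> carrier \<Gamma>" "\<omega> \<in> space M"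
  shows "act (inv\<^bsub>\<Gamma>\<^esub> (\<gamma> \<otimes>\<^bsub>\<Gamma>\<^esub> \<eta>)) \<omega> = act (inv\<^bsub>\<Gamma>\<^esub> \<eta>) (act (inv\<^bsub>\<Gamma>\<^esub> \<gamma>) \<omega>)"
  using assms by (simp add: group.inv_mult_group[OF group_Gamma] composition_rule inv_closed)

lemma Linf_fun_act:
  assumes "f \<in> Linf_fun M" "\<gamma> \<in> carrier \<Gamma>"
  shows "(\<lambda>\<omega>. f (act \<gamma> \<omega>)) \<in> Linf_fun M"
proof -
  have "(\<lambda>\<omega>. f (act \<gamma> \<omega>)) \<in> borel_measurable M"
    using assms unfolding Linf_fun_def by (intro measurable_compose[OF measurable_act]) auto
  moreover obtain C where "AE \<omega> in M. \<bar>f \<omega>\<bar> \<le> C" using assms unfolding Linf_fun_def by blast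
  then have "AE \<omega> in M. \<bar>f (act \<gamma> \<omega>)\<bar> \<le> C" by (rule AE_act[OF assms(2)])
  ultimately show ?thesis unfolding Linf_fun_def by blast
qed

lemma gact_Linf:
  assumes "f \<in> Linf_fun M" "\<gamma> \<in> carrier \<Gamma>"
  shows "gact (Linf \<Gamma> M act) \<gamma> (Linf_class M f) = Linf_class M (\<lambda>\<omega>. f (act (inv\<^bsub>\<Gamma>\<^esub> \<gamma>) \<omega>))"
proof -
  have "Linf_class M (\<lambda>\<omega>. f' (act (inv\<^bsub>\<Gamma>\<^esub> \<gamma>) \<omega>)) = Linf_class M (\<lambda>\<omega>. f (act (inv\<^bsub>\<Gamma>\<^esub> \<gamma>) \<omega>))"
    if "f' \<in> Linf_class M f" for f'
  proof (rule Linf_class_eqI)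
    have "AE \<omega> in M. f \<omega> = f' \<omega>" using that Linf_classD by blast
    from AE_act[OF inv_closed[OF assms(2)] this]
    show "AE \<omega> in M. f' (act (inv\<^bsub>\<Gamma>\<^esub> \<gamma>) \<omega>) = f (act (inv\<^bsub>\<Gamma>\<^esub> \<gamma>) \<omega>)" by eventually_elim simp
    have "f' \<in> Linf_fun M" using that Linf_classD by blast
    then show "(\<lambda>\<omega>. f' (act (inv\<^bsub>\<Gamma>\<^esub> \<gamma>) \<omega>)) \<in> Linf_fun M" "(\<lambda>\<omega>. f (act (inv\<^bsub>\<Gamma>\<^esub> \<gamma>) \<omega>)) \<in> Linf_fun M"
      using assms by (auto intro: Linf_fun_act inv_closed)
  qed
  then have "(\<Union>f'\<in>Linf_class M f. Linf_class M (\<lambda>\<omega>. f' (act (inv\<^bsub>\<Gamma>\<^esub> \<gamma>) \<omega>)))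
      = Linf_class M (\<lambda>\<omega>. f (act (inv\<^bsub>\<Gamma>\<^esub> \<gamma>) \<omega>))"
    using Linf_class_self[OF assms(1)] by (intro UN_const_class) blast+
  then show ?thesis by (simp add: Linf_def)
qed

definition delta :: "('g \<Rightarrow> 'w \<Rightarrow> real) \<Rightarrow> 'g \<Rightarrow> 'g \<Rightarrow> 'w \<Rightarrow> real"
  where "delta b \<gamma> \<eta> \<omega> = b \<eta> (act (inv\<^bsub>\<Gamma>\<^esub> \<gamma>) \<omega>) - b (\<gamma> \<otimes>\<^bsub>\<Gamma>\<^esub> \<eta>) \<omega> + b \<gamma> \<omega>"

lemma delta_Linf:
  assumes "b \<in> bounded_functions \<Gamma> M" "\<gamma> \<in> carrier \<Gamma>" "\<eta> \<in> carrier \<Gamma>"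
  shows "delta b \<gamma> \<eta> \<in> Linf_fun M"
proof -
  note L = bounded_functions_Linf[OF assms(1)]
  have "(\<lambda>\<omega>. b \<eta> (act (inv\<^bsub>\<Gamma>\<^esub> \<gamma>) \<omega>) + - b (\<gamma> \<otimes>\<^bsub>\<Gamma>\<^esub> \<eta>) \<omega> + b \<gamma> \<omega>) \<in> Linf_fun M"
    using assms by (intro Linf_fun_add Linf_fun_uminus Linf_fun_act L inv_closed mult_closed)
  then show ?thesis by (simp add: delta_def[abs_def])
qed

lemma coboundary_cochain1:
  assumes b: "b \<in> bounded_functions \<Gamma> M"
  shows "coboundary \<Gamma> (Linf \<Gamma> M act) (Suc 0) (cochain1 \<Gamma> M b) = cochain2 \<Gamma> M (delta b)"
proof
  fix gs
  note L = bounded_functions_Linf[OF b]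
  show "coboundary \<Gamma> (Linf \<Gamma> M act) (Suc 0) (cochain1 \<Gamma> M b) gs = cochain2 \<Gamma> M (delta b) gs"
  proof (cases "gs \<in> tuples \<Gamma> 2")
    case True
    then obtain x y where xy: "x \<in> carrier \<Gamma>" "y \<in> carrier \<Gamma>" "gs = [x, y]" by (auto simp: tuples_2)
    have c: "cochain1 \<Gamma> M b [z] = Linf_class M (b z)" if "z \<in> carrier \<Gamma>" for z
      using that by (simp add: cochain1_def tuples_1)
    have "cochain1 \<Gamma> M b \<in> tuples \<Gamma> (Suc 0) \<rightarrow> carrier (Linf \<Gamma> M act)"
      using L c by (auto simp: tuples_1 carrier_Linf)
    from coboundary_1[OF abelian_group_Linf this xy(1,2) mult_closed[OF xy(1,2)]]
    have "coboundary \<Gamma> (Linf \<Gamma> M act) (Suc 0) (cochain1 \<Gamma> M b) gs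
      = Linf_class M (\<lambda>\<omega>. b y (act (inv\<^bsub>\<Gamma>\<^esub> x) \<omega>)) \<oplus>\<^bsub>Linf \<Gamma> M act\<^esub>
        Linf_class M (\<lambda>\<omega>. - b (x \<otimes>\<^bsub>\<Gamma>\<^esub> y) \<omega>) \<oplus>\<^bsub>Linf \<Gamma> M act\<^esub> Linf_class M (b x)"
      using xy by (simp add: c mult_closed gact_Linf L a_inv_Linf)
    also have "\<dots> = Linf_class M (\<lambda>\<omega>. b y (act (inv\<^bsub>\<Gamma>\<^esub> x) \<omega>) + - b (x \<otimes>\<^bsub>\<Gamma>\<^esub> y) \<omega> + b x \<omega>)"
      using xy by (simp only: add_Linf Linf_fun_add Linf_fun_uminus Linf_fun_act L inv_closed mult_closed)
    finally show ?thesis using True xy by (simp add: cochain2_def delta_def[abs_def])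
  qed (simp add: coboundary_def cochain2_def numeral_2_eq_2)
qed

lemma bounded_coboundaries_2:
  "bounded_coboundaries \<Gamma> (Linf \<Gamma> M act) 2 = (\<lambda>b. cochain2 \<Gamma> M (delta b)) ` bounded_functions \<Gamma> M"
  unfolding bounded_coboundaries_def numeral_2_eq_2
  by (simp add: bounded_cochains_1 image_image coboundary_cochain1)

lemma cochain2_cong:
  assumes "\<And>\<gamma> \<eta>. \<gamma> \<in> carrier \<Gamma> \<Longrightarrow> \<eta> \<in> carrier \<Gamma> \<Longrightarrow> AE \<omega> in M. p \<gamma> \<eta> \<omega> = q \<gamma> \<eta> \<omega>"
    and "\<And>\<gamma> \<eta>. \<gamma> \<in> carrier \<Gamma> \<Longrightarrow> \<eta> \<in> carrier \<Gamma> \<Longrightarrow> p \<gamma> \<eta> \<in> Linf_fun M"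
    and "\<And>\<gamma> \<eta>. \<gamma> \<in> carrier \<Gamma> \<Longrightarrow> \<eta> \<in> carrier \<Gamma> \<Longrightarrow> q \<gamma> \<eta> \<in> Linf_fun M"
  shows "cochain2 \<Gamma> M p = cochain2 \<Gamma> M q"
  unfolding cochain2_def using assms by (intro restrict_ext Linf_class_eqI) (auto simp: tuples_2)

lemma bounded_class_cochain2:
  assumes p: "\<And>\<gamma> \<eta>. \<gamma> \<in> carrier \<Gamma> \<Longrightarrow> \<eta> \<in> carrier \<Gamma> \<Longrightarrow> p \<gamma> \<eta> \<in> Linf_fun M"
  shows "bounded_class \<Gamma> (Linf \<Gamma> M act) 2 (cochain2 \<Gamma> M p)
    = (\<lambda>b. cochain2 \<Gamma> M (\<lambda>\<gamma> \<eta> \<omega>. delta b \<gamma> \<eta> \<omega> + p \<gamma> \<eta> \<omega>)) ` bounded_functions \<Gamma> M"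
proof -
  have "(\<lambda>gs\<in>tuples \<Gamma> 2. cochain2 \<Gamma> M (delta b) gs \<oplus>\<^bsub>Linf \<Gamma> M act\<^esub> cochain2 \<Gamma> M p gs)
      = cochain2 \<Gamma> M (\<lambda>\<gamma> \<eta> \<omega>. delta b \<gamma> \<eta> \<omega> + p \<gamma> \<eta> \<omega>)" if "b \<in> bounded_functions \<Gamma> M" for b
    using p that by (intro ext) (auto simp: cochain2_def tuples_2 add_Linf delta_Linf)
  then show ?thesis
    unfolding bounded_class_def r_coset_def bounded_coboundaries_2 bounded_cocycles_def bounded_cochains_def
    by auto
qed

text \<open>The identity of the quotient is the set of coboundaries, so the question is when a coset
  equals that set. The coset element obtained from the zero function is \<open>p\<close> itself,
  which yields the primitive; conversely, adding the primitive to \<open>a\<close> matches the two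
  sets in both directions.\<close>

lemma bounded_class_cochain2_trivial_iff:
  assumes p: "\<And>\<gamma> \<eta>. \<gamma> \<in> carrier \<Gamma> \<Longrightarrow> \<eta> \<in> carrier \<Gamma> \<Longrightarrow> p \<gamma> \<eta> \<in> Linf_fun M"
  shows "bounded_class \<Gamma> (Linf \<Gamma> M act) 2 (cochain2 \<Gamma> M p) = \<one>\<^bsub>bounded_cohomology \<Gamma> (Linf \<Gamma> M act) 2\<^esub>
    \<longleftrightarrow> (\<exists>b\<in>bounded_functions \<Gamma> M. \<forall>\<gamma>\<in>carrier \<Gamma>. \<forall>\<eta>\<in>carrier \<Gamma>. AE \<omega> in M. p \<gamma> \<eta> \<omega> = delta b \<gamma> \<eta> \<omega>)"
    (is "?L = ?one \<longleftrightarrow> ?R")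
proof -
  have one: "?one = (\<lambda>b. cochain2 \<Gamma> M (delta b)) ` bounded_functions \<Gamma> M"
    by (simp add: bounded_cohomology_def bounded_coboundaries_2)
  have L: "?L = (\<lambda>b. cochain2 \<Gamma> M (\<lambda>\<gamma> \<eta> \<omega>. delta b \<gamma> \<eta> \<omega> + p \<gamma> \<eta> \<omega>)) ` bounded_functions \<Gamma> M"
    by (rule bounded_class_cochain2) (rule p)
  have dd: "delta (\<lambda>\<gamma> \<omega>. b \<gamma> \<omega> - c \<gamma> \<omega>) \<gamma> \<eta> \<omega> = delta b \<gamma> \<eta> \<omega> - delta c \<gamma> \<eta> \<omega>" for b c \<gamma> \<eta> \<omega>
    by (simp add: delta_def)
  show ?thesis
  proof
    assume "?L = ?one"
    moreover have "cochain2 \<Gamma> M (\<lambda>\<gamma> \<eta> \<omega>. delta (\<lambda>_ _. 0) \<gamma> \<eta> \<omega> + p \<gamma> \<eta> \<omega>) \<in> ?L"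
      unfolding L using bounded_functions_zero by blast
    ultimately obtain b where b: "b \<in> bounded_functions \<Gamma> M"
      "cochain2 \<Gamma> M (\<lambda>\<gamma> \<eta> \<omega>. delta (\<lambda>_ _. 0) \<gamma> \<eta> \<omega> + p \<gamma> \<eta> \<omega>) = cochain2 \<Gamma> M (delta b)"
      unfolding one by blast
    have "AE \<omega> in M. p \<gamma> \<eta> \<omega> = delta b \<gamma> \<eta> \<omega>" if "\<gamma> \<in> carrier \<Gamma>" "\<eta> \<in> carrier \<Gamma>" for \<gamma> \<eta>
    proof -
      have "cochain2 \<Gamma> M (\<lambda>\<gamma> \<eta> \<omega>. delta (\<lambda>_ _. 0) \<gamma> \<eta> \<omega> + p \<gamma> \<eta> \<omega>) [\<gamma>, \<eta>] = cochain2 \<Gamma> M (delta b) [\<gamma>, \<eta>]"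
        using b(2) by simp
      then have "Linf_class M (p \<gamma> \<eta>) = Linf_class M (delta b \<gamma> \<eta>)"
        using that by (simp add: cochain2_def tuples_2 delta_def[of "\<lambda>_ _. 0"])
      then show ?thesis using Linf_class_eq_iff p delta_Linf b that by blast
    qed
    then show ?R using b by blast
  next
    assume ?R
    then obtain b where b: "b \<in> bounded_functions \<Gamma> M"
      "\<And>\<gamma> \<eta>. \<gamma> \<in> carrier \<Gamma> \<Longrightarrow> \<eta> \<in> carrier \<Gamma> \<Longrightarrow> AE \<omega> in M. p \<gamma> \<eta> \<omega> = delta b \<gamma> \<eta> \<omega>" by blast
    have eq: "cochain2 \<Gamma> M (\<lambda>\<gamma> \<eta> \<omega>. delta a \<gamma> \<eta> \<omega> + p \<gamma> \<eta> \<omega>)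
        = cochain2 \<Gamma> M (delta (\<lambda>\<gamma> \<omega>. a \<gamma> \<omega> - - b \<gamma> \<omega>))"
      if a: "a \<in> bounded_functions \<Gamma> M" for a
    proof (rule cochain2_cong)
      fix \<gamma> \<eta> assume g: "\<gamma> \<in> carrier \<Gamma>" "\<eta> \<in> carrier \<Gamma>"
      show "AE \<omega> in M. delta a \<gamma> \<eta> \<omega> + p \<gamma> \<eta> \<omega> = delta (\<lambda>\<gamma> \<omega>. a \<gamma> \<omega> - - b \<gamma> \<omega>) \<gamma> \<eta> \<omega>"
        using b(2)[OF g] by eventually_elim (simp add: delta_def)
      show "(\<lambda>\<omega>. delta a \<gamma> \<eta> \<omega> + p \<gamma> \<eta> \<omega>) \<in> Linf_fun M"
        using g a p delta_Linf by (intro Linf_fun_add) auto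
      have "(\<lambda>\<gamma> \<omega>. - b \<gamma> \<omega>) \<in> bounded_functions \<Gamma> M"
        using bounded_functions_diff[OF bounded_functions_zero b(1)] by simp
      then show "delta (\<lambda>\<gamma> \<omega>. a \<gamma> \<omega> - - b \<gamma> \<omega>) \<gamma> \<eta> \<in> Linf_fun M"
        using g a by (intro delta_Linf bounded_functions_diff)
    qed
    have nb: "(\<lambda>\<gamma> \<omega>. - b \<gamma> \<omega>) \<in> bounded_functions \<Gamma> M"
      using bounded_functions_diff[OF bounded_functions_zero b(1)] by simp
    show "?L = ?one"
      unfolding L one
    proof (intro equalityI subsetI; elim imageE; hypsubst)
      fix a assume a: "a \<in> bounded_functions \<Gamma> M"
      show "cochain2 \<Gamma> M (\<lambda>\<gamma> \<eta> \<omega>. delta a \<gamma> \<eta> \<omega> + p \<gamma> \<eta> \<omega>)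
          \<in> (\<lambda>b. cochain2 \<Gamma> M (delta b)) ` bounded_functions \<Gamma> M"
        unfolding eq[OF a] using bounded_functions_diff[OF a nb] by blast
    next
      fix a assume a: "a \<in> bounded_functions \<Gamma> M"
      have "(\<lambda>\<gamma> \<omega>. a \<gamma> \<omega> - b \<gamma> \<omega>) \<in> bounded_functions \<Gamma> M" using bounded_functions_diff[OF a b(1)] .
      moreover from eq[OF this] have "cochain2 \<Gamma> M (delta a)
          = cochain2 \<Gamma> M (\<lambda>\<gamma> \<eta> \<omega>. delta (\<lambda>\<gamma> \<omega>. a \<gamma> \<omega> - b \<gamma> \<omega>) \<gamma> \<eta> \<omega> + p \<gamma> \<eta> \<omega>)" by simp
      ultimately show "cochain2 \<Gamma> M (delta a)
          \<in> (\<lambda>b. cochain2 \<Gamma> M (\<lambda>\<gamma> \<eta> \<omega>. delta b \<gamma> \<eta> \<omega> + p \<gamma> \<eta> \<omega>)) ` bounded_functions \<Gamma> M"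
        by blast
    qed
  qed
qed

text \<open>One inclusion of cosets is proved for arbitrary data by shifting the primitive; using it
  with \<open>b\<close> and with its negative gives equality.\<close>

lemma bounded_class_cochain2_eqI:
  assumes p: "\<And>\<gamma> \<eta>. \<gamma> \<in> carrier \<Gamma> \<Longrightarrow> \<eta> \<in> carrier \<Gamma> \<Longrightarrow> p \<gamma> \<eta> \<in> Linf_fun M"
    and q: "\<And>\<gamma> \<eta>. \<gamma> \<in> carrier \<Gamma> \<Longrightarrow> \<eta> \<in> carrier \<Gamma> \<Longrightarrow> q \<gamma> \<eta> \<in> Linf_fun M"
    and b: "b \<in> bounded_functions \<Gamma> M"
    and eq: "\<And>\<gamma> \<eta>. \<gamma> \<in> carrier \<Gamma> \<Longrightarrow> \<eta> \<in> carrier \<Gamma> \<Longrightarrow> AE \<omega> in M. q \<gamma> \<eta> \<omega> = delta b \<gamma> \<eta> \<omega> + p \<gamma> \<eta> \<omega>"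
  shows "bounded_class \<Gamma> (Linf \<Gamma> M act) 2 (cochain2 \<Gamma> M q)
    = bounded_class \<Gamma> (Linf \<Gamma> M act) 2 (cochain2 \<Gamma> M p)"
proof -
  have sub: "bounded_class \<Gamma> (Linf \<Gamma> M act) 2 (cochain2 \<Gamma> M q)
      \<subseteq> bounded_class \<Gamma> (Linf \<Gamma> M act) 2 (cochain2 \<Gamma> M p)"
    if p: "\<And>\<gamma> \<eta>. \<gamma> \<in> carrier \<Gamma> \<Longrightarrow> \<eta> \<in> carrier \<Gamma> \<Longrightarrow> p \<gamma> \<eta> \<in> Linf_fun M"
      and q: "\<And>\<gamma> \<eta>. \<gamma> \<in> carrier \<Gamma> \<Longrightarrow> \<eta> \<in> carrier \<Gamma> \<Longrightarrow> q \<gamma> \<eta> \<in> Linf_fun M"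
      and b: "b \<in> bounded_functions \<Gamma> M"
      and eq: "\<And>\<gamma> \<eta>. \<gamma> \<in> carrier \<Gamma> \<Longrightarrow> \<eta> \<in> carrier \<Gamma> \<Longrightarrow> AE \<omega> in M. q \<gamma> \<eta> \<omega> = p \<gamma> \<eta> \<omega> - delta b \<gamma> \<eta> \<omega>"
    for p q b
  proof (subst (1 2) bounded_class_cochain2; (intro subsetI, elim imageE, hypsubst)?)
    fix a assume a: "a \<in> bounded_functions \<Gamma> M"
    let ?c = "\<lambda>\<gamma> \<omega>. a \<gamma> \<omega> - b \<gamma> \<omega>"
    have c: "?c \<in> bounded_functions \<Gamma> M" by (rule bounded_functions_diff[OF a b])
    have "cochain2 \<Gamma> M (\<lambda>\<gamma> \<eta> \<omega>. delta a \<gamma> \<eta> \<omega> + q \<gamma> \<eta> \<omega>)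
        = cochain2 \<Gamma> M (\<lambda>\<gamma> \<eta> \<omega>. delta ?c \<gamma> \<eta> \<omega> + p \<gamma> \<eta> \<omega>)"
    proof (rule cochain2_cong)
      fix \<gamma> \<eta> assume g: "\<gamma> \<in> carrier \<Gamma>" "\<eta> \<in> carrier \<Gamma>"
      show "AE \<omega> in M. delta a \<gamma> \<eta> \<omega> + q \<gamma> \<eta> \<omega> = delta ?c \<gamma> \<eta> \<omega> + p \<gamma> \<eta> \<omega>"
        using eq[OF g] by eventually_elim (simp add: delta_def)
    qed (use a c p q delta_Linf in \<open>auto intro!: Linf_fun_add\<close>)
    then show "cochain2 \<Gamma> M (\<lambda>\<gamma> \<eta> \<omega>. delta a \<gamma> \<eta> \<omega> + q \<gamma> \<eta> \<omega>)
        \<in> (\<lambda>b. cochain2 \<Gamma> M (\<lambda>\<gamma> \<eta> \<omega>. delta b \<gamma> \<eta> \<omega> + p \<gamma> \<eta> \<omega>)) ` bounded_functions \<Gamma> M"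
      using c by blast
  qed (use p q in blast)+
  have nb: "(\<lambda>\<gamma> \<omega>. 0 - b \<gamma> \<omega>) \<in> bounded_functions \<Gamma> M"
    by (rule bounded_functions_diff[OF bounded_functions_zero b])
  show ?thesis
  proof (intro equalityI sub[OF p q nb] sub[OF q p b])
    fix \<gamma> \<eta> assume g: "\<gamma> \<in> carrier \<Gamma>" "\<eta> \<in> carrier \<Gamma>"
    show "AE \<omega> in M. q \<gamma> \<eta> \<omega> = p \<gamma> \<eta> \<omega> - delta (\<lambda>\<gamma> \<omega>. 0 - b \<gamma> \<omega>) \<gamma> \<eta> \<omega>"
      using eq[OF g] by eventually_elim (simp add: delta_def)
    show "AE \<omega> in M. p \<gamma> \<eta> \<omega> = q \<gamma> \<eta> \<omega> - delta b \<gamma> \<eta> \<omega>"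
      using eq[OF g] by eventually_elim simp
  qed
qed

end

section \<open>The parametrized Euler class\<close>

text \<open>Every generated element is the product of a word in the generators and their inverses,
  and there are countably many such words.\<close>

lemma (in group) countable_generate:
  assumes "countable S" "S \<subseteq> carrier G"
  shows "countable (generate G S)"
proof -
  let ?T = "S \<union> (\<lambda>x. inv x) ` S"
  let ?p = "\<lambda>ws. foldr (\<otimes>) ws \<one>"
  have closed: "?p ws \<in> carrier G" if "ws \<in> lists ?T" for ws
    using that assms(2) by (induction ws) auto
  have append: "?p (xs @ ys) = ?p xs \<otimes> ?p ys" if "xs \<in> lists ?T" "ys \<in> lists ?T" for xs ys
    using that(1)
  proof (induction xs)
    case Nil
    then show ?case using closed[OF that(2)] by simp
  next
    case (Cons x xs)
    have "x \<in> carrier G" "xs \<in> lists ?T" using Cons assms(2) by auto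
    then show ?case using Cons closed[OF \<open>xs \<in> lists ?T\<close>] closed[OF that(2)] by (simp add: m_assoc)
  qed
  have "x \<in> ?p ` lists ?T" if "x \<in> generate G S" for x
    using that
  proof (induction rule: generate.induct)
    case one
    then show ?case by (intro image_eqI[of _ _ "[]"]) auto
  next
    case (incl h)
    then show ?case using assms(2) by (intro image_eqI[of _ _ "[h]"]) auto
  next
    case (inv h)
    then show ?case using assms(2) by (intro image_eqI[of _ _ "[inv h]"]) auto
  next
    case (eng h1 h2)
    then obtain xs ys where "xs \<in> lists ?T" "ys \<in> lists ?T" "h1 = ?p xs" "h2 = ?p ys" by blast
    then show ?case using append by (intro image_eqI[of _ _ "xs @ ys"]) auto
  qed
  then have "generate G S \<subseteq> ?p ` lists ?T" by blast
  moreover have "countable (?p ` lists ?T)" using assms(1) by (intro countable_image countable_lists) auto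
  ultimately show ?thesis by (rule countable_subset)
qed

lemma measurable_funpow_Homeo: "(\<lambda>f. f ^^ Suc k) \<in> Homeo_borel \<rightarrow>\<^sub>M Homeo_borel"
proof (induction k)
  case (Suc k)
  have "(\<lambda>f. f \<circ> f ^^ Suc k) \<in> Homeo_borel \<rightarrow>\<^sub>M Homeo_borel"
    by (rule measurable_comp_Homeo[OF _ Suc]) simp
  then show ?case by (simp only: funpow.simps)
qed simp

text \<open>Along the powers of \<open>f\<close>, the coboundary of \<beta> telescopes up to one
  copy of \<open>\<beta> f\<close> per term. After division by the number of terms, boundedness
  kills the telescoped part, so \<beta> is a pointwise limit of Borel averages.\<close>

lemma measurable_bounded_primitive:
  fixes \<beta> :: "(circle \<Rightarrow> circle) \<Rightarrow> real"
  assumes bound: "\<And>f. f \<in> carrier Homeo_circle \<Longrightarrow> \<bar>\<beta> f\<bar> \<le> C"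
    and meas: "(\<lambda>(f, g). \<beta> g - \<beta> (f \<circ> g) + \<beta> f) \<in> borel_measurable (Homeo_borel \<Otimes>\<^sub>M Homeo_borel)"
  shows "\<beta> \<in> borel_measurable Homeo_borel"
proof -
  define d where "d f g = \<beta> g - \<beta> (f \<circ> g) + \<beta> f" for f g
  have meas_d: "(\<lambda>f. d f (f ^^ Suc k)) \<in> borel_measurable Homeo_borel" for k
    using measurable_compose[OF measurable_Pair[OF measurable_ident measurable_funpow_Homeo] meas]
    by (simp add: d_def id_def)
  \<comment> \<open>The powers run from 1 to \<open>n\<close>, which leaves \<open>f\<close> and its
    power \<open>n + 1\<close> as the two boundary terms.\<close>
  have tele: "(\<Sum>k<n. d f (f ^^ Suc k)) = \<beta> f - \<beta> (f ^^ Suc n) + real n * \<beta> f" for f n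
  proof (induction n)
    case (Suc n)
    have "d f (f ^^ Suc n) = \<beta> (f ^^ Suc n) - \<beta> (f ^^ Suc (Suc n)) + \<beta> f"
      by (simp only: d_def funpow.simps(2))
    then show ?case using Suc by (simp add: algebra_simps del: funpow.simps)
  qed simp
  have "(\<lambda>n. (\<Sum>k<n. d f (f ^^ Suc k)) / real n) \<longlonglongrightarrow> \<beta> f"
    if f: "f \<in> space Homeo_borel" for f
  proof -
    have fn: "f ^^ Suc n \<in> carrier Homeo_circle" for n
      using measurable_space[OF measurable_funpow_Homeo f] by (simp only: space_Homeo_borel)
    have "(\<lambda>n. (\<beta> f - \<beta> (f ^^ Suc n)) / real n) \<longlonglongrightarrow> 0"
    proof (rule Lim_null_comparison)
      show "(\<lambda>n. 2 * C * inverse (real n)) \<longlonglongrightarrow> 0"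
        by (rule tendsto_mult_right_zero[OF lim_inverse_n])
      have "\<bar>\<beta> f - \<beta> (f ^^ Suc n)\<bar> \<le> 2 * C" for n
        using bound[OF fn[of n]] bound[OF f[unfolded space_Homeo_borel]] by linarith
      then show "\<forall>\<^sub>F n in sequentially. norm ((\<beta> f - \<beta> (f ^^ Suc n)) / real n) \<le> 2 * C * inverse (real n)"
        by (auto simp: divide_inverse abs_mult intro!: always_eventually mult_right_mono simp del: funpow.simps)
    qed
    then have "(\<lambda>n. (\<beta> f - \<beta> (f ^^ Suc n)) / real n + \<beta> f) \<longlonglongrightarrow> 0 + \<beta> f"
      by (intro tendsto_add tendsto_const)
    moreover have "\<forall>\<^sub>F n in sequentially. (\<beta> f - \<beta> (f ^^ Suc n)) / real n + \<beta> f
        = (\<Sum>k<n. d f (f ^^ Suc k)) / real n"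
      using eventually_gt_at_top[of 0] by eventually_elim (simp add: tele add_divide_distrib del: funpow.simps)
    ultimately show ?thesis by (simp add: tendsto_cong del: funpow.simps)
  qed
  moreover have "(\<lambda>f. (\<Sum>k<n. d f (f ^^ Suc k)) / real n) \<in> borel_measurable Homeo_borel" for n
    by (intro borel_measurable_divide borel_measurable_sum meas_d borel_measurable_const)
  ultimately show ?thesis by (rule borel_measurable_LIMSEQ_real)
qed

lemma real_euler_class_eq:
  "real_euler_class = (\<lambda>F. \<lambda>gs\<in>tuples Homeo_circle 2.
      coboundary Homeo_circle trivial_real (Suc 0) F gs \<oplus>\<^bsub>(trivial_real :: (circle \<Rightarrow> circle, real) normed_module)\<^esub>
      (\<lambda>fs\<in>tuples Homeo_circle 2. real_of_int (euler_cocycle (fs ! 0) (fs ! 1))) gs)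
    ` carrier (bounded_cochains Homeo_circle trivial_real (Suc 0))"
  unfolding real_euler_class_def bounded_class_def r_coset_def bounded_coboundaries_def
    bounded_cocycles_def bounded_cochains_def[of _ _ 2]
  by (simp add: numeral_2_eq_2 image_image UNION_singleton_eq_range)

lemma real_euler_class_memD:
  assumes "\<psi> \<in> real_euler_class"
  obtains \<beta> C where "\<And>f. f \<in> carrier Homeo_circle \<Longrightarrow> \<bar>\<beta> f\<bar> \<le> C"
    "\<And>f g. f \<in> carrier Homeo_circle \<Longrightarrow> g \<in> carrier Homeo_circle
      \<Longrightarrow> \<psi> [f, g] = \<beta> g - \<beta> (f \<circ> g) + \<beta> f + of_int (euler_cocycle f g)"
proof -
  let ?A = "trivial_real :: (circle \<Rightarrow> circle, real) normed_module"
  obtain F where F: "F \<in> carrier (bounded_cochains Homeo_circle ?A (Suc 0))"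
    and \<psi>: "\<psi> = (\<lambda>gs\<in>tuples Homeo_circle 2. coboundary Homeo_circle ?A (Suc 0) F gs \<oplus>\<^bsub>?A\<^esub>
      (\<lambda>fs\<in>tuples Homeo_circle 2. of_int (euler_cocycle (fs ! 0) (fs ! 1))) gs)"
    using assms unfolding real_euler_class_eq by blast
  obtain C where C: "\<And>gs. gs \<in> tuples Homeo_circle (Suc 0) \<Longrightarrow> \<bar>F gs\<bar> \<le> C"
    using F unfolding bounded_cochains_def by (auto simp: trivial_real_def)
  have mult: "f \<otimes>\<^bsub>Homeo_circle\<^esub> g = f \<circ> g" for f g by (simp add: Homeo_circle_def)
  have add: "a \<oplus>\<^bsub>?A\<^esub> b = a + b" "gact ?A f a = a" for a b f by (simp_all add: trivial_real_def)
  show ?thesis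
  proof
    show "\<bar>F [f]\<bar> \<le> C" if "f \<in> carrier Homeo_circle" for f
      using that by (intro C) (simp add: tuples_1)
    fix f g assume fg: "f \<in> carrier Homeo_circle" "g \<in> carrier Homeo_circle"
    have "coboundary Homeo_circle ?A (Suc 0) F [f, g] = F [g] + - F [f \<circ> g] + F [f]"
      using coboundary_1[OF abelian_group_trivial_real _ fg, of F] comp_Homeo[OF fg]
      by (simp add: mult add a_inv_trivial_real) (simp add: trivial_real_def)
    then show "\<psi> [f, g] = F [g] - F [f \<circ> g] + F [f] + of_int (euler_cocycle f g)"
      unfolding \<psi> using fg by (simp add: tuples_2 add)
  qed
qed

lemma euler_cochain_mem:
  "(\<lambda>fs\<in>tuples Homeo_circle 2. real_of_int (euler_cocycle (fs ! 0) (fs ! 1))) \<in> real_euler_class"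
proof -
  let ?A = "trivial_real :: (circle \<Rightarrow> circle, real) normed_module"
  let ?e = "\<lambda>fs\<in>tuples Homeo_circle 2. real_of_int (euler_cocycle (fs ! 0) (fs ! 1))"
  define F :: "(circle \<Rightarrow> circle) list \<Rightarrow> real" where "F = (\<lambda>gs\<in>tuples Homeo_circle (Suc 0). 0)"
  have F: "F \<in> carrier (bounded_cochains Homeo_circle ?A (Suc 0))"
    unfolding bounded_cochains_def F_def by (auto simp: trivial_real_def intro!: exI[of _ 0])
  have mult: "f \<otimes>\<^bsub>Homeo_circle\<^esub> g = f \<circ> g" for f g by (simp add: Homeo_circle_def)
  have add: "a \<oplus>\<^bsub>?A\<^esub> b = a + b" "gact ?A f a = a" for a b f by (simp_all add: trivial_real_def)
  have "coboundary Homeo_circle ?A (Suc 0) F [f, g] = 0"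
    if fg: "f \<in> carrier Homeo_circle" "g \<in> carrier Homeo_circle" for f g
    using coboundary_1[OF abelian_group_trivial_real _ fg, of F] comp_Homeo[OF fg] fg
    by (simp add: mult add a_inv_trivial_real F_def tuples_1) (simp add: trivial_real_def)
  then have "?e = (\<lambda>gs\<in>tuples Homeo_circle 2. coboundary Homeo_circle ?A (Suc 0) F gs \<oplus>\<^bsub>?A\<^esub> ?e gs)"
    by (intro ext) (auto simp: tuples_2 add)
  then show ?thesis unfolding real_euler_class_eq using F by (intro image_eqI[of _ _ F])
qed

section \<open>Circle cocycles and the pullback of the Euler cocycle\<close>

locale circle_cocycle = standard_borel_probability_space_action \<Gamma> M act
  for \<Gamma> :: "'g monoid" and M :: "'w measure" and act :: "'g \<Rightarrow> 'w \<Rightarrow> 'w" +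
  fixes \<sigma> :: "'g \<Rightarrow> 'w \<Rightarrow> circle \<Rightarrow> circle"
  assumes cocycle: "measurable_cocycle \<Gamma> M act \<sigma>"
begin

text \<open>These are the homeomorphisms entering the pullback; \<open>\<tau> \<gamma> \<omega>\<close> carries the fibre over \<open>\<gamma>\<^sup>-\<^sup>1\<omega>\<close> to the fibre over \<open>\<omega>\<close>.\<close>

definition \<tau> :: "'g \<Rightarrow> 'w \<Rightarrow> circle \<Rightarrow> circle"
  where "\<tau> \<gamma> \<omega> = inv\<^bsub>Homeo_circle\<^esub> (\<sigma> (inv\<^bsub>\<Gamma>\<^esub> \<gamma>) \<omega>)"

lemma measurable_\<sigma>: "\<gamma> \<in> carrier \<Gamma> \<Longrightarrow> \<sigma> \<gamma> \<in> M \<rightarrow>\<^sub>M Homeo_borel"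
  using cocycle measurable_compose[OF measurable_Pair1', of \<gamma> "count_space (carrier \<Gamma>)" "\<lambda>(\<gamma>, \<omega>). \<sigma> \<gamma> \<omega>" M Homeo_borel]
  unfolding measurable_cocycle_def by simp

lemma \<sigma>_carrier: "\<gamma> \<in> carrier \<Gamma> \<Longrightarrow> \<omega> \<in> space M \<Longrightarrow> \<sigma> \<gamma> \<omega> \<in> carrier Homeo_circle"
  by (rule measurable_Homeo_carrier[OF measurable_\<sigma>])

lemma \<tau>_eq: "\<gamma> \<in> carrier \<Gamma> \<Longrightarrow> \<omega> \<in> space M \<Longrightarrow> \<tau> \<gamma> \<omega> = finv (\<sigma> (inv\<^bsub>\<Gamma>\<^esub> \<gamma>) \<omega>)"
  unfolding \<tau>_def by (rule m_inv_Homeo[OF \<sigma>_carrier[OF inv_closed]])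

lemma measurable_\<tau>:
  assumes "\<gamma> \<in> carrier \<Gamma>"
  shows "\<tau> \<gamma> \<in> M \<rightarrow>\<^sub>M Homeo_borel"
  using measurable_inv_Homeo[OF measurable_\<sigma>[OF inv_closed[OF assms]]]
  by (rule measurable_cong[THEN iffD1, rotated]) (simp add: \<tau>_eq[OF assms])

lemma \<tau>_carrier: "\<gamma> \<in> carrier \<Gamma> \<Longrightarrow> \<omega> \<in> space M \<Longrightarrow> \<tau> \<gamma> \<omega> \<in> carrier Homeo_circle"
  by (rule measurable_Homeo_carrier[OF measurable_\<tau>])

lemma measurable_\<tau>_act:
  assumes "\<gamma> \<in> carrier \<Gamma>" "\<eta> \<in> carrier \<Gamma>"
  shows "(\<lambda>\<omega>. \<tau> \<eta> (act \<gamma> \<omega>)) \<in> M \<rightarrow>\<^sub>M Homeo_borel"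
  by (rule measurable_compose[OF measurable_act measurable_\<tau>]) (use assms in auto)

text \<open>The cocycle identity of \<sigma> at the inverses of \<eta> and \<gamma>, inverted: the
  order is reversed once in the group and once among the homeomorphisms.\<close>

lemma AE_\<tau>_mult:
  assumes "\<gamma> \<in> carrier \<Gamma>" "\<eta> \<in> carrier \<Gamma>"
  shows "AE \<omega> in M. \<tau> (\<gamma> \<otimes>\<^bsub>\<Gamma>\<^esub> \<eta>) \<omega> = \<tau> \<gamma> \<omega> \<circ> \<tau> \<eta> (act (inv\<^bsub>\<Gamma>\<^esub> \<gamma>) \<omega>)"
proof -
  have "AE \<omega> in M. \<sigma> (inv\<^bsub>\<Gamma>\<^esub> \<eta> \<otimes>\<^bsub>\<Gamma>\<^esub> inv\<^bsub>\<Gamma>\<^esub> \<gamma>) \<omega> = \<sigma> (inv\<^bsub>\<Gamma>\<^esub> \<eta>) (act (inv\<^bsub>\<Gamma>\<^esub> \<gamma>) \<omega>) \<circ> \<sigma> (inv\<^bsub>\<Gamma>\<^esub> \<gamma>) \<omega>"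
    using cocycle assms inv_closed unfolding measurable_cocycle_def by blast
  then show ?thesis using AE_space
  proof eventually_elim
    case (elim \<omega>)
    have act: "act (inv\<^bsub>\<Gamma>\<^esub> \<gamma>) \<omega> \<in> space M" using elim assms act_space inv_closed by simp
    have "\<tau> (\<gamma> \<otimes>\<^bsub>\<Gamma>\<^esub> \<eta>) \<omega> = finv (\<sigma> (inv\<^bsub>\<Gamma>\<^esub> \<eta>) (act (inv\<^bsub>\<Gamma>\<^esub> \<gamma>) \<omega>) \<circ> \<sigma> (inv\<^bsub>\<Gamma>\<^esub> \<gamma>) \<omega>)"
      using assms elim by (simp add: \<tau>_eq mult_closed group.inv_mult_group[OF group_Gamma])
    also have "\<dots> = finv (\<sigma> (inv\<^bsub>\<Gamma>\<^esub> \<gamma>) \<omega>) \<circ> finv (\<sigma> (inv\<^bsub>\<Gamma>\<^esub> \<eta>) (act (inv\<^bsub>\<Gamma>\<^esub> \<gamma>) \<omega>))"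
      using assms elim act by (intro o_inv_distrib bij_Homeo \<sigma>_carrier inv_closed)
    finally show ?case using assms elim act by (simp add: \<tau>_eq)
  qed
qed

definition pulled_euler :: "'g \<Rightarrow> 'g \<Rightarrow> 'w \<Rightarrow> real"
  where "pulled_euler \<gamma> \<eta> \<omega> = of_int (euler_cocycle (\<tau> \<gamma> \<omega>) (\<tau> \<eta> (act (inv\<^bsub>\<Gamma>\<^esub> \<gamma>) \<omega>)))"

lemma pulled_euler_Linf:
  assumes "\<gamma> \<in> carrier \<Gamma>" "\<eta> \<in> carrier \<Gamma>"
  shows "pulled_euler \<gamma> \<eta> \<in> Linf_fun M"
proof (rule Linf_funI)
  show "pulled_euler \<gamma> \<eta> \<in> borel_measurable M"
    unfolding pulled_euler_def[abs_def]
    using assms by (intro measurable_euler_cocycle measurable_\<tau> measurable_\<tau>_act inv_closed)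
  show "\<bar>pulled_euler \<gamma> \<eta> \<omega>\<bar> \<le> 2" if "\<omega> \<in> space M" for \<omega>
    unfolding pulled_euler_def using assms that
    by (intro euler_cocycle_bound \<tau>_carrier act_space inv_closed)
qed

text \<open>\<open>the_elem\<close> is meaningful because the set of pulled back classes is a
  singleton. It is nonempty since the Euler cocycle is Borel. Another Borel representative differs
  from it by the coboundary of a bounded \<beta>, which is then Borel, so that composing \<beta>
  with \<tau> gives a bounded measurable primitive of the difference of pullbacks.\<close>

lemma induced_map2_euler:
  "induced_map2 \<Gamma> M act \<sigma> real_euler_class
    = bounded_class \<Gamma> (Linf \<Gamma> M act) 2 (cochain2 \<Gamma> M pulled_euler)"
proof -
  let ?class = "\<lambda>\<psi>. bounded_class \<Gamma> (Linf \<Gamma> M act) 2 (pullback_cochain \<Gamma> M act \<sigma> \<psi>)"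
  let ?e = "\<lambda>fs\<in>tuples Homeo_circle 2. real_of_int (euler_cocycle (fs ! 0) (fs ! 1))"
  have pull: "pullback_cochain \<Gamma> M act \<sigma> \<psi>
      = cochain2 \<Gamma> M (\<lambda>\<gamma> \<eta> \<omega>. \<psi> [\<tau> \<gamma> \<omega>, \<tau> \<eta> (act (inv\<^bsub>\<Gamma>\<^esub> \<gamma>) \<omega>)])" for \<psi>
    unfolding pullback_cochain_def cochain2_def \<tau>_def ..
  have class_eq: "?class \<psi> = bounded_class \<Gamma> (Linf \<Gamma> M act) 2 (cochain2 \<Gamma> M pulled_euler)"
    if \<psi>: "\<psi> \<in> real_euler_class" and borel: "borel_cochain2 \<psi>" for \<psi>
  proof -
    obtain \<beta> C where bound: "\<And>f. f \<in> carrier Homeo_circle \<Longrightarrow> \<bar>\<beta> f\<bar> \<le> C"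
      and \<beta>: "\<And>f g. f \<in> carrier Homeo_circle \<Longrightarrow> g \<in> carrier Homeo_circle
        \<Longrightarrow> \<psi> [f, g] = \<beta> g - \<beta> (f \<circ> g) + \<beta> f + of_int (euler_cocycle f g)"
      using real_euler_class_memD[OF \<psi>] by blast
    have "(\<lambda>z. (\<lambda>(f, g). \<psi> [f, g]) z - of_int (euler_cocycle (fst z) (snd z)))
        \<in> borel_measurable (Homeo_borel \<Otimes>\<^sub>M Homeo_borel)"
      using borel unfolding borel_cochain2_def
      by (intro borel_measurable_diff measurable_euler_cocycle measurable_fst measurable_snd)
    then have "(\<lambda>(f, g). \<beta> g - \<beta> (f \<circ> g) + \<beta> f) \<in> borel_measurable (Homeo_borel \<Otimes>\<^sub>M Homeo_borel)"
      by (rule measurable_cong[THEN iffD1, rotated]) (auto simp: space_pair_measure space_Homeo_borel \<beta>)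
    from measurable_bounded_primitive[OF bound this]
    have meas_\<beta>: "\<beta> \<in> borel_measurable Homeo_borel" .
    define b where "b \<gamma> \<omega> = \<beta> (\<tau> \<gamma> \<omega>)" for \<gamma> \<omega>
    have b: "b \<in> bounded_functions \<Gamma> M"
      unfolding bounded_functions_def b_def[abs_def]
      using measurable_compose[OF measurable_\<tau> meas_\<beta>] bound \<tau>_carrier by blast
    have AE: "AE \<omega> in M. \<psi> [\<tau> \<gamma> \<omega>, \<tau> \<eta> (act (inv\<^bsub>\<Gamma>\<^esub> \<gamma>) \<omega>)] = delta b \<gamma> \<eta> \<omega> + pulled_euler \<gamma> \<eta> \<omega>"
      if g: "\<gamma> \<in> carrier \<Gamma>" "\<eta> \<in> carrier \<Gamma>" for \<gamma> \<eta>
      using AE_\<tau>_mult[OF g] AE_space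
    proof eventually_elim
      case (elim \<omega>)
      have "\<tau> \<gamma> \<omega> \<in> carrier Homeo_circle" "\<tau> \<eta> (act (inv\<^bsub>\<Gamma>\<^esub> \<gamma>) \<omega>) \<in> carrier Homeo_circle"
        using g elim by (auto intro: \<tau>_carrier act_space inv_closed)
      then show ?case by (simp add: \<beta> delta_def b_def elim pulled_euler_def)
    qed
    have L: "(\<lambda>\<omega>. \<psi> [\<tau> \<gamma> \<omega>, \<tau> \<eta> (act (inv\<^bsub>\<Gamma>\<^esub> \<gamma>) \<omega>)]) \<in> Linf_fun M"
      if g: "\<gamma> \<in> carrier \<Gamma>" "\<eta> \<in> carrier \<Gamma>" for \<gamma> \<eta>
    proof (rule Linf_funI)
      have "(\<lambda>\<omega>. (\<tau> \<gamma> \<omega>, \<tau> \<eta> (act (inv\<^bsub>\<Gamma>\<^esub> \<gamma>) \<omega>))) \<in> M \<rightarrow>\<^sub>M Homeo_borel \<Otimes>\<^sub>M Homeo_borel"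
        using g by (intro measurable_Pair measurable_\<tau> measurable_\<tau>_act inv_closed)
      from measurable_compose[OF this borel[unfolded borel_cochain2_def]]
      show "(\<lambda>\<omega>. \<psi> [\<tau> \<gamma> \<omega>, \<tau> \<eta> (act (inv\<^bsub>\<Gamma>\<^esub> \<gamma>) \<omega>)]) \<in> borel_measurable M" by simp
      \<comment> \<open>Three values of \<beta>, each at most \<open>C\<close>, and the bound 2 for
        the Euler cocycle.\<close>
      show "\<bar>\<psi> [\<tau> \<gamma> \<omega>, \<tau> \<eta> (act (inv\<^bsub>\<Gamma>\<^esub> \<gamma>) \<omega>)]\<bar> \<le> 3 * C + 2" if "\<omega> \<in> space M" for \<omega>
      proof -
        have c: "\<tau> \<gamma> \<omega> \<in> carrier Homeo_circle" "\<tau> \<eta> (act (inv\<^bsub>\<Gamma>\<^esub> \<gamma>) \<omega>) \<in> carrier Homeo_circle"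
          using g that by (auto intro: \<tau>_carrier act_space inv_closed)
        show ?thesis
          unfolding \<beta>[OF c] using euler_cocycle_bound[OF c] bound[OF c(1)] bound[OF c(2)] bound[OF comp_Homeo[OF c]]
          by linarith
      qed
    qed
    show ?thesis
      unfolding pull by (rule bounded_class_cochain2_eqI[OF _ _ b]) (fact pulled_euler_Linf L AE)+
  qed
  have "borel_cochain2 ?e"
  proof -
    have "(\<lambda>z. real_of_int (euler_cocycle (fst z) (snd z))) \<in> borel_measurable (Homeo_borel \<Otimes>\<^sub>M Homeo_borel)"
      by (intro measurable_euler_cocycle measurable_fst measurable_snd)
    then show ?thesis unfolding borel_cochain2_def
      by (rule measurable_cong[THEN iffD1, rotated]) (auto simp: space_pair_measure space_Homeo_borel tuples_2)
  qed
  then have "?class ` {\<psi> \<in> real_euler_class. borel_cochain2 \<psi>}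
      = {bounded_class \<Gamma> (Linf \<Gamma> M act) 2 (cochain2 \<Gamma> M pulled_euler)}"
    using class_eq euler_cochain_mem by blast
  then show ?thesis unfolding induced_map2_def by simp
qed

lemma euler_class_trivial_iff:
  "induced_map2 \<Gamma> M act \<sigma> real_euler_class = \<one>\<^bsub>bounded_cohomology \<Gamma> (Linf \<Gamma> M act) 2\<^esub>
    \<longleftrightarrow> (\<exists>b\<in>bounded_functions \<Gamma> M. \<forall>\<gamma>\<in>carrier \<Gamma>. \<forall>\<eta>\<in>carrier \<Gamma>.
          AE \<omega> in M. pulled_euler \<gamma> \<eta> \<omega> = delta b \<gamma> \<eta> \<omega>)"
  unfolding induced_map2_euler by (rule bounded_class_cochain2_trivial_iff) (rule pulled_euler_Linf)

definition T :: "'g \<Rightarrow> 'w \<Rightarrow> real \<Rightarrow> real"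
  where "T \<gamma> \<omega> = euler_section (\<tau> \<gamma> \<omega>)"

lemma T_lift:
  assumes "\<gamma> \<in> carrier \<Gamma>" "\<omega> \<in> space M"
  shows "T \<gamma> \<omega> \<in> Homeo_real" "is_lift (T \<gamma> \<omega>) (\<tau> \<gamma> \<omega>)" "0 \<le> T \<gamma> \<omega> 0" "T \<gamma> \<omega> 0 < 1"
  unfolding T_def using euler_section_lift \<tau>_carrier[OF assms] by auto

text \<open>Normalisation at 0 bounds the displacement there, and comparison with the neighbouring
  integers spreads the bound to the line. Its independence of \<gamma> and \<omega> is what makes
  both directions of the theorem produce uniformly bounded data.\<close>

lemma T_displacement:
  assumes "\<gamma> \<in> carrier \<Gamma>" "\<omega> \<in> space M"
  shows "\<bar>T \<gamma> \<omega> x - x\<bar> \<le> 2"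
proof -
  note lift_T = T_lift[OF assms]
  have "T \<gamma> \<omega> (0 + of_int \<lfloor>x\<rfloor>) \<le> T \<gamma> \<omega> x" "T \<gamma> \<omega> x \<le> T \<gamma> \<omega> (0 + of_int (\<lfloor>x\<rfloor> + 1))"
    unfolding Homeo_real_le[OF lift_T(1)] by linarith+
  then show ?thesis
    unfolding Homeo_real_int[OF lift_T(1), of 0] using lift_T(3,4) by linarith
qed

lemma AE_T_mult:
  assumes "\<gamma> \<in> carrier \<Gamma>" "\<eta> \<in> carrier \<Gamma>"
  shows "AE \<omega> in M. \<forall>x. T \<gamma> \<omega> (T \<eta> (act (inv\<^bsub>\<Gamma>\<^esub> \<gamma>) \<omega>) x) = T (\<gamma> \<otimes>\<^bsub>\<Gamma>\<^esub> \<eta>) \<omega> x + pulled_euler \<gamma> \<eta> \<omega>"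
  using AE_\<tau>_mult[OF assms] AE_space
proof eventually_elim
  case (elim \<omega>)
  have "\<tau> \<gamma> \<omega> \<in> carrier Homeo_circle" "\<tau> \<eta> (act (inv\<^bsub>\<Gamma>\<^esub> \<gamma>) \<omega>) \<in> carrier Homeo_circle"
    using assms elim by (auto intro: \<tau>_carrier act_space inv_closed)
  then show ?case by (simp add: T_def elim pulled_euler_def euler_section_comp)
qed

end

section \<open>The invariant measure on the circle\<close>

text \<open>Normalised Haar measure of the circle, as the image of Lebesgue measure on a fundamental
  domain.\<close>

definition circle_measure :: "circle measure"
  where "circle_measure = distr (restrict_space lborel {0..<1}) borel circle_of"

lemma measurable_circle_of_restrict:
  "circle_of \<in> restrict_space lborel {0..<1} \<rightarrow>\<^sub>M borel"
  by (rule measurable_restrict_space1) simp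

lemma sets_circle_measure [measurable_cong]: "sets circle_measure = sets borel"
  by (simp add: circle_measure_def)

lemma space_circle_measure: "space circle_measure = UNIV"
  by (simp add: circle_measure_def)

lemma emeasure_circle_measure:
  assumes "A \<in> sets borel"
  shows "emeasure circle_measure A = emeasure lborel (circle_of -` A \<inter> {0..<1})"
proof -
  have "circle_of -` A \<in> sets borel" using measurable_sets[OF measurable_circle_of assms] by simp
  then show ?thesis
    unfolding circle_measure_def using assms
    by (simp add: emeasure_distr[OF measurable_circle_of_restrict] space_restrict_space emeasure_restrict_space)
qed

lemma prob_space_circle_measure: "prob_space circle_measure"
  by (rule prob_spaceI) (simp add: space_circle_measure emeasure_circle_measure)

lemma measurable_circle_add [measurable]: "(\<lambda>z. z + \<theta>) \<in> borel_measurable (borel :: circle measure)"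
proof -
  have "z + \<theta> = circle_of (rep z + rep \<theta>)" for z by (simp add: circle_of_add)
  moreover have "(\<lambda>z. circle_of (rep z + rep \<theta>)) \<in> borel_measurable borel" by measurable
  ultimately show ?thesis by simp
qed

lemma emeasure_lborel_shift:
  fixes S :: "real set"
  assumes "S \<in> sets borel"
  shows "emeasure lborel {x. x + c \<in> S} = emeasure lborel S"
proof -
  have "emeasure lborel S = emeasure (distr lborel borel ((+) c)) S" by (simp add: lborel_distr_plus)
  also have "\<dots> = emeasure lborel ((+) c -` S)" using assms by (simp add: emeasure_distr)
  finally show ?thesis by (simp add: vimage_def add.commute)
qed

text \<open>A rotation by \<open>a\<close> moves the fundamental domain to [a, 1 + a). The part
  beyond 1 is moved back by 1, which leaves the periodic set \<open>B\<close> unchanged and fills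
  the gap [0, a).\<close>

lemma circle_measure_rotation: "distr circle_measure borel (\<lambda>z. z + \<theta>) = circle_measure"
proof (rule measure_eqI)
  fix A assume "A \<in> sets (distr circle_measure borel (\<lambda>z. z + \<theta>))"
  then have A: "A \<in> sets borel" by simp
  define B where "B = circle_of -` A"
  define a where "a = rep \<theta>"
  have a: "0 \<le> a" "a < 1" unfolding a_def using rep_range by auto
  have B: "B \<in> sets borel" using measurable_sets[OF measurable_circle_of A] by (simp add: B_def)
  have per: "x - 1 \<in> B \<longleftrightarrow> x \<in> B" for x
    using circle_of_add_int[of x "- 1"] by (simp add: B_def)
  have A': "(\<lambda>z. z + \<theta>) -` A \<in> sets borel" using measurable_sets[OF measurable_circle_add A] by simp
  have "emeasure (distr circle_measure borel (\<lambda>z. z + \<theta>)) A = emeasure circle_measure ((\<lambda>z. z + \<theta>) -` A)"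
    using A by (subst emeasure_distr) (simp_all add: space_circle_measure measurable_cong_sets[OF sets_circle_measure refl])
  also have "\<dots> = emeasure lborel (circle_of -` ((\<lambda>z. z + \<theta>) -` A) \<inter> {0..<1})"
    by (rule emeasure_circle_measure[OF A'])
  also have "circle_of -` ((\<lambda>z. z + \<theta>) -` A) \<inter> {0..<1} = {x. x + a \<in> B \<inter> {a..<1 + a}}"
    by (auto simp: B_def a_def circle_of_add)
  also have "emeasure lborel \<dots> = emeasure lborel (B \<inter> {a..<1 + a})"
    by (rule emeasure_lborel_shift) (use B in auto)
  also have "B \<inter> {a..<1 + a} = (B \<inter> {a..<1}) \<union> (B \<inter> {1..<1 + a})" using a by auto
  also have "emeasure lborel \<dots> = emeasure lborel (B \<inter> {a..<1}) + emeasure lborel (B \<inter> {1..<1 + a})"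
    using B by (intro plus_emeasure[symmetric]) auto
  also have "B \<inter> {1..<1 + a} = {x. x + - 1 \<in> B \<inter> {0..<a}}" using per by auto
  also have "emeasure lborel \<dots> = emeasure lborel (B \<inter> {0..<a})"
    by (rule emeasure_lborel_shift) (use B in auto)
  also have "emeasure lborel (B \<inter> {a..<1}) + emeasure lborel (B \<inter> {0..<a})
      = emeasure lborel ((B \<inter> {a..<1}) \<union> (B \<inter> {0..<a}))"
    using B by (intro plus_emeasure) auto
  also have "(B \<inter> {a..<1}) \<union> (B \<inter> {0..<a}) = B \<inter> {0..<1}" using a by auto
  also have "emeasure lborel \<dots> = emeasure circle_measure A"
    unfolding B_def by (rule emeasure_circle_measure[OF A, symmetric])
  finally show "emeasure (distr circle_measure borel (\<lambda>z. z + \<theta>)) A = emeasure circle_measure A" .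
qed (simp add: sets_circle_measure)

lemma integral_circle_rotation:
  fixes h :: "circle \<Rightarrow> real"
  assumes "h \<in> borel_measurable borel"
  shows "(\<integral>z. h (z + \<theta>) \<partial>circle_measure) = (\<integral>z. h z \<partial>circle_measure)"
proof -
  have "(\<integral>z. h z \<partial>circle_measure) = (\<integral>z. h z \<partial>distr circle_measure borel (\<lambda>z. z + \<theta>))"
    by (simp add: circle_measure_rotation)
  also have "\<dots> = (\<integral>z. h (z + \<theta>) \<partial>circle_measure)"
    using assms by (intro integral_distr) (simp_all add: measurable_cong_sets[OF sets_circle_measure refl])
  finally show ?thesis by simp
qed

section \<open>Lifts and generalised inverses of degree one maps\<close>

text \<open>\<open>\<lceil>x - r\<rceil> \<le> m\<close> says that \<open>x\<close> does not exceed
  the translate \<open>r + m\<close>, a condition that a degree one homeomorphism preserves. Hence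
  counting translates of a point is invariant under lifts.\<close>

lemma ceiling_diff_Homeo_real:
  assumes "S \<in> Homeo_real"
  shows "\<lceil>S x - S r\<rceil> = \<lceil>x - r\<rceil>"
proof -
  have "\<lceil>S x - S r\<rceil> \<le> m \<longleftrightarrow> \<lceil>x - r\<rceil> \<le> m" for m
    using Homeo_real_le[OF assms, of x "r + of_int m"] Homeo_real_int[OF assms, of r m]
    by (simp add: ceiling_le_iff algebra_simps)
  then show ?thesis by (metis order_antisym order_refl)
qed

lemma Homeo_real_cSUP:
  assumes "G \<in> Homeo_real" "I \<noteq> {}" "bdd_above (f ` I)"
  shows "G (SUP i\<in>I. f i) = (SUP i\<in>I. G (f i))"
proof -
  have "continuous (at_left (Sup (f ` I))) G"
    using Homeo_realD(1)[OF assms(1)]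
    by (simp add: continuous_on_eq_continuous_at continuous_at_imp_continuous_at_within)
  from continuous_at_Sup_mono[OF Homeo_real_mono[OF assms(1)] this] assms(2,3)
  show ?thesis by (simp add: image_image)
qed

definition descend :: "(real \<Rightarrow> real) \<Rightarrow> circle \<Rightarrow> circle"
  where "descend F z = circle_of (F (rep z))"

lemma is_lift_descend:
  assumes "\<And>x. F (x + 1) = F x + 1"
  shows "is_lift F (descend F)"
proof -
  have "F (frac x + of_int \<lfloor>x\<rfloor>) = F (frac x) + of_int \<lfloor>x\<rfloor>" for x
    by (rule degree_one_int) (rule assms)
  then show ?thesis unfolding is_lift_def descend_def
    by (metis circle_of_add_int diff_add_cancel frac_def rep_circle_of)
qed

lemma nondecreasing_degree_one_descend:
  assumes "mono F" "\<And>x. F (x + 1) = F x + 1"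
  shows "nondecreasing_degree_one (descend F)"
  unfolding nondecreasing_degree_one_def
  by (intro exI[of _ F] conjI allI assms is_lift_descend degree_one_int)

lemma measurable_descend:
  assumes "(\<lambda>(x, \<omega>). F \<omega> x) \<in> borel_measurable (borel \<Otimes>\<^sub>M M)"
  shows "(\<lambda>(z, \<omega>). descend (F \<omega>) z) \<in> borel \<Otimes>\<^sub>M M \<rightarrow>\<^sub>M borel"
proof -
  have "(\<lambda>p. (rep (fst p), snd p)) \<in> borel \<Otimes>\<^sub>M M \<rightarrow>\<^sub>M borel \<Otimes>\<^sub>M M" by measurable
  from measurable_compose[OF measurable_compose[OF this assms] measurable_circle_of]
  show ?thesis by (simp add: descend_def case_prod_beta')
qed

text \<open>Generalised inverse for monotone functions that may jump or be constant on intervals; a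
  uniform bound on \<open>F y - y\<close> guarantees that the supremum is taken over a nonempty
  bounded set.\<close>

definition upper_inverse :: "(real \<Rightarrow> real) \<Rightarrow> real \<Rightarrow> real"
  where "upper_inverse F x = Sup {y. F y \<le> x}"

lemma upper_inverse_set:
  assumes "\<And>y. \<bar>F y - y\<bar> \<le> K"
  shows "{y. F y \<le> x} \<noteq> {}" "bdd_above {y. F y \<le> (x::real)}"
proof -
  have "F (x - K) \<le> x" using assms[of "x - K"] by linarith
  then show "{y. F y \<le> x} \<noteq> {}" by blast
  have "y \<le> x + K" if "F y \<le> x" for y using assms[of y] that by linarith
  then show "bdd_above {y. F y \<le> x}" by (intro bdd_aboveI[of _ "x + K"]) simp
qed

lemma upper_inverse_mono:
  assumes "\<And>y. \<bar>F y - y\<bar> \<le> K"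
  shows "mono (upper_inverse F)"
  unfolding upper_inverse_def
  by (intro monoI cSup_subset_mono upper_inverse_set[OF assms]) auto

text \<open>The hypothesis makes the sublevel set of \<open>G\<close> the translate by
  \<open>c\<close> of that of \<open>F\<close>. With \<open>F = G\<close> and \<open>c = 1\<close>
  it gives degree one; with two fibres and \<open>c\<close> a value of \<open>b\<close> it gives the
  second semicohomology.\<close>

lemma upper_inverse_equivariant:
  assumes "\<And>y. \<bar>F y - y\<bar> \<le> K" "\<And>y. \<bar>G y - y\<bar> \<le> K"
    and "\<And>y. G (y + c) \<le> x' \<longleftrightarrow> F y \<le> x"
  shows "upper_inverse G x' = upper_inverse F x + c"
proof -
  have "{y. G y \<le> x'} = (\<lambda>y. y + c) ` {y. F y \<le> x}"
  proof (intro equalityI subsetI)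
    fix y assume "y \<in> {y. G y \<le> x'}"
    then have "F (y - c) \<le> x" using assms(3)[of "y - c"] by simp
    then show "y \<in> (\<lambda>y. y + c) ` {y. F y \<le> x}" by (intro image_eqI[of _ _ "y - c"]) auto
  qed (use assms(3) in auto)
  moreover have "(SUP y\<in>{y. F y \<le> x}. y + c) = (SUP y\<in>{y. F y \<le> x}. y) + c"
    using Homeo_real_cSUP[OF Homeo_real_translate[OF Homeo_real_id, of c], of "{y. F y \<le> x}" "\<lambda>y. y"]
      upper_inverse_set[OF assms(1), of x] by simp
  ultimately show ?thesis by (simp add: upper_inverse_def)
qed

lemma upper_inverse_degree_one:
  assumes "\<And>y. \<bar>F y - y\<bar> \<le> K" "\<And>x. F (x + 1) = F x + 1"
  shows "upper_inverse F (x + 1) = upper_inverse F x + 1"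
  by (rule upper_inverse_equivariant[OF assms(1) assms(1)]) (simp add: assms(2))

text \<open>Monotonicity allows a rational witness, which turns joint measurability into a countable
  union.\<close>

lemma less_upper_inverse_iff:
  assumes "\<And>y. \<bar>F y - y\<bar> \<le> K" "mono F"
  shows "a < upper_inverse F x \<longleftrightarrow> (\<exists>q\<in>\<rat>. a < q \<and> F q \<le> x)"
proof
  assume "a < upper_inverse F x"
  then obtain y where y: "F y \<le> x" "a < y"
    unfolding upper_inverse_def using less_cSup_iff[OF upper_inverse_set[OF assms(1)]] by auto
  obtain q where q: "q \<in> \<rat>" "a < q" "q < y" using Rats_dense_in_real[OF y(2)] by blast
  then have "F q \<le> x" using monoD[OF assms(2), of q y] y by simp
  then show "\<exists>q\<in>\<rat>. a < q \<and> F q \<le> x" using q by blast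
next
  assume "\<exists>q\<in>\<rat>. a < q \<and> F q \<le> x"
  then obtain q where q: "a < q" "F q \<le> x" by blast
  then have "q \<le> upper_inverse F x"
    unfolding upper_inverse_def by (intro cSup_upper upper_inverse_set[OF assms(1)]) simp
  then show "a < upper_inverse F x" using q by simp
qed

lemma measurable_upper_inverse:
  assumes F: "\<And>x. (\<lambda>\<omega>. F \<omega> x) \<in> borel_measurable M"
    and coarse: "\<And>\<omega> y. \<omega> \<in> space M \<Longrightarrow> \<bar>F \<omega> y - y\<bar> \<le> K" "\<And>\<omega>. \<omega> \<in> space M \<Longrightarrow> mono (F \<omega>)"
  shows "(\<lambda>(x, \<omega>). upper_inverse (F \<omega>) x) \<in> borel_measurable (borel \<Otimes>\<^sub>M M)"
proof (rule borel_measurableI_greater)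
  fix a
  have iff: "a < upper_inverse (F \<omega>) x \<longleftrightarrow> (\<exists>q\<in>\<rat>. a < q \<and> F \<omega> q \<le> x)" if "\<omega> \<in> space M" for \<omega> x
    by (rule less_upper_inverse_iff[OF coarse(1)[OF that] coarse(2)[OF that]])
  have "{p \<in> space (borel \<Otimes>\<^sub>M M). a < (case p of (x, \<omega>) \<Rightarrow> upper_inverse (F \<omega>) x)}
      = (\<Union>q\<in>{q \<in> \<rat>. a < q}. {p \<in> space (borel \<Otimes>\<^sub>M M). F (snd p) q \<le> fst p})"
    by (auto simp: space_pair_measure iff)
  also have "\<dots> \<in> sets (borel \<Otimes>\<^sub>M M)"
  proof (intro sets.countable_UN' image_subsetI)
    show "countable {q \<in> \<rat>. a < (q :: real)}" by (rule countable_subset[OF _ countable_rat]) blast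
    fix q
    have [measurable]: "(\<lambda>p. F (snd p) q) \<in> borel_measurable (borel \<Otimes>\<^sub>M M)"
      by (rule measurable_compose[OF measurable_snd F])
    show "{p \<in> space (borel \<Otimes>\<^sub>M M). F (snd p) q \<le> fst p} \<in> sets (borel \<Otimes>\<^sub>M M)" by measurable
  qed
  finally show "{p \<in> space (borel \<Otimes>\<^sub>M M). a < (case p of (x, \<omega>) \<Rightarrow> upper_inverse (F \<omega>) x)}
      \<in> sets (borel \<Otimes>\<^sub>M M)" .
qed

lemma is_lift_rotation: "is_lift (\<lambda>x. x + c) (\<lambda>z. z + circle_of c)"
  by (simp add: is_lift_def circle_of_add)

section \<open>Semicohomology with rotations\<close>

context circle_cocycle
begin

lemma \<sigma>_\<tau>:
  assumes "\<gamma> \<in> carrier \<Gamma>" "\<omega> \<in> space M"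
  shows "\<sigma> \<gamma> \<omega> (\<tau> (inv\<^bsub>\<Gamma>\<^esub> \<gamma>) \<omega> z) = z" "\<tau> (inv\<^bsub>\<Gamma>\<^esub> \<gamma>) \<omega> (\<sigma> \<gamma> \<omega> z) = z"
  using bij_Homeo[OF \<sigma>_carrier[OF assms]] assms
  by (simp_all add: \<tau>_eq inv_closed group.inv_inv[OF group_Gamma] bij_is_surj surj_f_inv_f bij_is_inj)

text \<open>
  Below \<open>n \<omega> x z\<close> counts, with sign, the lifts of \<open>\<phi> \<omega> z\<close> in the interval from 0 to \<open>x\<close>,
  so \<open>\<psi> \<omega>\<close> is the distribution function of the image of the rotation invariant measure under \<open>\<phi> \<omega>\<close>.
  Passing to real-valued distribution functions avoids choosing lifts of \<open>\<phi> \<omega>\<close>, which are neither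
  unique nor evidently measurable in \<open>\<omega>\<close> when \<open>\<phi> \<omega>\<close> is constant or nearly so.
\<close>

lemma semicohomologous_imp_trivial:
  assumes \<rho>: "\<And>\<gamma> \<omega>. \<gamma> \<in> carrier \<Gamma> \<Longrightarrow> \<omega> \<in> space M \<Longrightarrow> \<rho> \<gamma> \<omega> \<in> rotations"
    and semi: "left_semicohomologous \<Gamma> M act \<sigma> \<rho>"
  obtains b where "b \<in> bounded_functions \<Gamma> M"
    "\<And>\<gamma> \<eta>. \<gamma> \<in> carrier \<Gamma> \<Longrightarrow> \<eta> \<in> carrier \<Gamma> \<Longrightarrow> AE \<omega> in M. pulled_euler \<gamma> \<eta> \<omega> = delta b \<gamma> \<eta> \<omega>"
proof -
  interpret cm: prob_space circle_measure by (rule prob_space_circle_measure)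
  obtain \<phi> where \<phi>: "(\<lambda>(x, \<omega>). \<phi> \<omega> x) \<in> borel \<Otimes>\<^sub>M M \<rightarrow>\<^sub>M borel"
    and eq: "\<And>\<gamma>. \<gamma> \<in> carrier \<Gamma> \<Longrightarrow> AE \<omega> in M. \<sigma> \<gamma> \<omega> \<circ> \<phi> \<omega> = \<phi> (act \<gamma> \<omega>) \<circ> \<rho> \<gamma> \<omega>"
    using semi unfolding left_semicohomologous_def by blast
  \<comment> \<open>The integer part split off when the image under \<open>T\<close> of a
    representative in [0,1) is reduced to [0,1) again; its mean over the circle is the required
    \<open>b\<close>.\<close>
  define f where "f \<gamma> \<omega> z = real_of_int \<lfloor>T \<gamma> \<omega> (rep (\<phi> (act (inv\<^bsub>\<Gamma>\<^esub> \<gamma>) \<omega>) z))\<rfloor>" for \<gamma> \<omega> z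
  define b where "b \<gamma> \<omega> = (\<integral>z. f \<gamma> \<omega> z \<partial>circle_measure)" for \<gamma> \<omega>
  define n where "n \<omega> x z = real_of_int \<lceil>x - rep (\<phi> \<omega> z)\<rceil>" for \<omega> x z
  define \<psi> where "\<psi> \<omega> x = (\<integral>z. n \<omega> x z \<partial>circle_measure)" for \<omega> x
  have \<phi>_section: "\<phi> \<omega> \<in> borel_measurable borel" if "\<omega> \<in> space M" for \<omega>
    using measurable_compose[OF measurable_Pair2'[OF that] \<phi>] by simp
  have meas_n: "n \<omega> x \<in> borel_measurable borel" if "\<omega> \<in> space M" for \<omega> x
    unfolding n_def[abs_def] using \<phi>_section[OF that] by measurable
  have meas_f_joint: "(\<lambda>(\<omega>, z). f \<gamma> \<omega> z) \<in> borel_measurable (M \<Otimes>\<^sub>M circle_measure)"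
    if g: "\<gamma> \<in> carrier \<Gamma>" for \<gamma>
  proof -
    note [measurable] = measurable_act[OF inv_closed[OF g]]
    have "(\<lambda>p. (snd p, act (inv\<^bsub>\<Gamma>\<^esub> \<gamma>) (fst p))) \<in> M \<Otimes>\<^sub>M circle_measure \<rightarrow>\<^sub>M borel \<Otimes>\<^sub>M M"
      by measurable
    from measurable_compose[OF measurable_compose[OF this \<phi>] measurable_rep]
    have u: "(\<lambda>p. rep (\<phi> (act (inv\<^bsub>\<Gamma>\<^esub> \<gamma>) (fst p)) (snd p))) \<in> borel_measurable (M \<Otimes>\<^sub>M circle_measure)"
      by simp
    have [measurable]: "(\<lambda>p. T \<gamma> (fst p) (rep (\<phi> (act (inv\<^bsub>\<Gamma>\<^esub> \<gamma>) (fst p)) (snd p))))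
        \<in> borel_measurable (M \<Otimes>\<^sub>M circle_measure)"
      unfolding T_def
      by (rule measurable_euler_section_eval[OF measurable_compose[OF measurable_fst measurable_\<tau>[OF g]] u])
    show ?thesis unfolding f_def case_prod_beta' by measurable
  qed
  have meas_f: "f \<gamma> \<omega> \<in> borel_measurable borel" if "\<gamma> \<in> carrier \<Gamma>" "\<omega> \<in> space M" for \<gamma> \<omega>
    using measurable_compose[OF measurable_Pair1'[OF that(2)] meas_f_joint[OF that(1)]]
    by (simp add: measurable_cong_sets[OF sets_circle_measure refl])
  have f_bound: "\<bar>f \<gamma> \<omega> z\<bar> \<le> 3" if "\<gamma> \<in> carrier \<Gamma>" "\<omega> \<in> space M" for \<gamma> \<omega> z
    unfolding f_def using T_displacement[OF that, of "rep (\<phi> (act (inv\<^bsub>\<Gamma>\<^esub> \<gamma>) \<omega>) z)"]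
      rep_range[of "\<phi> (act (inv\<^bsub>\<Gamma>\<^esub> \<gamma>) \<omega>) z"] by linarith
  have n_bound: "\<bar>n \<omega> x z\<bar> \<le> \<bar>x\<bar> + 2" for \<omega> x z
    unfolding n_def using rep_range[of "\<phi> \<omega> z"] by linarith
  have int_f: "integrable circle_measure (f \<gamma> \<omega>)" if "\<gamma> \<in> carrier \<Gamma>" "\<omega> \<in> space M" for \<gamma> \<omega>
    using f_bound[OF that] meas_f[OF that]
    by (intro cm.integrable_const_bound[of _ 3]) (auto simp: measurable_cong_sets[OF sets_circle_measure refl])
  have int_n: "integrable circle_measure (n \<omega> x)" if "\<omega> \<in> space M" for \<omega> x
    using n_bound meas_n[OF that]
    by (intro cm.integrable_const_bound[of _ "\<bar>x\<bar> + 2"]) (auto simp: measurable_cong_sets[OF sets_circle_measure refl])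
  have "\<bar>b \<gamma> \<omega>\<bar> \<le> 3" if "\<gamma> \<in> carrier \<Gamma>" "\<omega> \<in> space M" for \<gamma> \<omega>
  proof -
    have "-3 \<le> f \<gamma> \<omega> z" "f \<gamma> \<omega> z \<le> 3" for z using f_bound[OF that, of z] by linarith+
    then have "-3 \<le> b \<gamma> \<omega>" "b \<gamma> \<omega> \<le> 3"
      unfolding b_def using int_f[OF that] by (auto intro: cm.integral_ge_const cm.integral_le_const)
    then show ?thesis by linarith
  qed
  moreover have "b \<gamma> \<in> borel_measurable M" if "\<gamma> \<in> carrier \<Gamma>" for \<gamma>
    unfolding b_def[abs_def]
    by (rule cm.borel_measurable_lebesgue_integral) (rule meas_f_joint[OF that])
  ultimately have b: "b \<in> bounded_functions \<Gamma> M" unfolding bounded_functions_def by blast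
  have \<psi>_int: "\<psi> \<omega> (x + of_int k) = \<psi> \<omega> x + of_int k" if "\<omega> \<in> space M" for \<omega> x k
  proof -
    have "n \<omega> (x + of_int k) z = n \<omega> x z + of_int k" for z
    proof -
      have "x + of_int k - rep (\<phi> \<omega> z) = x - rep (\<phi> \<omega> z) + of_int k" by simp
      then show ?thesis unfolding n_def by (metis ceiling_add_of_int of_int_add)
    qed
    then have "\<psi> \<omega> (x + of_int k) = (\<integral>z. n \<omega> x z + of_int k \<partial>circle_measure)"
      by (simp add: \<psi>_def)
    also have "\<dots> = \<psi> \<omega> x + of_int k"
      unfolding \<psi>_def by (subst Bochner_Integration.integral_add) (simp_all add: int_n[OF that] cm.prob_space)
    finally show ?thesis .
  qed
  have equivariant: "AE \<omega> in M. \<forall>x. \<psi> \<omega> (T \<gamma> \<omega> x) = \<psi> (act (inv\<^bsub>\<Gamma>\<^esub> \<gamma>) \<omega>) x + b \<gamma> \<omega>"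
    if g: "\<gamma> \<in> carrier \<Gamma>" for \<gamma>
    using eq[OF inv_closed[OF g]] AE_space
  proof eventually_elim
    case (elim \<omega>)
    let ?\<omega> = "act (inv\<^bsub>\<Gamma>\<^esub> \<gamma>) \<omega>"
    have w': "?\<omega> \<in> space M" using elim g by (intro act_space inv_closed)
    note lift_T = T_lift[OF g elim(2)]
    obtain \<theta> where \<theta>: "\<rho> (inv\<^bsub>\<Gamma>\<^esub> \<gamma>) \<omega> = (\<lambda>z. z + \<theta>)"
      using \<rho>[OF inv_closed[OF g] elim(2)] unfolding rotations_def by blast
    have \<phi>_eq: "\<phi> \<omega> z = \<tau> \<gamma> \<omega> (\<phi> ?\<omega> (z + \<theta>))" for z
    proof -
      have "\<sigma> (inv\<^bsub>\<Gamma>\<^esub> \<gamma>) \<omega> (\<phi> \<omega> z) = \<phi> ?\<omega> (z + \<theta>)" using elim(1) by (simp add: \<theta> fun_eq_iff)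
      then show ?thesis
        using \<sigma>_\<tau>(2)[OF inv_closed[OF g] elim(2)] group.inv_inv[OF group_Gamma g] by metis
    qed
    \<comment> \<open>Counting from \<open>T \<gamma> \<omega> x\<close> agrees with counting from
      \<open>x\<close> if the image of the old representative is the base point; replacing that
      point by the representative in [0,1) adds the integer \<open>f\<close>.\<close>
    have key: "n \<omega> (T \<gamma> \<omega> x) z = n ?\<omega> x (z + \<theta>) + f \<gamma> \<omega> (z + \<theta>)" for x z
    proof -
      let ?r = "rep (\<phi> ?\<omega> (z + \<theta>))"
      have "\<phi> \<omega> z = circle_of (T \<gamma> \<omega> ?r)"
        using lift_T(2) circle_of_rep unfolding \<phi>_eq is_lift_def by metis
      then have "rep (\<phi> \<omega> z) = T \<gamma> \<omega> ?r - of_int \<lfloor>T \<gamma> \<omega> ?r\<rfloor>" by (simp add: frac_def)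
      then have "T \<gamma> \<omega> x - rep (\<phi> \<omega> z) = (T \<gamma> \<omega> x - T \<gamma> \<omega> ?r) + of_int \<lfloor>T \<gamma> \<omega> ?r\<rfloor>" by simp
      then have "\<lceil>T \<gamma> \<omega> x - rep (\<phi> \<omega> z)\<rceil> = \<lceil>x - ?r\<rceil> + \<lfloor>T \<gamma> \<omega> ?r\<rfloor>"
        using ceiling_diff_Homeo_real[OF lift_T(1), of x ?r] by (metis ceiling_add_of_int)
      then show ?thesis by (simp add: n_def f_def)
    qed
    show ?case
    proof
      fix x
      have "\<psi> \<omega> (T \<gamma> \<omega> x) = (\<integral>z. n ?\<omega> x (z + \<theta>) + f \<gamma> \<omega> (z + \<theta>) \<partial>circle_measure)"
        unfolding \<psi>_def key ..
      \<comment> \<open>The unknown angle \<theta> disappears by rotation invariance; here it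
        matters that \<rho> consists of rotations.\<close>
      also have "\<dots> = (\<integral>z. n ?\<omega> x z + f \<gamma> \<omega> z \<partial>circle_measure)"
        by (rule integral_circle_rotation) (intro borel_measurable_add meas_n[OF w'] meas_f[OF g elim(2)])
      also have "\<dots> = \<psi> ?\<omega> x + b \<gamma> \<omega>"
        unfolding \<psi>_def b_def by (rule Bochner_Integration.integral_add[OF int_n[OF w'] int_f[OF g elim(2)]])
      finally show "\<psi> \<omega> (T \<gamma> \<omega> x) = \<psi> ?\<omega> x + b \<gamma> \<omega>" .
    qed
  qed
  \<comment> \<open>The value of \<open>\<psi> \<omega>\<close> at the composite of two lifts at 0
    is computed twice: by applying equivariance twice, and by merging the lifts into that of the
    product first, at the cost of the integer \<open>pulled_euler\<close>, which \<psi> carries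
    through.\<close>
  have "AE \<omega> in M. pulled_euler \<gamma> \<eta> \<omega> = delta b \<gamma> \<eta> \<omega>" if g: "\<gamma> \<in> carrier \<Gamma>" "\<eta> \<in> carrier \<Gamma>" for \<gamma> \<eta>
    using equivariant[OF g(1)] equivariant[OF mult_closed[OF g]]
      AE_act[OF inv_closed[OF g(1)] equivariant[OF g(2)]] AE_T_mult[OF g] AE_space
  proof eventually_elim
    case (elim \<omega>)
    let ?\<omega> = "act (inv\<^bsub>\<Gamma>\<^esub> \<gamma>) \<omega>"
    have "\<psi> \<omega> (T \<gamma> \<omega> (T \<eta> ?\<omega> 0)) = \<psi> (act (inv\<^bsub>\<Gamma>\<^esub> \<eta>) ?\<omega>) 0 + b \<eta> ?\<omega> + b \<gamma> \<omega>"
      using elim(1,3) by simp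
    moreover have "\<psi> \<omega> (T \<gamma> \<omega> (T \<eta> ?\<omega> 0)) = \<psi> \<omega> (T (\<gamma> \<otimes>\<^bsub>\<Gamma>\<^esub> \<eta>) \<omega> 0) + pulled_euler \<gamma> \<eta> \<omega>"
      using elim(4) \<psi>_int[OF elim(5)] by (simp add: pulled_euler_def)
    moreover have "\<psi> \<omega> (T (\<gamma> \<otimes>\<^bsub>\<Gamma>\<^esub> \<eta>) \<omega> 0) = \<psi> (act (inv\<^bsub>\<Gamma>\<^esub> \<eta>) ?\<omega>) 0 + b (\<gamma> \<otimes>\<^bsub>\<Gamma>\<^esub> \<eta>) \<omega>"
      using elim(2) act_inv_mult[OF g elim(5)] by simp
    ultimately show ?case by (simp add: delta_def)
  qed
  with b show ?thesis using that by blast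
qed

lemma trivial_imp_semicohomologous:
  assumes countable: "countable (carrier \<Gamma>)"
    and b: "b \<in> bounded_functions \<Gamma> M"
    and triv: "\<And>\<gamma> \<eta>. \<gamma> \<in> carrier \<Gamma> \<Longrightarrow> \<eta> \<in> carrier \<Gamma> \<Longrightarrow> AE \<omega> in M. pulled_euler \<gamma> \<eta> \<omega> = delta b \<gamma> \<eta> \<omega>"
  shows "\<exists>\<rho>. measurable_cocycle \<Gamma> M act \<rho> \<and> (\<forall>\<gamma> \<in> carrier \<Gamma>. \<forall>\<omega> \<in> space M. \<rho> \<gamma> \<omega> \<in> rotations)
    \<and> semicohomologous \<Gamma> M act \<sigma> \<rho>"
proof -
  note inv_inv = group.inv_inv[OF group_Gamma]
  have meas_b: "b \<gamma> \<in> borel_measurable M" if "\<gamma> \<in> carrier \<Gamma>" for \<gamma>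
    using b that by (simp add: bounded_functions_def)
  obtain C where C: "\<And>\<gamma> \<omega>. \<gamma> \<in> carrier \<Gamma> \<Longrightarrow> \<omega> \<in> space M \<Longrightarrow> \<bar>b \<gamma> \<omega>\<bar> \<le> C"
    using b unfolding bounded_functions_def by blast
  have ne: "carrier \<Gamma> \<noteq> {}" using monoid.one_closed[OF group.is_monoid[OF group_Gamma]] by blast
  define f where "f \<gamma> \<omega> y = T \<gamma> \<omega> (y - b \<gamma> \<omega>)" for \<gamma> \<omega> y
  define \<phi> where "\<phi> \<omega> y = (SUP \<gamma>\<in>carrier \<Gamma>. f \<gamma> \<omega> y)" for \<omega> y
  have near: "\<bar>f \<gamma> \<omega> y - y\<bar> \<le> C + 2" if "\<gamma> \<in> carrier \<Gamma>" "\<omega> \<in> space M" for \<gamma> \<omega> y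
    unfolding f_def using T_displacement[OF that, of "y - b \<gamma> \<omega>"] C[OF that] by linarith
  have bdd: "bdd_above ((\<lambda>\<gamma>. f \<gamma> \<omega> y) ` carrier \<Gamma>)" if "\<omega> \<in> space M" for \<omega> y
  proof (intro bdd_aboveI2)
    show "f \<gamma> \<omega> y \<le> y + (C + 2)" if "\<gamma> \<in> carrier \<Gamma>" for \<gamma>
      using near[OF that \<open>\<omega> \<in> space M\<close>, of y] by linarith
  qed
  have \<phi>_near: "\<bar>\<phi> \<omega> y - y\<bar> \<le> C + 2" if w: "\<omega> \<in> space M" for \<omega> y
  proof -
    obtain \<gamma> where \<gamma>: "\<gamma> \<in> carrier \<Gamma>" using ne by blast
    have "f \<gamma> \<omega> y \<le> \<phi> \<omega> y" unfolding \<phi>_def by (rule cSUP_upper[OF \<gamma> bdd[OF w]])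
    moreover have "\<phi> \<omega> y \<le> y + (C + 2)"
      unfolding \<phi>_def
    proof (rule cSUP_least[OF ne])
      show "f \<gamma> \<omega> y \<le> y + (C + 2)" if "\<gamma> \<in> carrier \<Gamma>" for \<gamma> using near[OF that w, of y] by linarith
    qed
    ultimately show ?thesis using near[OF \<gamma> w, of y] by linarith
  qed
  have \<phi>_mono: "mono (\<phi> \<omega>)" if w: "\<omega> \<in> space M" for \<omega>
  proof (rule monoI)
    fix x y :: real assume "x \<le> y"
    then show "\<phi> \<omega> x \<le> \<phi> \<omega> y"
      unfolding \<phi>_def f_def
      by (intro cSUP_mono[OF ne bdd[OF w, unfolded f_def]])
        (auto simp: Homeo_real_le[OF T_lift(1)[OF _ w]] intro: rev_bexI)
  qed
  have \<phi>_one: "\<phi> \<omega> (y + 1) = \<phi> \<omega> y + 1" if w: "\<omega> \<in> space M" for \<omega> y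
  proof -
    have "f \<gamma> \<omega> (y + 1) = f \<gamma> \<omega> y + 1" if "\<gamma> \<in> carrier \<Gamma>" for \<gamma>
      using Homeo_realD(3)[OF T_lift(1)[OF that w], of "y - b \<gamma> \<omega>"] by (simp add: f_def algebra_simps)
    then have "\<phi> \<omega> (y + 1) = (SUP \<gamma>\<in>carrier \<Gamma>. f \<gamma> \<omega> y + 1)"
      unfolding \<phi>_def by (intro SUP_cong) auto
    also have "\<dots> = \<phi> \<omega> y + 1"
      using Homeo_real_cSUP[OF Homeo_real_translate[OF Homeo_real_id, of 1] ne bdd[OF w, of y]]
      by (simp add: \<phi>_def)
    finally show ?thesis .
  qed
  have \<phi>_meas: "(\<lambda>(y, \<omega>). \<phi> \<omega> y) \<in> borel_measurable (borel \<Otimes>\<^sub>M M)"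
    unfolding \<phi>_def case_prod_beta'
  proof (rule borel_measurable_cSUP[OF countable])
    fix \<gamma> assume g: "\<gamma> \<in> carrier \<Gamma>"
    have [measurable]: "(\<lambda>p. b \<gamma> (snd p)) \<in> borel_measurable (borel \<Otimes>\<^sub>M M)"
      by (rule measurable_compose[OF measurable_snd meas_b[OF g]])
    show "(\<lambda>p. f \<gamma> (snd p) (fst p)) \<in> borel_measurable (borel \<Otimes>\<^sub>M M)"
      unfolding f_def T_def
      by (rule measurable_euler_section_eval[OF measurable_compose[OF measurable_snd measurable_\<tau>[OF g]]])
        measurable
  next
    fix p :: "real \<times> 'w" assume "p \<in> space (borel \<Otimes>\<^sub>M M)"
    then show "bdd_above ((\<lambda>\<gamma>. f \<gamma> (snd p) (fst p)) ` carrier \<Gamma>)"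
      using bdd by (auto simp: space_pair_measure)
  qed
  \<comment> \<open>A single null set for all pairs: at a fixed \<omega>, the supremum compares
    \<gamma> with every \<eta> simultaneously.\<close>
  have AE_T: "AE \<omega> in M. \<forall>\<gamma>\<in>carrier \<Gamma>. \<forall>\<eta>\<in>carrier \<Gamma>.
      (\<forall>x. T \<gamma> \<omega> (T \<eta> (act (inv\<^bsub>\<Gamma>\<^esub> \<gamma>) \<omega>) x) = T (\<gamma> \<otimes>\<^bsub>\<Gamma>\<^esub> \<eta>) \<omega> x + pulled_euler \<gamma> \<eta> \<omega>)
      \<and> pulled_euler \<gamma> \<eta> \<omega> = delta b \<gamma> \<eta> \<omega>"
    unfolding AE_ball_countable[OF countable] using AE_T_mult triv by auto
  have \<phi>_equivariant: "AE \<omega> in M. \<forall>\<gamma>\<in>carrier \<Gamma>. \<forall>y.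
      \<phi> \<omega> (y + b \<gamma> \<omega>) = T \<gamma> \<omega> (\<phi> (act (inv\<^bsub>\<Gamma>\<^esub> \<gamma>) \<omega>) y)"
    using AE_T AE_space
  proof eventually_elim
    case (elim \<omega>)
    show ?case
    proof (intro ballI allI)
      fix \<gamma> y assume g: "\<gamma> \<in> carrier \<Gamma>"
      let ?\<omega> = "act (inv\<^bsub>\<Gamma>\<^esub> \<gamma>) \<omega>"
      have w': "?\<omega> \<in> space M" using elim g by (intro act_space inv_closed)
      have step: "T \<gamma> \<omega> (f \<eta> ?\<omega> y) = f (\<gamma> \<otimes>\<^bsub>\<Gamma>\<^esub> \<eta>) \<omega> (y + b \<gamma> \<omega>)" if h: "\<eta> \<in> carrier \<Gamma>" for \<eta>
      proof -
        \<comment> \<open>\<open>T\<close> commutes with integer translations only, so it matters that \<open>delta b \<gamma> \<eta> \<omega>\<close> is an integer\<close>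
        let ?k = "euler_cocycle (\<tau> \<gamma> \<omega>) (\<tau> \<eta> ?\<omega>)"
        have k: "of_int ?k = delta b \<gamma> \<eta> \<omega>"
          using elim(1) g h by (simp add: pulled_euler_def)
        have "T \<gamma> \<omega> (f \<eta> ?\<omega> y) = T (\<gamma> \<otimes>\<^bsub>\<Gamma>\<^esub> \<eta>) \<omega> (y - b \<eta> ?\<omega>) + of_int ?k"
          using elim(1) g h by (simp add: f_def pulled_euler_def)
        also have "\<dots> = T (\<gamma> \<otimes>\<^bsub>\<Gamma>\<^esub> \<eta>) \<omega> (y - b \<eta> ?\<omega> + of_int ?k)"
          by (rule Homeo_real_int[OF T_lift(1)[OF mult_closed[OF g h] elim(2)], symmetric])
        finally show ?thesis unfolding k by (simp add: f_def delta_def algebra_simps)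
      qed
      \<comment> \<open>Left multiplication by \<gamma> permutes the index set, so the supremum over
        the products is the full supremum.\<close>
      have surj: "(\<lambda>\<eta>. \<gamma> \<otimes>\<^bsub>\<Gamma>\<^esub> \<eta>) ` carrier \<Gamma> = carrier \<Gamma>"
        by (rule group.surj_const_mult[OF group_Gamma g])
      have "T \<gamma> \<omega> (\<phi> ?\<omega> y) = (SUP \<eta>\<in>carrier \<Gamma>. T \<gamma> \<omega> (f \<eta> ?\<omega> y))"
        unfolding \<phi>_def by (rule Homeo_real_cSUP[OF T_lift(1)[OF g elim(2)] ne bdd[OF w']])
      also have "\<dots> = (SUP \<eta>\<in>carrier \<Gamma>. f (\<gamma> \<otimes>\<^bsub>\<Gamma>\<^esub> \<eta>) \<omega> (y + b \<gamma> \<omega>))"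
        using step by (intro SUP_cong) auto
      also have "\<dots> = (SUP \<eta>\<in>(\<lambda>\<eta>. \<gamma> \<otimes>\<^bsub>\<Gamma>\<^esub> \<eta>) ` carrier \<Gamma>. f \<eta> \<omega> (y + b \<gamma> \<omega>))"
        by (simp add: image_image)
      also have "\<dots> = \<phi> \<omega> (y + b \<gamma> \<omega>)" unfolding surj \<phi>_def ..
      finally show "\<phi> \<omega> (y + b \<gamma> \<omega>) = T \<gamma> \<omega> (\<phi> ?\<omega> y)" by simp
    qed
  qed
  define \<psi> where "\<psi> \<omega> = upper_inverse (\<phi> \<omega>)" for \<omega>
  have \<psi>_meas: "(\<lambda>(x, \<omega>). \<psi> \<omega> x) \<in> borel_measurable (borel \<Otimes>\<^sub>M M)"
    unfolding \<psi>_def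
  proof (rule measurable_upper_inverse)
    show "(\<lambda>\<omega>. \<phi> \<omega> x) \<in> borel_measurable M" for x
      using measurable_compose[OF measurable_Pair1' \<phi>_meas, of x] by simp
  qed (use \<phi>_near \<phi>_mono in auto)
  \<comment> \<open>The inverse matches \<open>T\<close>, which lifts the inverse of \<sigma> at the
    inverse element; inverting the translation by \<open>b\<close> gives the sign.\<close>
  define \<rho> where "\<rho> \<gamma> \<omega> z = z + circle_of (- b (inv\<^bsub>\<Gamma>\<^esub> \<gamma>) \<omega>)" for \<gamma> \<omega> z
  have \<rho>_cocycle: "measurable_cocycle \<Gamma> M act \<rho>"
    unfolding measurable_cocycle_def
  proof (intro conjI ballI)
    show "(\<lambda>(\<gamma>, \<omega>). \<rho> \<gamma> \<omega>) \<in> count_space (carrier \<Gamma>) \<Otimes>\<^sub>M M \<rightarrow>\<^sub>M Homeo_borel"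
    proof (rule measurable_pair_measure_countable1[OF countable])
      fix \<gamma> assume g: "\<gamma> \<in> carrier \<Gamma>"
      have "\<rho> \<gamma> \<in> M \<rightarrow>\<^sub>M Homeo_borel"
      proof (rule measurable_Homeo_borelI)
        show "(\<lambda>x. x + - b (inv\<^bsub>\<Gamma>\<^esub> \<gamma>) \<omega>) \<in> Homeo_real" for \<omega>
          by (rule Homeo_real_translate[OF Homeo_real_id])
        show "is_lift (\<lambda>x. x + - b (inv\<^bsub>\<Gamma>\<^esub> \<gamma>) \<omega>) (\<rho> \<gamma> \<omega>)" for \<omega>
          unfolding \<rho>_def by (rule is_lift_rotation)
        show "(\<lambda>\<omega>. x + - b (inv\<^bsub>\<Gamma>\<^esub> \<gamma>) \<omega>) \<in> borel_measurable M" for x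
          using meas_b[OF inv_closed[OF g]] by measurable
      qed
      then show "(\<lambda>\<omega>. case (\<gamma>, \<omega>) of (\<gamma>, \<omega>) \<Rightarrow> \<rho> \<gamma> \<omega>) \<in> M \<rightarrow>\<^sub>M Homeo_borel" by simp
    qed
  next
    fix \<gamma> \<eta> assume g: "\<gamma> \<in> carrier \<Gamma>" "\<eta> \<in> carrier \<Gamma>"
    show "AE \<omega> in M. \<rho> (\<gamma> \<otimes>\<^bsub>\<Gamma>\<^esub> \<eta>) \<omega> = \<rho> \<gamma> (act \<eta> \<omega>) \<circ> \<rho> \<eta> \<omega>"
      using triv[OF inv_closed[OF g(2)] inv_closed[OF g(1)]]
    proof eventually_elim
      case (elim \<omega>)
      \<comment> \<open>As a real-valued function \<open>b\<close> satisfies the cocycle identity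
        only up to \<open>delta b\<close>; this is an integer almost everywhere, so the rotations
        satisfy it exactly.\<close>
      obtain k :: int where "delta b (inv\<^bsub>\<Gamma>\<^esub> \<eta>) (inv\<^bsub>\<Gamma>\<^esub> \<gamma>) \<omega> = of_int k"
        using elim unfolding pulled_euler_def by metis
      then have k: "- b (inv\<^bsub>\<Gamma>\<^esub> (\<gamma> \<otimes>\<^bsub>\<Gamma>\<^esub> \<eta>)) \<omega>
          = (- b (inv\<^bsub>\<Gamma>\<^esub> \<eta>) \<omega> + - b (inv\<^bsub>\<Gamma>\<^esub> \<gamma>) (act \<eta> \<omega>)) + of_int k"
        using g by (simp add: delta_def inv_inv group.inv_mult_group[OF group_Gamma])
      show ?case unfolding \<rho>_def k circle_of_add_int circle_of_add by (simp add: fun_eq_iff add.assoc)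
    qed
  qed
  have "left_semicohomologous \<Gamma> M act \<sigma> \<rho>"
    unfolding left_semicohomologous_def
  proof (intro exI[of _ "\<lambda>\<omega>. descend (\<phi> \<omega>)"] conjI ballI)
    show "(\<lambda>(x, \<omega>). descend (\<phi> \<omega>) x) \<in> borel \<Otimes>\<^sub>M M \<rightarrow>\<^sub>M borel" by (rule measurable_descend[OF \<phi>_meas])
    show "AE \<omega> in M. nondecreasing_degree_one (descend (\<phi> \<omega>))"
      using AE_space by eventually_elim (intro nondecreasing_degree_one_descend \<phi>_mono \<phi>_one)
    fix \<gamma> assume g: "\<gamma> \<in> carrier \<Gamma>"
    show "AE \<omega> in M. \<sigma> \<gamma> \<omega> \<circ> descend (\<phi> \<omega>) = descend (\<phi> (act \<gamma> \<omega>)) \<circ> \<rho> \<gamma> \<omega>"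
      using \<phi>_equivariant AE_space
    proof eventually_elim
      case (elim \<omega>)
      let ?\<omega> = "act \<gamma> \<omega>" and ?b = "b (inv\<^bsub>\<Gamma>\<^esub> \<gamma>) \<omega>"
      have w': "?\<omega> \<in> space M" using elim g by (intro act_space)
      have lift: "descend (\<phi> \<omega>) (circle_of x) = circle_of (\<phi> \<omega> x)"
        "descend (\<phi> ?\<omega>) (circle_of x) = circle_of (\<phi> ?\<omega> x)" for x
        using is_lift_descend[of "\<phi> \<omega>", OF \<phi>_one[OF elim(2)]]
          is_lift_descend[of "\<phi> ?\<omega>", OF \<phi>_one[OF w']]
        by (simp_all add: is_lift_def)
      show ?case
      proof
        fix z
        obtain x where x: "z = circle_of x" by (rule circle_of_exhaust)
        have "\<phi> \<omega> x = T (inv\<^bsub>\<Gamma>\<^esub> \<gamma>) \<omega> (\<phi> ?\<omega> (x - ?b))"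
          using elim(1)[rule_format, OF inv_closed[OF g], of "x - ?b"] by (simp add: inv_inv g)
        then have "circle_of (\<phi> \<omega> x) = \<tau> (inv\<^bsub>\<Gamma>\<^esub> \<gamma>) \<omega> (circle_of (\<phi> ?\<omega> (x - ?b)))"
          using T_lift(2)[OF inv_closed[OF g] elim(2)] by (simp add: is_lift_def)
        then have "\<sigma> \<gamma> \<omega> (circle_of (\<phi> \<omega> x)) = circle_of (\<phi> ?\<omega> (x - ?b))"
          by (simp add: \<sigma>_\<tau>(1)[OF g elim(2)])
        moreover have "\<rho> \<gamma> \<omega> z = circle_of (x - ?b)"
          unfolding x \<rho>_def circle_of_add[symmetric] by simp
        ultimately show "(\<sigma> \<gamma> \<omega> \<circ> descend (\<phi> \<omega>)) z = (descend (\<phi> ?\<omega>) \<circ> \<rho> \<gamma> \<omega>) z"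
          by (simp add: lift x)
      qed
    qed
  qed
  moreover have "left_semicohomologous \<Gamma> M act \<rho> \<sigma>"
    unfolding left_semicohomologous_def
  proof (intro exI[of _ "\<lambda>\<omega>. descend (\<psi> \<omega>)"] conjI ballI)
    have \<psi>_one: "\<psi> \<omega> (x + 1) = \<psi> \<omega> x + 1" if "\<omega> \<in> space M" for \<omega> x
      unfolding \<psi>_def by (rule upper_inverse_degree_one[OF \<phi>_near[OF that] \<phi>_one[OF that]])
    show "(\<lambda>(x, \<omega>). descend (\<psi> \<omega>) x) \<in> borel \<Otimes>\<^sub>M M \<rightarrow>\<^sub>M borel" by (rule measurable_descend[OF \<psi>_meas])
    have \<psi>_mono: "mono (\<psi> \<omega>)" if "\<omega> \<in> space M" for \<omega>
      unfolding \<psi>_def by (rule upper_inverse_mono[OF \<phi>_near[OF that]])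
    show "AE \<omega> in M. nondecreasing_degree_one (descend (\<psi> \<omega>))"
      using AE_space by eventually_elim (intro nondecreasing_degree_one_descend \<psi>_mono \<psi>_one)
    fix \<gamma> assume g: "\<gamma> \<in> carrier \<Gamma>"
    show "AE \<omega> in M. \<rho> \<gamma> \<omega> \<circ> descend (\<psi> \<omega>) = descend (\<psi> (act \<gamma> \<omega>)) \<circ> \<sigma> \<gamma> \<omega>"
      using \<phi>_equivariant AE_space
    proof eventually_elim
      case (elim \<omega>)
      let ?\<omega> = "act \<gamma> \<omega>" and ?b = "b (inv\<^bsub>\<Gamma>\<^esub> \<gamma>) \<omega>" and ?T = "T (inv\<^bsub>\<Gamma>\<^esub> \<gamma>) \<omega>"
      have w': "?\<omega> \<in> space M" using elim g by (intro act_space)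
      note lift_T = T_lift[OF inv_closed[OF g] elim(2)]
      have lift: "descend (\<psi> \<omega>) (circle_of x) = circle_of (\<psi> \<omega> x)"
        "descend (\<psi> ?\<omega>) (circle_of x) = circle_of (\<psi> ?\<omega> x)" for x
        using is_lift_descend[of "\<psi> \<omega>", OF \<psi>_one[OF elim(2)]]
          is_lift_descend[of "\<psi> ?\<omega>", OF \<psi>_one[OF w']]
        by (simp_all add: is_lift_def)
      \<comment> \<open>Since \<open>T\<close> preserves and reflects order, equivariance of \<phi>
        identifies the sublevel sets over the two fibres up to translation by
        \<open>b\<close>.\<close>
      have \<psi>_eq: "\<psi> \<omega> (?T x) = \<psi> ?\<omega> x + ?b" for x
        unfolding \<psi>_def
      proof (rule upper_inverse_equivariant[OF \<phi>_near[OF w'] \<phi>_near[OF elim(2)]])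
        fix y
        have "\<phi> \<omega> (y + ?b) = ?T (\<phi> ?\<omega> y)"
          using elim(1)[rule_format, OF inv_closed[OF g], of y] by (simp add: inv_inv g)
        then show "\<phi> \<omega> (y + ?b) \<le> ?T x \<longleftrightarrow> \<phi> ?\<omega> y \<le> x" by (simp add: Homeo_real_le[OF lift_T(1)])
      qed
      show ?case
      proof
        fix z
        obtain x where x: "\<sigma> \<gamma> \<omega> z = circle_of x" by (rule circle_of_exhaust)
        have "z = \<tau> (inv\<^bsub>\<Gamma>\<^esub> \<gamma>) \<omega> (circle_of x)" using \<sigma>_\<tau>(2)[OF g elim(2), of z] x by simp
        then have z: "z = circle_of (?T x)" using lift_T(2) by (simp add: is_lift_def)
        have "descend (\<psi> \<omega>) z = circle_of (\<psi> ?\<omega> x + ?b)" unfolding z lift \<psi>_eq ..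
        then have "\<rho> \<gamma> \<omega> (descend (\<psi> \<omega>) z) = circle_of (\<psi> ?\<omega> x)"
          unfolding \<rho>_def by (simp add: circle_of_add[symmetric])
        then show "(\<rho> \<gamma> \<omega> \<circ> descend (\<psi> \<omega>)) z = (descend (\<psi> ?\<omega>) \<circ> \<sigma> \<gamma> \<omega>) z"
          by (simp add: x lift)
      qed
    qed
  qed
  ultimately have "semicohomologous \<Gamma> M act \<sigma> \<rho>" unfolding semicohomologous_def ..
  moreover have "\<forall>\<gamma>\<in>carrier \<Gamma>. \<forall>\<omega>\<in>space M. \<rho> \<gamma> \<omega> \<in> rotations"
    unfolding rotations_def \<rho>_def[abs_def] by blast
  ultimately show ?thesis using \<rho>_cocycle by blast
qed

end

theorem proposition2:
  fixes \<Gamma> :: "'g monoid" and M :: "'w measure"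
    and act :: "'g \<Rightarrow> 'w \<Rightarrow> 'w"
    and \<sigma> :: "'g \<Rightarrow> 'w \<Rightarrow> circle \<Rightarrow> circle"
  assumes "group \<Gamma>" and "finitely_generated \<Gamma>"
    and "standard_borel_probability_space_action \<Gamma> M act"
    and "measurable_cocycle \<Gamma> M act \<sigma>"
  shows "induced_map2 \<Gamma> M act \<sigma> real_euler_class
           = \<one>\<^bsub>bounded_cohomology \<Gamma> (Linf \<Gamma> M act) 2\<^esub>
     \<longleftrightarrow> (\<exists>\<rho>. measurable_cocycle \<Gamma> M act \<rho>
           \<and> (\<forall>\<gamma> \<in> carrier \<Gamma>. \<forall>\<omega> \<in> space M. \<rho> \<gamma> \<omega> \<in> rotations)
           \<and> semicohomologous \<Gamma> M act \<sigma> \<rho>)"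
proof -
  interpret circle_cocycle \<Gamma> M act \<sigma>
    using assms(3,4) by (simp add: circle_cocycle_def circle_cocycle_axioms_def)
  \<comment> \<open>Finite generation enters as countability of the group.\<close>
  have countable: "countable (carrier \<Gamma>)"
    using assms(2) group.countable_generate[OF assms(1)] countable_finite
    unfolding finitely_generated_def by metis
  show ?thesis
    unfolding euler_class_trivial_iff
  proof
    assume "\<exists>b\<in>bounded_functions \<Gamma> M. \<forall>\<gamma>\<in>carrier \<Gamma>. \<forall>\<eta>\<in>carrier \<Gamma>.
      AE \<omega> in M. pulled_euler \<gamma> \<eta> \<omega> = delta b \<gamma> \<eta> \<omega>"
    then show "\<exists>\<rho>. measurable_cocycle \<Gamma> M act \<rho>
        \<and> (\<forall>\<gamma> \<in> carrier \<Gamma>. \<forall>\<omega> \<in> space M. \<rho> \<gamma> \<omega> \<in> rotations) \<and> semicohomologous \<Gamma> M act \<sigma> \<rho>"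
      using trivial_imp_semicohomologous[OF countable] by blast
  next
    assume "\<exists>\<rho>. measurable_cocycle \<Gamma> M act \<rho>
        \<and> (\<forall>\<gamma> \<in> carrier \<Gamma>. \<forall>\<omega> \<in> space M. \<rho> \<gamma> \<omega> \<in> rotations) \<and> semicohomologous \<Gamma> M act \<sigma> \<rho>"
    then obtain \<rho> where "\<And>\<gamma> \<omega>. \<gamma> \<in> carrier \<Gamma> \<Longrightarrow> \<omega> \<in> space M \<Longrightarrow> \<rho> \<gamma> \<omega> \<in> rotations"
      "left_semicohomologous \<Gamma> M act \<sigma> \<rho>"
      unfolding semicohomologous_def by blast
    from semicohomologous_imp_trivial[OF this]
    show "\<exists>b\<in>bounded_functions \<Gamma> M. \<forall>\<gamma>\<in>carrier \<Gamma>. \<forall>\<eta>\<in>carrier \<Gamma>.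
        AE \<omega> in M. pulled_euler \<gamma> \<eta> \<omega> = delta b \<gamma> \<eta> \<omega>" by metis
  qed
qed

end
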